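(* Let $\tilde W\in C^2([0,\infty))$ satisfy $\tilde W(0)=0$, $\tilde W\ge0$, $\tilde W''\ge0$ on $(0,\infty)$. (a) If $N\ge7$, then for every $\eta>0$ the system (MM) has no solution $(\tilde f_\eta,g_\eta)$ with $g_\eta>0$ in $(0,1)$. (b) If $2\le N\le6$, then for every $\eta>0$ the system (MM) has a unique solution $(\tilde f_\eta,g_\eta)$ with $g_\eta>0$ in $(0,1)$. Moreover $(\tilde f_\eta,\pm g_\eta)$ are the only two minimizers of $I^{MM}_\eta$ in $\mathcal B^{MM}$, $\tilde f_\eta/r,g_\eta\in C^2([0,1])$, and $\tilde f_\eta>0$, $\tilde f_\eta'>0$, $g_\eta'<0$ in $(0,1)$. In addition, for $3\le N\le6$, the non-escaping solution $(1,0)$ is an unstable critical point of $I^{MM}_\eta$ in $\mathcal B^{MM}$.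
   Context: $r=|x|$, $n=x/|x|$, $B^N$ unit ball in $\mathbb R^N$. System (MM) for $(f,g)$: $f^2+g^2=1$ in $(0,1)$; $f''+\frac{N-1}rf'-\frac{N-1}{r^2}f=-\lambda f$, $g''+\frac{N-1}rg'=\frac1{\eta^2}\tilde W'(g^2)g-\lambda g$ in $(0,1)$ with $\lambda=(f')^2+\frac{N-1}{r^2}f^2+(g')^2+\frac1{\eta^2}\tilde W'(g^2)g^2$; $f(1)=1$, $g(1)=0$; and $(f(|x|)n,g(|x|))\in H^1(B^N,\mathbb S^N)$. $I^{MM}_\eta[f,g]=\frac12\int_0^1\big[(f')^2+(g')^2+\frac{N-1}{r^2}f^2+\frac1{\eta^2}\tilde W(g^2)\big]r^{N-1}dr$ on $\mathcal B^{MM}=\{(f,g): r^{\frac{N-1}2}f',r^{\frac{N-3}2}f,r^{\frac{N-1}2}g',r^{\frac{N-1}2}g\in L^2(0,1),f^2+g^2=1,f(1)=1,g(1)=0\}$. Unstable for $(1,0)$ means there is $q\in \mathrm{Lip}_c(0,1)$ with $\int_0^1\big[(q')^2-\frac{N-1}{r^2}q^2+\frac{\tilde W'(0)}{\eta^2}q^2\big]r^{N-1}dr<0$ (this is the second variation $\frac{d^2}{dt^2}|_{t=0}I^{MM}_\eta[(1,tq)/\sqrt{1+t^2q^2}]$). *)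

theory Defs
  imports "HOL-Analysis.Analysis"
begin

text \<open>Radial admissible class (the set B^MM), with f', g' weak (a.e.) derivatives:
  f, g locally absolutely continuous on (0,1) with derivatives f', g';
  weighted L2 conditions; f^2+g^2=1; boundary values f(1)=1, g(1)=0 as traces.\<close>
definition BMM :: "nat \<Rightarrow> (real \<Rightarrow> real) \<Rightarrow> (real \<Rightarrow> real) \<Rightarrow> (real \<Rightarrow> real) \<Rightarrow> (real \<Rightarrow> real) \<Rightarrow> bool" where
  "BMM N f f' g g' \<longleftrightarrow>
     (\<forall>a b. 0 < a \<and> a \<le> b \<and> b < 1 \<longrightarrow>
        (f' has_integral (f b - f a)) {a..b} \<and> (g' has_integral (g b - g a)) {a..b}) \<and>
     (\<lambda>r. (f' r)^2 * r^(N-1)) integrable_on {0<..<1} \<and>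
     (\<lambda>r. (f r)^2 / r^2 * r^(N-1)) integrable_on {0<..<1} \<and>
     (\<lambda>r. (g' r)^2 * r^(N-1)) integrable_on {0<..<1} \<and>
     (\<lambda>r. (g r)^2 * r^(N-1)) integrable_on {0<..<1} \<and>
     (\<forall>r\<in>{0<..<1}. (f r)^2 + (g r)^2 = 1) \<and>
     (f \<longlongrightarrow> 1) (at_left 1) \<and> (g \<longlongrightarrow> 0) (at_left 1)"

definition IMM :: "nat \<Rightarrow> real \<Rightarrow> (real \<Rightarrow> real) \<Rightarrow> (real \<Rightarrow> real) \<Rightarrow> (real \<Rightarrow> real) \<Rightarrow> (real \<Rightarrow> real) \<Rightarrow> (real \<Rightarrow> real) \<Rightarrow> real" where
  "IMM N \<eta> W f f' g g' = 1/2 * integral {0<..<1}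
     (\<lambda>r. ((f' r)^2 + (g' r)^2 + (real N - 1) / r^2 * (f r)^2 + W ((g r)^2) / \<eta>^2) * r^(N-1))"

definition MM_minimizer :: "nat \<Rightarrow> real \<Rightarrow> (real \<Rightarrow> real) \<Rightarrow> (real \<Rightarrow> real) \<Rightarrow> (real \<Rightarrow> real) \<Rightarrow> bool" where
  "MM_minimizer N \<eta> W f g \<longleftrightarrow>
     (\<exists>f' g'. BMM N f f' g g' \<and>
        (\<forall>h h' k k'. BMM N h h' k k' \<longrightarrow> IMM N \<eta> W f f' g g' \<le> IMM N \<eta> W h h' k k'))"

text \<open>Solutions of the system (MM); W1 is the derivative tilde W'.  The equations hold
  classically in (0,1); the H^1(B^N,S^N) condition is expressed through the radial
  weighted L2 conditions in BMM.\<close>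
definition MM_solution :: "nat \<Rightarrow> real \<Rightarrow> (real \<Rightarrow> real) \<Rightarrow> (real \<Rightarrow> real) \<Rightarrow> (real \<Rightarrow> real) \<Rightarrow> bool" where
  "MM_solution N \<eta> W1 f g \<longleftrightarrow>
     (\<exists>f1 f2 g1 g2.
        (\<forall>r\<in>{0<..<1}.
           (f has_real_derivative f1 r) (at r) \<and> (f1 has_real_derivative f2 r) (at r) \<and>
           (g has_real_derivative g1 r) (at r) \<and> (g1 has_real_derivative g2 r) (at r) \<and>
           (let lam = (f1 r)^2 + (real N - 1) / r^2 * (f r)^2 + (g1 r)^2
                      + W1 ((g r)^2) * (g r)^2 / \<eta>^2
            in f2 r + (real N - 1) / r * f1 r - (real N - 1) / r^2 * f r = - lam * f r \<and>
               g2 r + (real N - 1) / r * g1 r = W1 ((g r)^2) * g r / \<eta>^2 - lam * g r)) \<and>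
        BMM N f f1 g g1)"

definition Lipc_deriv :: "(real \<Rightarrow> real) \<Rightarrow> (real \<Rightarrow> real) \<Rightarrow> bool" where
  "Lipc_deriv q q' \<longleftrightarrow>
     (\<exists>L. L-lipschitz_on UNIV q) \<and>
     (\<exists>a b. 0 < a \<and> a < b \<and> b < 1 \<and> (\<forall>r. r \<notin> {a..b} \<longrightarrow> q r = 0)) \<and>
     (\<forall>s t. s \<le> t \<longrightarrow> (q' has_integral (q t - q s)) {s..t})"

definition unstable_trivial :: "nat \<Rightarrow> real \<Rightarrow> (real \<Rightarrow> real) \<Rightarrow> bool" where
  "unstable_trivial N \<eta> W1 \<longleftrightarrow>
     (\<exists>q q'. Lipc_deriv q q' \<and>
        integral {0<..<1} (\<lambda>r. ((q' r)^2 - (real N - 1) / r^2 * (q r)^2 + W1 0 / \<eta>^2 * (q r)^2) * r^(N-1)) < 0)"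

definition C2_closed01 :: "(real \<Rightarrow> real) \<Rightarrow> bool" where
  "C2_closed01 F \<longleftrightarrow>
     (\<exists>F1 F2. (\<forall>x\<in>{0..1}. (F has_real_derivative F1 x) (at x within {0..1}) \<and>
                           (F1 has_real_derivative F2 x) (at x within {0..1})) \<and>
              continuous_on {0..1} F2)"

end

theory Submission imports Defs begin

text \<open>Write \<open>f = sin \<theta>\<close>, \<open>g = cos \<theta>\<close>; the system becomes
  \<open>\<theta>'' + (N-1)/r \<theta>' = sin \<theta> cos \<theta> ((N-1)/r\<^sup>2 - W'(cos\<^sup>2 \<theta>)/\<eta>\<^sup>2)\<close> with \<open>\<theta>(1) = \<pi>/2\<close>. For every
  solution with \<open>g > 0\<close>, finite energy forces \<open>\<theta>\<close> to be monotone near \<open>0\<close>, and a Pohozaev-type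
  identity shows that it cannot stop increasing before reaching \<open>\<pi>/2\<close>; hence \<open>f, f' > 0 > g'\<close>.

  Such a solution is a minimizer: \<open>f\<close> and \<open>g\<close> are positive solutions of the linearised equations, so
  the energy excess of any competitor \<open>(h, k)\<close> is a sum of the squares \<open>(h' - (f'/f) h)\<^sup>2\<close> and
  \<open>(k' - (g'/g) k)\<^sup>2\<close>, of a boundary term that vanishes in the limit and of a term that is
  nonnegative by convexity of \<open>W\<close>. Vanishing of the first square gives \<open>h = f\<close>; this yields uniqueness.

  For \<open>N \<ge> 7\<close>, Hardy's inequality applied to \<open>\<pi>/2 - \<theta>\<close> excludes solutions, because
  \<open>(N-2)\<^sup>2/4 \<ge> N-1\<close>. For \<open>N \<le> 6\<close> the opposite inequality makes the linearisation at \<open>\<theta> = \<pi>/2\<close>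
  oscillate. Hence \<open>(1, 0)\<close> is unstable, and in the shooting problem \<open>\<theta> = r \<phi>\<close>, \<open>\<phi>(0) = a\<close>, the value \<open>\<pi>/2\<close> is
  reached before \<open>r = 1\<close> for large \<open>a\<close>; by continuity in \<open>a\<close> it is reached exactly at \<open>r = 1\<close> for
  some \<open>a\<close>.\<close>

section \<open>Integration by parts and a Gronwall lemma\<close>

text \<open>The angle is used because it removes both the constraint and the multiplier. Two
  obstacles shape the argument. At \<open>r = 0\<close> a solution is only known to have finite
  energy, and at \<open>r = 1\<close> the factor \<open>g\<close> in the denominator of the boundary
  term tends to 0. So estimates run on compact subintervals, and the inner endpoint is taken among
  radii where a finite integral forces the boundary quantity to be small. Competitors have merely
  weak derivatives, hence the product rule for indefinite integrals. Uniqueness is not read off the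
  shooting problem, which would require comparing different amplitudes. Every positive solution is a
  minimizer, and the equality case identifies any two of them; regularity is therefore checked only
  for the constructed solution. The dimension threshold comes from linearising at the angle
  \<open>pi/2\<close>, where the potential is \<open>(N-1)/r^2\<close> and Hardy's constant is
  \<open>(N-2)^2/4\<close>. These are equal at \<open>N = 4 + 2 sqrt 2\<close>, between 6 and
  7.\<close>

lemma gronwall_zero:
  fixes E E' :: "real \<Rightarrow> real"
  assumes "x \<le> y"
    and d: "\<And>r. x \<le> r \<Longrightarrow> r \<le> y \<Longrightarrow> (E has_real_derivative E' r) (at r)"
    and b: "\<And>r. x \<le> r \<Longrightarrow> r \<le> y \<Longrightarrow> \<bar>E' r\<bar> \<le> C * E r"
    and "E x = 0 \<or> E y = 0" and nn: "\<And>r. x \<le> r \<Longrightarrow> r \<le> y \<Longrightarrow> E r \<ge> 0"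
    and s: "x \<le> s" "s \<le> y"
  shows "E s = 0"
proof -
  have "E s \<le> 0"
    using \<open>E x = 0 \<or> E y = 0\<close>
  proof
    assume "E x = 0"
    \<comment> \<open>The bound on \<open>E'\<close> is two-sided: \<open>exp (- C r) E\<close> is
      nonincreasing and carries a zero forward, while \<open>exp (C r) E\<close> is nondecreasing
      and carries a zero backward.\<close>
    have "exp (- C * s) * E s \<le> exp (- C * x) * E x"
    proof (rule DERIV_nonpos_imp_nonincreasing[OF s(1)])
      fix r assume r: "x \<le> r" "r \<le> s"
      have "((\<lambda>r. exp (- C * r) * E r) has_real_derivative exp (- C * r) * (E' r - C * E r)) (at r)"
        using d[of r] r s by (auto intro!: derivative_eq_intros simp: algebra_simps)
      moreover have "exp (- C * r) * (E' r - C * E r) \<le> 0"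
        using b[of r] r s by (intro mult_nonneg_nonpos) auto
      ultimately show "\<exists>y. ((\<lambda>r. exp (- C * r) * E r) has_real_derivative y) (at r) \<and> y \<le> 0" by blast
    qed
    then show ?thesis using \<open>E x = 0\<close> by (simp add: mult_le_0_iff)
  next
    assume "E y = 0"
    have "exp (C * s) * E s \<le> exp (C * y) * E y"
    proof (rule DERIV_nonneg_imp_nondecreasing[OF s(2)])
      fix r assume r: "s \<le> r" "r \<le> y"
      have "((\<lambda>r. exp (C * r) * E r) has_real_derivative exp (C * r) * (E' r + C * E r)) (at r)"
        using d[of r] r s by (auto intro!: derivative_eq_intros simp: algebra_simps)
      moreover have "exp (C * r) * (E' r + C * E r) \<ge> 0"
        using b[of r] r s by (intro mult_nonneg_nonneg) auto
      ultimately show "\<exists>y. ((\<lambda>r. exp (C * r) * E r) has_real_derivative y) (at r) \<and> y \<ge> 0" by blast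
    qed
    then show ?thesis using \<open>E y = 0\<close> by (simp add: mult_le_0_iff)
  qed
  with nn[OF s] show ?thesis by simp
qed

text \<open>Two uniqueness arguments share the system \<open>u' = s v\<close>,
  \<open>v' = - m/r v + k (m/r^2 - w)\<close>: at the rest state \<open>f = 0\<close> with
  \<open>u = f\<close>, \<open>s = g\<close>, and at the angle \<open>pi/2\<close> with
  \<open>u = pi/2 - \<theta>\<close>, \<open>s = -1\<close>. The constant is finite because
  \<open>r\<close> stays above \<open>x > 0\<close>.\<close>

lemma damped_energy_bound:
  fixes u v m x r s k w M :: real
  assumes m: "m \<ge> 0" and x: "0 < x" "x \<le> r" and s: "\<bar>s\<bar> \<le> 1" and k: "\<bar>k\<bar> \<le> \<bar>u\<bar>"
    and w: "0 \<le> w" "w \<le> M"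
  shows "\<bar>2 * u * (s * v) + 2 * v * (- m / r * v + k * (m / r^2 - w))\<bar>
    \<le> (1 + 2 * m / x + m / x^2 + M) * (u^2 + v^2)"
proof -
  define E where "E = u^2 + v^2"
  have uv: "2 * \<bar>u\<bar> * \<bar>v\<bar> \<le> E"
    unfolding E_def using zero_le_power2[of "\<bar>u\<bar> - \<bar>v\<bar>"] by (simp add: power2_diff)
  have mr: "m / r \<le> m / x" "m / r^2 \<le> m / x^2" "0 \<le> m / r" "0 \<le> m / r^2"
    using m x by (auto intro!: divide_left_mono power_mono)
  have z: "\<bar>m / r^2 - w\<bar> \<le> m / x^2 + M" using mr w by linarith
  have tri: "\<bar>a - b + c\<bar> \<le> \<bar>a\<bar> + \<bar>b\<bar> + \<bar>c\<bar>" for a b c :: real by linarith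
  have "2 * u * (s * v) + 2 * v * (- m / r * v + k * (m / r^2 - w))
      = 2 * u * v * s - 2 * (m / r) * v^2 + 2 * k * v * (m / r^2 - w)"
    by (simp add: algebra_simps power2_eq_square)
  then have "\<bar>2 * u * (s * v) + 2 * v * (- m / r * v + k * (m / r^2 - w))\<bar>
      \<le> \<bar>2 * u * v * s\<bar> + \<bar>2 * (m / r) * v^2\<bar> + \<bar>2 * k * v * (m / r^2 - w)\<bar>"
    using tri by metis
  also have "\<bar>2 * u * v * s\<bar> = 2 * \<bar>u\<bar> * \<bar>v\<bar> * \<bar>s\<bar>" by (simp add: abs_mult)
  also have "\<dots> \<le> E * 1" by (rule mult_mono[OF uv s]) (auto simp: E_def)
  also have "\<bar>2 * (m / r) * v^2\<bar> = 2 * (m / r) * v^2" using m x by (simp add: abs_mult)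
  also have "\<dots> \<le> 2 * (m / x) * E"
    using mr m x by (intro mult_mono) (auto simp: E_def)
  also have "\<bar>2 * k * v * (m / r^2 - w)\<bar> = 2 * \<bar>k\<bar> * \<bar>v\<bar> * \<bar>m / r^2 - w\<bar>" by (simp add: abs_mult)
  also have "\<dots> \<le> 2 * \<bar>u\<bar> * \<bar>v\<bar> * \<bar>m / r^2 - w\<bar>"
    using k by (intro mult_right_mono) auto
  also have "\<dots> \<le> E * (m / x^2 + M)" by (rule mult_mono[OF uv z]) (auto simp: E_def)
  finally show ?thesis unfolding E_def[symmetric] by (simp add: algebra_simps)
qed

text \<open>Otherwise \<open>u\<close> would dominate a multiple of the non-integrable function \<open>1/r\<close>.\<close>
lemma integrable_small_near_0:
  fixes u :: "real \<Rightarrow> real"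
  assumes int: "u integrable_on {0<..<1}" and nn: "\<And>r. r \<in> {0<..<1} \<Longrightarrow> u r \<ge> 0"
    and "\<delta> > 0" "\<epsilon> > 0"
  shows "\<exists>r. 0 < r \<and> r < \<delta> \<and> r < 1 \<and> r * u r < \<epsilon>"
proof (rule ccontr)
  assume neg: "\<not> ?thesis"
  define b where "b = min \<delta> 1 / 2"
  have b: "0 < b" "b < \<delta>" "b < 1" using assms by (auto simp: b_def min_def)
  define I where "I = integral {0<..<1} u"
  define x where "x = b * exp (- (\<bar>I\<bar> + 1) / \<epsilon>)"
  have x: "0 < x" "x < b" using b \<open>\<epsilon>>0\<close> by (auto simp: x_def divide_neg_pos)
  have i1: "((\<lambda>r. \<epsilon> / r) has_integral (\<epsilon> * ln b - \<epsilon> * ln x)) {x..b}"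
    using x by (intro fundamental_theorem_of_calculus)
       (auto intro!: derivative_eq_intros simp: has_real_derivative_iff_has_vector_derivative[symmetric])
  have sub: "{x..b} \<subseteq> {0<..<1}" using x b by auto
  have i2: "u integrable_on {x..b}"
    by (rule integrable_on_subinterval[OF int sub])
  have "\<epsilon> / r \<le> u r" if "r \<in> {x..b}" for r
    using neg that x b by (force simp: not_less field_simps)
  then have "\<epsilon> * ln b - \<epsilon> * ln x \<le> integral {x..b} u"
    by (intro has_integral_le[OF i1 integrable_integral[OF i2]])
  also have "\<dots> \<le> I" unfolding I_def
    using nn by (intro integral_subset_le[OF sub i2 int]) auto
  finally have "\<epsilon> * ln b - \<epsilon> * ln x \<le> I" .
  moreover have "ln x = ln b - (\<bar>I\<bar> + 1) / \<epsilon>" unfolding x_def using b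
    by (subst ln_mult) (use \<open>\<epsilon>>0\<close> in \<open>auto simp: divide_simps\<close>)
  then have "\<epsilon> * ln b - \<epsilon> * ln x = \<bar>I\<bar> + 1" using \<open>\<epsilon>>0\<close> by (simp add: right_diff_distrib)
  ultimately show False by linarith
qed

lemma absint_mult_continuous:
  fixes u v :: "real \<Rightarrow> real"
  assumes "continuous_on {a..b} u" "v absolutely_integrable_on {a..b}"
  shows "(\<lambda>t. u t * v t) absolutely_integrable_on {a..b}"
proof -
  have "u \<in> borel_measurable (lebesgue_on {a..b})"
    by (rule continuous_imp_measurable_on_sets_lebesgue) (use assms in auto)
  moreover have "bounded (u ` {a..b})"
    using assms by (intro compact_imp_bounded compact_continuous_image) auto
  ultimately show ?thesis
    using assms by (intro absolutely_integrable_bounded_measurable_product_real) auto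
qed

text \<open>Integration by parts for indefinite integrals. On a short interval \<open>[x,y]\<close> the defect is
  \<open>\<integral> (u y - u t) v' t + (v x - v t) u' t dt\<close>, hence small relative to \<open>\<integral> \<bar>u'\<bar> + \<bar>v'\<bar>\<close>;
  this bound is additive, so Bolzano's bisection lemma propagates it to \<open>[a,b]\<close>.\<close>
lemma has_integral_product:
  fixes u v u' v' :: "real \<Rightarrow> real"
  assumes ab: "a \<le> b"
    and u: "\<And>x y. a \<le> x \<Longrightarrow> x \<le> y \<Longrightarrow> y \<le> b \<Longrightarrow> (u' has_integral (u y - u x)) {x..y}"
    and v: "\<And>x y. a \<le> x \<Longrightarrow> x \<le> y \<Longrightarrow> y \<le> b \<Longrightarrow> (v' has_integral (v y - v x)) {x..y}"
    and cu: "continuous_on {a..b} u" and cv: "continuous_on {a..b} v"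
    and au: "u' absolutely_integrable_on {a..b}" and av: "v' absolutely_integrable_on {a..b}"
  shows "((\<lambda>t. u t * v' t + v t * u' t) has_integral (u b * v b - u a * v a)) {a..b}"
proof -
  define d where "d = (\<lambda>t. u t * v' t + v t * u' t)"
  have ad: "d absolutely_integrable_on {a..b}"
    unfolding d_def using absint_mult_continuous[OF cu av] absint_mult_continuous[OF cv au]
    by (intro set_integral_add)
  define n where "n = (\<lambda>t. \<bar>u' t\<bar> + \<bar>v' t\<bar>)"
  have an: "n absolutely_integrable_on {a..b}"
    unfolding n_def using au av by (intro set_integral_add set_integrable_abs)
  have di: "d integrable_on {x..y}" if "a \<le> x" "y \<le> b" for x y
    using ad that set_lebesgue_integral_eq_integral(1) integrable_on_subinterval
    by (metis atLeastatMost_subset_iff)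
  have ni: "n integrable_on {x..y}" if "a \<le> x" "y \<le> b" for x y
    using an that set_lebesgue_integral_eq_integral(1) integrable_on_subinterval
    by (metis atLeastatMost_subset_iff)
  have vi: "v' absolutely_integrable_on {x..y}" "u' absolutely_integrable_on {x..y}" if "a \<le> x" "y \<le> b" for x y
    using that av au by (auto intro: absolutely_integrable_on_subinterval)
  have nn: "n t \<ge> 0" for t by (simp add: n_def)
  have key: "\<bar>u b * v b - u a * v a - integral {a..b} d\<bar> \<le> \<epsilon> * integral {a..b} n" if "\<epsilon> > 0" for \<epsilon>
  proof -
    define P where "P = (\<lambda>x y. a \<le> x \<and> x \<le> y \<and> y \<le> b \<longrightarrow>
        \<bar>u y * v y - u x * v x - integral {x..y} d\<bar> \<le> \<epsilon> * integral {x..y} n)"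
    have "P a b"
    proof (rule Bolzano[OF ab])
      fix x y z assume *: "P x y" "P y z" "x \<le> y" "y \<le> z"
      show "P x z" unfolding P_def
      proof safe
        assume r: "a \<le> x" "x \<le> z" "z \<le> b"
        have "integral {x..y} d + integral {y..z} d = integral {x..z} d"
             "integral {x..y} n + integral {y..z} n = integral {x..z} n"
          using * r di ni by (auto intro!: Henstock_Kurzweil_Integration.integral_combine)
        moreover have "\<bar>u y * v y - u x * v x - integral {x..y} d\<bar> \<le> \<epsilon> * integral {x..y} n"
          "\<bar>u z * v z - u y * v y - integral {y..z} d\<bar> \<le> \<epsilon> * integral {y..z} n"
          using * r by (auto simp: P_def)
        moreover have "\<epsilon> * integral {x..z} n = \<epsilon> * integral {x..y} n + \<epsilon> * integral {y..z} n"
          using calculation(2) by (metis distrib_left)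
        ultimately show "\<bar>u z * v z - u x * v x - integral {x..z} d\<bar> \<le> \<epsilon> * integral {x..z} n"
          by linarith
      qed
    next
      fix t0 assume t0: "a \<le> t0" "t0 \<le> b"
      obtain d1 where d1: "d1 > 0" "\<And>t. t \<in> {a..b} \<Longrightarrow> \<bar>t - t0\<bar> < d1 \<Longrightarrow> \<bar>u t - u t0\<bar> < \<epsilon>/2"
        using cu t0 \<open>\<epsilon>>0\<close> unfolding continuous_on_iff dist_real_def
        by (metis atLeastAtMost_iff half_gt_zero)
      obtain d2 where d2: "d2 > 0" "\<And>t. t \<in> {a..b} \<Longrightarrow> \<bar>t - t0\<bar> < d2 \<Longrightarrow> \<bar>v t - v t0\<bar> < \<epsilon>/2"
        using cv t0 \<open>\<epsilon>>0\<close> unfolding continuous_on_iff dist_real_def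
        by (metis atLeastAtMost_iff half_gt_zero)
      show "\<exists>\<delta>>0. \<forall>x y. x \<le> t0 \<and> t0 \<le> y \<and> y - x < \<delta> \<longrightarrow> P x y"
      proof (intro exI[of _ "min d1 d2"] conjI allI impI)
        fix x y assume xy: "x \<le> t0 \<and> t0 \<le> y \<and> y - x < min d1 d2"
        show "P x y" unfolding P_def
        proof safe
          assume r: "a \<le> x" "x \<le> y" "y \<le> b"
          have "((\<lambda>t. u y * v' t + v x * u' t - d t) has_integral
             (u y * (v y - v x) + v x * (u y - u x) - integral {x..y} d)) {x..y}"
            using r u v di by (intro has_integral_diff has_integral_add has_integral_mult_right
                integrable_integral) auto
          then have i: "((\<lambda>t. (u y - u t) * v' t + (v x - v t) * u' t) has_integral
             (u y * v y - u x * v x - integral {x..y} d)) {x..y}"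
            by (simp add: d_def algebra_simps)
          have "norm (integral {x..y} (\<lambda>t. (u y - u t) * v' t + (v x - v t) * u' t)) \<le>
             integral {x..y} (\<lambda>t. \<epsilon> * n t)"
          proof (rule integral_norm_bound_integral)
            show "(\<lambda>t. (u y - u t) * v' t + (v x - v t) * u' t) integrable_on {x..y}"
              using i by blast
            show "(\<lambda>t. \<epsilon> * n t) integrable_on {x..y}"
              by (intro integrable_on_mult_right ni r)
            fix t assume t: "t \<in> {x..y}"
            have "\<bar>y - t0\<bar> < d1" "\<bar>t - t0\<bar> < d1" "\<bar>x - t0\<bar> < d2" "\<bar>t - t0\<bar> < d2"
              using t xy by auto
            then have "\<bar>u y - u t0\<bar> < \<epsilon>/2" "\<bar>u t - u t0\<bar> < \<epsilon>/2" "\<bar>v x - v t0\<bar> < \<epsilon>/2" "\<bar>v t - v t0\<bar> < \<epsilon>/2"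
              using d1(2)[of y] d1(2)[of t] d2(2)[of x] d2(2)[of t] t r by auto
            then have "\<bar>u y - u t\<bar> \<le> \<epsilon>" and "\<bar>v x - v t\<bar> \<le> \<epsilon>" by linarith+
            then have "\<bar>(u y - u t) * v' t\<bar> + \<bar>(v x - v t) * u' t\<bar> \<le> \<epsilon> * \<bar>v' t\<bar> + \<epsilon> * \<bar>u' t\<bar>"
              unfolding abs_mult by (intro add_mono mult_right_mono) auto
            then show "norm ((u y - u t) * v' t + (v x - v t) * u' t) \<le> \<epsilon> * n t"
              unfolding n_def real_norm_def by (simp add: algebra_simps)
          qed
          then show "\<bar>u y * v y - u x * v x - integral {x..y} d\<bar> \<le> \<epsilon> * integral {x..y} n"
            using integral_unique[OF i] by simp
        qed
      qed (use d1 d2 in auto)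
    qed
    then show ?thesis using ab by (simp add: P_def)
  qed
  have "\<bar>u b * v b - u a * v a - integral {a..b} d\<bar> \<le> 0"
  proof (rule field_le_epsilon)
    fix e :: real assume "e > 0"
    define I where "I = integral {a..b} n"
    have "I \<ge> 0" unfolding I_def using ni nn by (intro integral_nonneg) auto
    have "\<bar>u b * v b - u a * v a - integral {a..b} d\<bar> \<le> (e / (I + 1)) * I"
      using key[of "e / (I + 1)"] \<open>e>0\<close> \<open>I\<ge>0\<close> by (simp add: I_def)
    also have "\<dots> \<le> e" using \<open>e>0\<close> \<open>I\<ge>0\<close> by (simp add: field_simps)
    finally show "\<bar>u b * v b - u a * v a - integral {a..b} d\<bar> \<le> 0 + e" by simp
  qed
  then have "integral {a..b} d = u b * v b - u a * v a" by simp
  then show ?thesis using di[of a b] unfolding d_def by (metis integrable_integral order_refl)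
qed

section \<open>Monotonicity of positive solutions\<close>

locale potential =
  fixes W W1 W2 :: "real \<Rightarrow> real"
  assumes W_d1: "\<And>x. x \<ge> 0 \<Longrightarrow> (W has_real_derivative W1 x) (at x within {0..})"
    and W_d2: "\<And>x. x \<ge> 0 \<Longrightarrow> (W1 has_real_derivative W2 x) (at x within {0..})"
    and W_C2: "continuous_on {0..} W2"
    and W0: "W 0 = 0"
    and W_nonneg: "\<And>x. x \<ge> 0 \<Longrightarrow> W x \<ge> 0"
    and W2_nonneg: "\<And>x. x > 0 \<Longrightarrow> W2 x \<ge> 0"
begin

lemma W_cont: "continuous_on {0..} W"
  by (rule DERIV_continuous_on) (use W_d1 in auto)

lemma W1_cont: "continuous_on {0..} W1"
  by (rule DERIV_continuous_on) (use W_d2 in auto)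

lemma W_deriv_at: "x > 0 \<Longrightarrow> (W has_real_derivative W1 x) (at x)"
  using W_d1[of x] at_within_open_subset[of x "{0<..}" "{0..}"] by (auto simp: subset_eq)

lemma W1_deriv_at: "x > 0 \<Longrightarrow> (W1 has_real_derivative W2 x) (at x)"
  using W_d2[of x] at_within_open_subset[of x "{0<..}" "{0..}"] by (auto simp: subset_eq)

lemma W1_mono: assumes "0 \<le> x" "x \<le> y" shows "W1 x \<le> W1 y"
proof (rule DERIV_nonneg_imp_increasing_open[OF assms(2)])
  show "continuous_on {x..y} W1" using W1_cont by (rule continuous_on_subset) (use assms in auto)
  fix t assume "x < t" "t < y"
  then show "\<exists>l. (W1 has_real_derivative l) (at t) \<and> 0 \<le> l"
    using W1_deriv_at[of t] W2_nonneg[of t] assms by auto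
qed

text \<open>\<open>W\<close> attains its minimum at 0, so its slope there cannot be negative, and
  \<open>W1\<close> is nondecreasing.\<close>

lemma W1_nonneg: assumes "x \<ge> 0" shows "W1 x \<ge> 0"
proof (rule ccontr)
  assume "\<not> ?thesis"
  then have "W1 0 < 0" using W1_mono[of 0 x] assms by simp
  from has_real_derivative_neg_dec_right[OF W_d1[of 0] this]
  obtain d where d: "d > 0" "\<And>h. 0 < h \<Longrightarrow> 0 + h \<in> {0..} \<Longrightarrow> h < d \<Longrightarrow> W (0 + h) < W 0" by auto
  from d(2)[of "d/2"] d(1) W_nonneg[of "d/2"] W0 show False by simp
qed

lemma W_mvt:
  assumes "0 \<le> x" "x < y"
  obtains z where "x < z" "z < y" "W y - W x = (y - x) * W1 z"
proof -
  have "\<exists>z. x < z \<and> z < y \<and> W y - W x = (y - x) * W1 z"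
  proof -
    have "continuous_on {x..y} W" using W_cont by (rule continuous_on_subset) (use assms in auto)
    moreover have "(W has_real_derivative W1 t) (at t)" if "x < t" "t < y" for t
      using W_deriv_at that assms by simp
    ultimately obtain l z where z: "x < z" "z < y" "(W has_real_derivative l) (at z)" "W y - W x = (y - x) * l"
      using MVT[OF assms(2), of W] by (metis real_differentiable_def)
    then have "l = W1 z" using W_deriv_at[of z] assms DERIV_unique by auto
    with z show ?thesis by auto
  qed
  with that show ?thesis by auto
qed

lemma W_convex:
  assumes "0 \<le> x" "0 \<le> y" shows "W y \<ge> W x + W1 x * (y - x)"
proof (cases x y rule: linorder_cases)
  case less
  then obtain z where z: "x < z" "W y - W x = (y - x) * W1 z" using W_mvt[OF assms(1)] by metis
  have "(y - x) * W1 x \<le> (y - x) * W1 z" using W1_mono[of x z] z assms less by (intro mult_left_mono) auto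
  with z show ?thesis by (simp add: algebra_simps)
next
  case greater
  then obtain z where z: "y < z" "z < x" "W x - W y = (x - y) * W1 z" using W_mvt[OF assms(2)] by metis
  have "(x - y) * W1 z \<le> (x - y) * W1 x" using W1_mono[of z x] z assms greater by (intro mult_left_mono) auto
  with z show ?thesis by (simp add: algebra_simps)
qed auto

lemma W_mono: assumes "0 \<le> x" "x \<le> y" shows "W x \<le> W y"
  using W_convex[of x y] W1_nonneg[of x] assms
  by (smt (verit) mult_nonneg_nonneg)

text \<open>Strictness comes from the positive slope at the left point, since \<open>W\<close> need
  not be strictly convex.\<close>

lemma W_strict: assumes "0 \<le> x" "x < y" "W1 x > 0" shows "W x < W y"
  using W_convex[of x y] assms by (smt (verit) mult_pos_pos)

end

lemma first_zero:
  fixes u :: "real \<Rightarrow> real"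
  assumes "a \<le> b" "continuous_on {a..b} u" "u a < 0" "u b \<ge> 0"
  obtains c where "a < c" "c \<le> b" "u c = 0" "\<And>r. a \<le> r \<Longrightarrow> r < c \<Longrightarrow> u r < 0"
proof -
  define K where "K = {r\<in>{a..b}. u r \<in> {0..}}"
  have "closed K" unfolding K_def
    using assms(2) by (intro continuous_closed_preimage[unfolded vimage_def Int_def, simplified]) (auto simp: Collect_conj_eq)
  then have "compact K" unfolding compact_eq_bounded_closed K_def
    by (auto intro: bounded_subset[of "{a..b}"])
  moreover have "b \<in> K" using assms by (simp add: K_def)
  ultimately obtain c where c: "c \<in> K" "\<And>r. r \<in> K \<Longrightarrow> c \<le> r"
    using compact_attains_inf[of K] by blast
  have neg: "u r < 0" if "a \<le> r" "r < c" for r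
    using c(2)[of r] that c(1) by (force simp: K_def)
  have c': "a \<le> c" "c \<le> b" "u c \<ge> 0" using c(1) by (auto simp: K_def)
  have "continuous_on {a..c} u" using assms(2) by (rule continuous_on_subset) (use c' in auto)
  then obtain x where "a \<le> x" "x \<le> c" "u x = 0"
    using IVT'[of u a 0 c] c' assms(3) by auto
  with neg[of x] have "u c = 0" by (cases "x = c") auto
  with c' neg assms(3) that[of c] show ?thesis by (cases "a = c") auto
qed

text \<open>Written with \<open>1/r\<close> instead of a lowered exponent, so that it matches the
  first-order term of the radial Laplacian.\<close>

lemma DERIV_power_dim:
  assumes "N \<ge> 1" "r > 0"
  shows "((\<lambda>r. r ^ (N - 1)) has_real_derivative (real N - 1) / r * r ^ (N - 1)) (at r)"
proof -
  have "((\<lambda>r. r ^ (N - 1)) has_real_derivative real (N - 1) * r ^ (N - 1 - 1)) (at r)"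
    by (auto intro!: derivative_eq_intros)
  moreover have "real (N - 1) * r ^ (N - 1 - 1) = (real N - 1) / r * r ^ (N - 1)"
    using assms by (cases "N - 1") (auto simp: of_nat_diff)
  ultimately show ?thesis by simp
qed

section \<open>The angle equation of a positive solution\<close>

locale mm_pos = potential W W1 W2 for W W1 W2 :: "real \<Rightarrow> real" +
  fixes N :: nat and \<eta> :: real and f g f1 f2 g1 g2 :: "real \<Rightarrow> real"
  assumes N2: "N \<ge> 2" and eta: "\<eta> > 0"
    and df: "\<And>r. 0 < r \<Longrightarrow> r < 1 \<Longrightarrow> (f has_real_derivative f1 r) (at r)"
    and df1: "\<And>r. 0 < r \<Longrightarrow> r < 1 \<Longrightarrow> (f1 has_real_derivative f2 r) (at r)"
    and dg: "\<And>r. 0 < r \<Longrightarrow> r < 1 \<Longrightarrow> (g has_real_derivative g1 r) (at r)"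
    and dg1: "\<And>r. 0 < r \<Longrightarrow> r < 1 \<Longrightarrow> (g1 has_real_derivative g2 r) (at r)"
    and eq_f: "\<And>r. 0 < r \<Longrightarrow> r < 1 \<Longrightarrow>
         f2 r + (real N - 1) / r * f1 r - (real N - 1) / r^2 * f r
         = - ((f1 r)^2 + (real N - 1) / r^2 * (f r)^2 + (g1 r)^2 + W1 ((g r)^2) * (g r)^2 / \<eta>^2) * f r"
    and eq_g: "\<And>r. 0 < r \<Longrightarrow> r < 1 \<Longrightarrow>
         g2 r + (real N - 1) / r * g1 r = W1 ((g r)^2) * g r / \<eta>^2
         - ((f1 r)^2 + (real N - 1) / r^2 * (f r)^2 + (g1 r)^2 + W1 ((g r)^2) * (g r)^2 / \<eta>^2) * g r"
    and bmm: "BMM N f f1 g g1"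
    and g_pos: "\<And>r. 0 < r \<Longrightarrow> r < 1 \<Longrightarrow> g r > 0"
begin

text \<open>With \<open>f = sin \<theta>\<close> and \<open>g = cos \<theta>\<close>, \<open>p\<close> is \<open>\<theta>'\<close>.\<close>
definition p :: "real \<Rightarrow> real" where "p r = f1 r / g r"
definition w :: "real \<Rightarrow> real" where "w r = W1 ((g r)^2) / \<eta>^2"

definition m :: real where "m = real N - 1"

lemma m_ge: "m \<ge> 1" using N2 by (simp add: m_def)

lemma unit: "0 < r \<Longrightarrow> r < 1 \<Longrightarrow> (f r)^2 + (g r)^2 = 1"
  using bmm by (auto simp: BMM_def)

lemma f1_eq: "0 < r \<Longrightarrow> r < 1 \<Longrightarrow> f1 r = g r * p r"
  using g_pos[of r] by (simp add: p_def)

lemma g1_eq: assumes r: "0 < r" "r < 1" shows "g1 r = - f r * p r"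
proof -
  have "((\<lambda>r. (f r)^2 + (g r)^2) has_real_derivative 2 * f r * f1 r + 2 * g r * g1 r) (at r)"
    using r by (auto intro!: derivative_eq_intros df dg)
  moreover have "((\<lambda>r. (f r)^2 + (g r)^2) has_real_derivative 0) (at r)"
  proof (rule has_field_derivative_transform_within_open[where S="{0<..<1}"])
    show "((\<lambda>_. 1::real) has_real_derivative 0) (at r)" by simp
  qed (use r unit in auto)
  ultimately have "2 * f r * f1 r + 2 * g r * g1 r = 0" by (rule DERIV_unique)
  then show ?thesis using g_pos[OF r] by (simp add: p_def field_simps)
qed

lemma f_bound: "0 < r \<Longrightarrow> r < 1 \<Longrightarrow> \<bar>f r\<bar> < 1"
  using unit[of r] g_pos[of r] by (metis abs_square_less_1 less_add_same_cancel1 zero_less_power)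

lemma g_le: "0 < r \<Longrightarrow> r < 1 \<Longrightarrow> g r \<le> 1"
  using unit[of r] zero_le_power2[of "f r"] abs_square_le_1[of "g r"] by linarith

lemma w_nonneg: "w r \<ge> 0"
  using W1_nonneg[of "(g r)^2"] by (simp add: w_def)

lemma w_le: "0 < r \<Longrightarrow> r < 1 \<Longrightarrow> w r \<le> W1 1 / \<eta>^2"
  using W1_mono[of "(g r)^2" 1] g_le[of r] g_pos[of r]
  by (auto simp: w_def divide_right_mono power_le_one)

lemma df': "0 < r \<Longrightarrow> r < 1 \<Longrightarrow> (f has_real_derivative g r * p r) (at r)"
  using df[of r] f1_eq[of r] by simp

lemma dg': "0 < r \<Longrightarrow> r < 1 \<Longrightarrow> (g has_real_derivative - f r * p r) (at r)"
  using dg[of r] g1_eq[of r] by simp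

text \<open>Differentiating \<open>p = f1 / g\<close> produces \<open>f p^2\<close>, which cancels
  the \<open>p^2\<close> part of the multiplier; \<open>f^2 = 1 - g^2\<close> turns the remaining
  multiplier terms into the factor \<open>g^2\<close> that is divided out.\<close>

lemma dp:
  assumes r: "0 < r" "r < 1"
  shows "(p has_real_derivative - m / r * p r + f r * g r * (m / r^2 - w r)) (at r)"
proof -
  have gp: "g r > 0" using g_pos r by simp
  have "((\<lambda>r. f1 r / g r) has_real_derivative (f2 r * g r - f1 r * (- f r * p r)) / (g r * g r)) (at r)"
    using r gp by (intro DERIV_divide df1 dg') auto
  moreover have "(f2 r * g r - f1 r * (- f r * p r)) / (g r * g r)
      = - m / r * p r + f r * g r * (m / r^2 - w r)"
  proof -
    define c where "c = m / r"
    define e where "e = m / r^2"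
    have u: "(f r)^2 = 1 - (g r)^2" using unit[OF r] by simp
    have "(f1 r)^2 + (g1 r)^2 = (p r)^2 * ((f r)^2 + (g r)^2)"
      using f1_eq[OF r] g1_eq[OF r] by (simp add: power_mult_distrib algebra_simps)
    then have s: "(f1 r)^2 + (g1 r)^2 = (p r)^2" using unit[OF r] by simp
    have "f2 r + c * f1 r - e * f r = - ((f1 r)^2 + e * (f r)^2 + (g1 r)^2 + w r * (g r)^2) * f r"
      using eq_f[OF r] unfolding c_def e_def w_def m_def by simp
    also have "(f1 r)^2 + e * (f r)^2 + (g1 r)^2 + w r * (g r)^2 = (p r)^2 + e * (1 - (g r)^2) + w r * (g r)^2"
      using s u by simp
    finally have "f2 r + c * (g r * p r) - e * f r
       = - ((p r)^2 + e * (1 - (g r)^2) + w r * (g r)^2) * f r"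
      using f1_eq[OF r] by simp
    then have f2: "f2 r = - c * (g r * p r) + e * f r - ((p r)^2 + e * (1 - (g r)^2) + w r * (g r)^2) * f r"
      by algebra
    have "f2 r * g r - f1 r * (- f r * p r) = (- c * p r + f r * g r * (e - w r)) * (g r * g r)"
      unfolding f2 f1_eq[OF r] by algebra
    then show ?thesis using gp unfolding c_def e_def by (simp add: field_simps)
  qed
  ultimately show ?thesis unfolding p_def[abs_def] by simp
qed

text \<open>Since \<open>f1^2 + g1^2 = p^2\<close>, finite energy makes \<open>r^(N-1) p^2\<close>
  integrable. The resulting smallness at arbitrarily small radii stands in for a boundary condition
  at the origin.\<close>

lemma small_near_0:
  assumes "\<delta> > 0" "\<epsilon> > 0"
  shows "\<exists>r. 0 < r \<and> r < \<delta> \<and> r < 1 \<and> r^N * (p r)^2 < \<epsilon>"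
proof -
  have "(\<lambda>r. (f1 r)^2 * r^(N-1) + (g1 r)^2 * r^(N-1)) integrable_on {0<..<1}"
    using bmm by (auto simp: BMM_def intro: integrable_add)
  from integrable_small_near_0[OF this _ assms]
  obtain r where r: "0 < r" "r < \<delta>" "r < 1" "r * ((f1 r)^2 * r^(N-1) + (g1 r)^2 * r^(N-1)) < \<epsilon>" by auto
  have "(f1 r)^2 + (g1 r)^2 = (p r)^2 * ((f r)^2 + (g r)^2)"
    using f1_eq[of r] g1_eq[of r] r by (simp add: power_mult_distrib algebra_simps)
  then have "(f1 r)^2 + (g1 r)^2 = (p r)^2" using unit[of r] r by simp
  moreover have "r * ((f1 r)^2 * r^(N-1) + (g1 r)^2 * r^(N-1)) = r^N * ((f1 r)^2 + (g1 r)^2)"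
    using N2 by (cases N) (auto simp: algebra_simps)
  ultimately show ?thesis using r by auto
qed

text \<open>The square of the flux is \<open>r^(2(N-1)) p^2\<close>, and
  \<open>2(N-1) \<ge> N\<close> because \<open>N \<ge> 2\<close>.\<close>

lemma flux_small_near_0:
  assumes "\<delta> > 0" "\<epsilon> > 0"
  shows "\<exists>r. 0 < r \<and> r < \<delta> \<and> r < 1 \<and> r^(N-1) * \<bar>p r\<bar> < \<epsilon>"
proof -
  obtain r where r: "0 < r" "r < \<delta>" "r < 1" "r^N * (p r)^2 < \<epsilon>^2"
    using small_near_0[OF assms(1), of "\<epsilon>^2"] assms(2) by auto
  have "(r^(N-1) * \<bar>p r\<bar>)^2 = r^(2*(N-1)) * (p r)^2"
    by (simp add: power_mult_distrib power_mult[symmetric] mult.commute)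
  also have "\<dots> \<le> r^N * (p r)^2"
    using r N2 by (intro mult_right_mono power_decreasing) auto
  also have "\<dots> < \<epsilon>^2" by (rule r)
  finally have "r^(N-1) * \<bar>p r\<bar> < \<epsilon>" using assms(2) by (meson less_eq_real_def power_less_imp_less_base)
  with r show ?thesis by auto
qed

lemma d_flux:
  assumes r: "0 < r" "r < 1"
  shows "((\<lambda>r. r^(N-1) * p r) has_real_derivative r^(N-1) * (f r * g r * (m / r^2 - w r))) (at r)"
proof -
  have "((\<lambda>r. r^(N-1) * p r) has_real_derivative m / r * r^(N-1) * p r
     + (- m / r * p r + f r * g r * (m / r^2 - w r)) * r^(N-1)) (at r)"
    unfolding m_def using r N2 by (intro DERIV_mult DERIV_power_dim dp[unfolded m_def]) auto
  then show ?thesis by (simp add: algebra_simps)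
qed

text \<open>Because \<open>(f^2)' = 2 f g p\<close> and \<open>g > 0\<close>, the sign of
  \<open>S\<close> is that of \<open>(f^2)'\<close>. This tracks the growth of \<open>f^2\<close>
  before the sign of \<open>f\<close> is known.\<close>

definition S :: "real \<Rightarrow> real" where "S r = f r * (r^(N-1) * p r)"

lemma d_S:
  assumes r: "0 < r" "r < 1"
  shows "(S has_real_derivative r^(N-1) * g r * ((p r)^2 + (f r)^2 * (m / r^2 - w r))) (at r)"
proof -
  have "(S has_real_derivative g r * p r * (r^(N-1) * p r) + r^(N-1) * (f r * g r * (m / r^2 - w r)) * f r) (at r)"
    unfolding S_def[abs_def] using r by (intro DERIV_mult df' d_flux) auto
  then show ?thesis by (simp add: algebra_simps power2_eq_square)
qed

lemma S_small: assumes "\<delta> > 0" "\<epsilon> > 0"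
  shows "\<exists>r. 0 < r \<and> r < \<delta> \<and> r < 1 \<and> \<bar>S r\<bar> < \<epsilon>"
proof -
  obtain r where r: "0 < r" "r < \<delta>" "r < 1" "r^(N-1) * \<bar>p r\<bar> < \<epsilon>"
    using flux_small_near_0[OF assms] by auto
  have "\<bar>S r\<bar> = \<bar>f r\<bar> * (r^(N-1) * \<bar>p r\<bar>)" using r by (simp add: S_def abs_mult)
  also have "\<dots> \<le> 1 * (r^(N-1) * \<bar>p r\<bar>)" using f_bound[of r] r by (intro mult_right_mono) auto
  finally show ?thesis using r by auto
qed

text \<open>\<open>w\<close> is bounded by \<open>W1 1 / \<eta>^2\<close>, so the term
  \<open>m / r^2\<close> wins for small \<open>r\<close>.\<close>

lemma ex_rc: "\<exists>rc. 0 < rc \<and> rc < 1 \<and> (\<forall>r. 0 < r \<longrightarrow> r < rc \<longrightarrow> m / r^2 - w r > 0)"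
proof -
  define B where "B = W1 1 / \<eta>^2 + 1"
  have B: "B \<ge> 1" using W1_nonneg[of 1] by (simp add: B_def)
  show ?thesis
  proof (intro exI[of _ "1 / (B + 1)"] conjI allI impI)
    fix r assume r: "0 < r" "r < 1 / (B + 1)"
    have r1: "r < 1" using r B by (smt (verit) divide_le_eq_1)
    have "r * (B + 1) < 1" using r B by (simp add: field_simps)
    then have rB: "r * B < 1" using r by (simp add: algebra_simps)
    have "r^2 * w r \<le> r * w r" using r r1 w_nonneg by (intro mult_right_mono) (auto simp: power2_eq_square)
    also have "\<dots> \<le> r * B" using r r1 w_le[of r] by (intro mult_left_mono) (auto simp: B_def)
    finally have "r^2 * w r < m" using rB m_ge by linarith
    then show "m / r^2 - w r > 0" using r by (simp add: field_simps)
  qed (use B in \<open>auto simp: field_simps\<close>)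
qed

text \<open>\<open>f = 0\<close> is a rest state of the angle equation. Once reached with
  \<open>p = 0\<close> it persists up to \<open>r = 1\<close>, against the trace of
  \<open>f\<close>.\<close>

lemma p_f_zero:
  assumes x: "0 < x" "x < 1" "f x = 0" "p x = 0"
  shows False
proof -
  have zero: "f y = 0" if y: "x \<le> y" "y < 1" for y
  proof -
    define B where "B = W1 1 / \<eta>^2"
    define E where "E = (\<lambda>r. (f r)^2 + (p r)^2)"
    define E' where "E' = (\<lambda>r. 2 * f r * (g r * p r) + 2 * p r * (- m / r * p r + f r * g r * (m / r^2 - w r)))"
    define C where "C = 1 + 2 * m / x + m / x^2 + B"
    have "E y = 0"
    proof (rule gronwall_zero[where E=E and s=y and x=x and y=y and E'=E' and C=C])
      fix r assume r: "x \<le> r" "r \<le> y"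
      then have r1: "0 < r" "r < 1" using x y by auto
      show "(E has_real_derivative E' r) (at r)"
        unfolding E_def E'_def using r1 by (auto intro!: derivative_eq_intros df' dp)
      show "\<bar>E' r\<bar> \<le> C * E r"
        unfolding E_def E'_def C_def
      proof (rule damped_energy_bound)
        show "\<bar>f r * g r\<bar> \<le> \<bar>f r\<bar>" "\<bar>g r\<bar> \<le> 1"
          using g_pos[OF r1] g_le[OF r1] by (auto simp: abs_mult mult_left_le)
      qed (use m_ge x r w_nonneg w_le[OF r1] in \<open>auto simp: B_def\<close>)
    qed (use x y in \<open>auto simp: E_def\<close>)
    then show ?thesis unfolding E_def by (simp add: sum_power2_eq_zero_iff)
  qed
  have "(f \<longlongrightarrow> 1) (at_left 1)" using bmm by (simp add: BMM_def)
  then have "\<forall>\<^sub>F r in at_left 1. f r > 0" by (rule order_tendstoD) simp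
  moreover have "\<forall>\<^sub>F r in at_left 1. x < r \<and> r < 1"
    using x by (auto simp: eventually_at_left intro!: exI[of _ x])
  ultimately have "\<forall>\<^sub>F r in at_left (1::real). False" by eventually_elim (use zero in force)
  then show False by simp
qed

text \<open>Near the origin \<open>S' \<ge> 0\<close>, and \<open>S\<close> is small along radii
  tending to 0, so \<open>S \<ge> 0\<close>. A zero of \<open>S\<close> would make it vanish on the
  whole interval below; then \<open>S' = 0\<close> forces \<open>f = p = 0\<close> there.\<close>

lemma S_pos_near_0:
  obtains rc where "0 < rc" "rc < 1" "\<And>r. 0 < r \<Longrightarrow> r < rc \<Longrightarrow> S r > 0 \<and> m / r^2 - w r > 0"
proof -
  obtain rc where rc: "0 < rc" "rc < 1" and z: "\<And>r. 0 < r \<Longrightarrow> r < rc \<Longrightarrow> m / r^2 - w r > 0"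
    using ex_rc by auto
  have mono: "S x \<le> S y" if "0 < x" "x \<le> y" "y < rc" for x y
  proof (rule DERIV_nonneg_imp_nondecreasing[OF that(2)])
    fix r assume "x \<le> r" "r \<le> y"
    then have r: "0 < r" "r < 1" "r < rc" using that rc by auto
    show "\<exists>l. (S has_real_derivative l) (at r) \<and> 0 \<le> l"
      using z[OF r(1,3)] r g_pos[OF r(1,2)]
      by (intro exI[of _ "r^(N-1) * g r * ((p r)^2 + (f r)^2 * (m / r^2 - w r))"] conjI d_S
          mult_nonneg_nonneg add_nonneg_nonneg) auto
  qed
  have nn: "S r \<ge> 0" if r: "0 < r" "r < rc" for r
  proof (rule ccontr)
    assume "\<not> ?thesis"
    then obtain x where "0 < x" "x < r" "\<bar>S x\<bar> < - S r" using S_small[of r "- S r"] r by auto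
    with mono[of x r] r show False by simp
  qed
  have "S r > 0" if r: "0 < r" "r < rc" for r
  proof (rule ccontr)
    assume "\<not> ?thesis"
    then have S0: "S x = 0" if "0 < x" "x \<le> r" for x
      using nn[of x] mono[of x r] that r by auto
    define x where "x = r / 2"
    have x: "0 < x" "x < r" "x < 1" using r rc by (auto simp: x_def)
    have "(S has_real_derivative 0) (at x)"
      by (rule has_field_derivative_transform_within_open[of "\<lambda>_. 0" _ _ "{0<..<r}"])
         (use S0 x in auto)
    with d_S[OF x(1,3)] have "x^(N-1) * g x * ((p x)^2 + (f x)^2 * (m / x^2 - w x)) = 0"
      by (rule DERIV_unique)
    then have "(p x)^2 + (f x)^2 * (m / x^2 - w x) = 0" using x g_pos[OF x(1,3)] by simp
    moreover have "m / x^2 - w x > 0" using z x r by simp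
    ultimately have "(p x)^2 = 0 \<and> (f x)^2 * (m / x^2 - w x) = 0"
      by (subst (asm) add_nonneg_eq_0_iff) auto
    then have "p x = 0" "f x = 0" using \<open>m / x^2 - w x > 0\<close> by auto
    then show False using p_f_zero x by blast
  qed
  then show ?thesis using that rc z by blast
qed


lemma cont_f: "\<lbrakk>0 < a; b < 1\<rbrakk> \<Longrightarrow> continuous_on {a..b} f"
  by (rule DERIV_continuous_on[of _ _ f1]) (use df in \<open>auto intro: has_field_derivative_at_within\<close>)

lemma cont_S: "\<lbrakk>0 < a; b < 1\<rbrakk> \<Longrightarrow> continuous_on {a..b} S"
  by (rule DERIV_continuous_on[OF has_field_derivative_at_within[OF d_S]]) auto

lemma cont_p: "\<lbrakk>0 < a; b < 1\<rbrakk> \<Longrightarrow> continuous_on {a..b} p"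
  by (rule DERIV_continuous_on[OF has_field_derivative_at_within[OF dp]]) auto

lemma f_near_1: assumes "y < 1" "x < 1" obtains t where "x < t" "t < 1" "f t > y"
proof -
  have "(f \<longlongrightarrow> 1) (at_left 1)" using bmm by (simp add: BMM_def)
  then have "\<forall>\<^sub>F r in at_left 1. f r > y" using assms by (intro order_tendstoD) auto
  moreover have "\<forall>\<^sub>F r in at_left 1. x < r \<and> r < 1"
    using assms by (auto simp: eventually_at_left intro!: exI[of _ x])
  ultimately have "\<forall>\<^sub>F r in at_left (1::real). x < r \<and> r < 1 \<and> f r > y" by eventually_elim auto
  then show ?thesis using that eventually_happens'[of "at_left (1::real)"] by force
qed

text \<open>At a critical point of the angle \<open>w\<close> is stationary, so only the factor
  \<open>r^2\<close> contributes.\<close>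

lemma d_z:
  assumes r: "0 < r" "r < 1" and "p r = 0"
  shows "((\<lambda>r. m - r^2 * w r) has_real_derivative - (2 * r * w r)) (at r)"
proof -
  have "((\<lambda>r. W1 ((g r)^2)) has_real_derivative W2 ((g r)^2) * (2 * g r * (- f r * p r))) (at r)"
    using r g_pos[OF r]
    by (intro DERIV_chain2[OF W1_deriv_at]) (auto intro!: derivative_eq_intros dg')
  then have "((\<lambda>r. W1 ((g r)^2)) has_real_derivative 0) (at r)" using assms by simp
  then have "(w has_real_derivative 0) (at r)" unfolding w_def[abs_def]
    using eta by (auto intro!: derivative_eq_intros)
  then show ?thesis by (auto intro!: derivative_eq_intros)
qed

text \<open>If the angle stopped increasing at \<open>rm\<close>, it would be trapped in the potential well: the
  Pohozaev-type quantity \<open>G\<close> decreases as long as \<open>f\<^sup>2\<close> stays below its value at \<open>rm\<close>, while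
  returning to that value would need \<open>G \<ge> 0\<close>.\<close>
lemma S_pos: assumes x: "0 < x" "x < 1" shows "S x > 0"
proof (rule ccontr)
  assume "\<not> ?thesis"
  obtain rc where rc: "0 < rc" "rc < 1" "\<And>r. 0 < r \<Longrightarrow> r < rc \<Longrightarrow> S r > 0 \<and> m / r^2 - w r > 0"
    using S_pos_near_0 by blast
  define a where "a = rc / 2"
  have "rc \<le> x" using rc(3)[of x] x \<open>\<not> S x > 0\<close> by force
  then have a: "0 < a" "a < rc" "a < x" "a < 1" using rc x by (auto simp: a_def)
  obtain rm where rm: "a < rm" "rm \<le> x" "- S rm = 0" "\<And>r. a \<le> r \<Longrightarrow> r < rm \<Longrightarrow> - S r < 0"
    using first_zero[of a x "\<lambda>r. - S r"] cont_S[of a x] a rc(3)[of a] \<open>\<not> S x > 0\<close> x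
    by (auto intro: continuous_on_minus)
  have rm01: "0 < rm" "rm < 1" using rm a x by auto
  \<comment> \<open>As \<open>f^2\<close> has been growing, \<open>f rm\<close> is nonzero, so
    \<open>S rm = 0\<close> must come from \<open>p rm = 0\<close>.\<close>
  have "(f a)^2 < (f rm)^2"
  proof (rule DERIV_pos_imp_increasing_open[OF rm(1)])
    fix r assume r: "a < r" "r < rm"
    then have r1: "0 < r" "r < 1" using a rm x by auto
    have "((\<lambda>r. (f r)^2) has_real_derivative 2 * f r * (g r * p r)) (at r)"
      using r1 by (auto intro!: derivative_eq_intros df')
    moreover have "f r * p r > 0" using rm(4)[of r] r r1
      by (auto simp: S_def zero_less_mult_iff mult_less_0_iff)
    then have "0 < (f r * p r) * (2 * g r)" using g_pos[OF r1] by simp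
    then have "2 * f r * (g r * p r) > 0" by (simp add: algebra_simps)
    ultimately show "\<exists>y. ((\<lambda>r. (f r)^2) has_real_derivative y) (at r) \<and> 0 < y" by blast
  next
    show "continuous_on {a..rm} (\<lambda>r. (f r)^2)"
      using cont_f[of a rm] a rm01 by (intro continuous_on_power) auto
  qed
  then have frm: "f rm \<noteq> 0" by auto
  then have prm: "p rm = 0" using rm(3) rm01 by (simp add: S_def)
  \<comment> \<open>\<open>S\<close> descends to 0 at \<open>rm\<close>, so \<open>S'\<close> is not
    positive there; as \<open>p rm = 0\<close>, its sign is that of
    \<open>m / rm^2 - w rm\<close>.\<close>
  have zrm: "m - rm^2 * w rm \<le> 0"
  proof (rule ccontr)
    assume "\<not> ?thesis"
    then have "m / rm^2 - w rm > 0" using rm01 by (simp add: field_simps)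
    then have "rm^(N-1) * g rm * ((p rm)^2 + (f rm)^2 * (m / rm^2 - w rm)) > 0"
      using rm01 g_pos[OF rm01] frm prm by simp
    from DERIV_pos_inc_left[OF d_S[OF rm01] this]
    obtain d where d: "d > 0" "\<And>h. 0 < h \<Longrightarrow> h < d \<Longrightarrow> S (rm - h) < S rm" by blast
    define h where "h = min (d / 2) (rm - a)"
    have "0 < h" "h < d" "a \<le> rm - h" using d(1) rm(1) by (auto simp: h_def min_def)
    then show False using d(2)[of h] rm(3) rm(4)[of "rm - h"] by auto
  qed
  have wrm: "w rm > 0" using zrm m_ge by (smt (verit) mult_nonneg_nonpos zero_le_power2)
  \<comment> \<open>A possible equality in \<open>zrm\<close> becomes strict immediately after
    \<open>rm\<close>, which pushes the angle back.\<close>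
  have "- (2 * rm * w rm) < 0" using wrm rm01 by simp
  from DERIV_neg_dec_right[OF d_z[OF rm01 prm] this]
  obtain d1 where d1: "d1 > 0" "\<And>h. 0 < h \<Longrightarrow> h < d1 \<Longrightarrow> m - (rm + h)^2 * w (rm + h) < 0"
    using zrm by force
  have "isCont f rm" using df[OF rm01] DERIV_isCont by blast
  then obtain d2 where d2: "d2 > 0" "\<And>r. \<bar>r - rm\<bar> < d2 \<Longrightarrow> \<bar>f r - f rm\<bar> < \<bar>f rm\<bar>"
    using frm unfolding continuous_at_eps_delta dist_real_def by (meson zero_less_abs_iff)
  define e where "e = min (min d1 d2) (1 - rm) / 2"
  have e: "0 < e" "e < d1" "e < d2" "e < 1 - rm" using d1 d2 rm01 by (auto simp: e_def min_def)
  have same: "f r * f rm > 0" if "rm \<le> r" "r \<le> rm + e" for r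
    using d2(2)[of r] that e frm by (cases "f rm > 0") (auto simp: zero_less_mult_iff)
  \<comment> \<open>On this short interval \<open>f\<close> keeps the sign of \<open>f rm\<close>;
    multiplying by \<open>f rm\<close> treats both signs at once.\<close>
  have D: "f rm * (r^(N-1) * p r) < 0" if r: "rm < r" "r \<le> rm + e" for r
  proof -
    have "f rm * (r^(N-1) * p r) < f rm * (rm^(N-1) * p rm)"
    proof (rule DERIV_neg_imp_decreasing_open[OF r(1)])
      fix s assume s: "rm < s" "s < r"
      then have s1: "0 < s" "s < 1" using r rm01 e by auto
      have "((\<lambda>r. f rm * (r^(N-1) * p r)) has_real_derivative f rm * (s^(N-1) * (f s * g s * (m / s^2 - w s)))) (at s)"
        by (intro DERIV_cmult d_flux s1)
      moreover have "f rm * (s^(N-1) * (f s * g s * (m / s^2 - w s))) < 0"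
      proof -
        have "m - s^2 * w s < 0" using d1(2)[of "s - rm"] s r e by auto
        then have "m / s^2 - w s < 0" using s1 by (simp add: field_simps)
        then have "(f s * f rm) * (s^(N-1) * g s) * (m / s^2 - w s) < 0"
          using same[of s] s r s1 g_pos[OF s1] mult_pos_neg[of "(f s * f rm) * (s^(N-1) * g s)"]
            mult_pos_pos[of "f s * f rm" "s^(N-1) * g s"] by simp
        then show ?thesis by (simp add: algebra_simps)
      qed
      ultimately show "\<exists>y. ((\<lambda>r. f rm * (r^(N-1) * p r)) has_real_derivative y) (at s) \<and> y < 0" by blast
    next
      show "continuous_on {rm..r} (\<lambda>r. f rm * (r ^ (N - 1) * p r))"
        using cont_p[of rm r] rm01 r e by (intro continuous_intros) auto
    qed
    then show ?thesis using prm by simp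
  qed
  have fdec: "(f r)^2 < (f rm)^2" if r: "rm < r" "r \<le> rm + e" for r
  proof (rule DERIV_neg_imp_decreasing_open[OF r(1)])
    fix s assume s: "rm < s" "s < r"
    then have s1: "0 < s" "s < 1" using r rm01 e by auto
    have "((\<lambda>r. (f r)^2) has_real_derivative 2 * f s * (g s * p s)) (at s)"
      using s1 by (auto intro!: derivative_eq_intros df')
    moreover have "f rm * p s < 0" using D[of s] s r s1 by (auto simp: zero_less_mult_iff mult_less_0_iff)
    then have "2 * f s * (g s * p s) < 0" using same[of s] s r g_pos[OF s1]
      by (auto simp: zero_less_mult_iff mult_less_0_iff)
    ultimately show "\<exists>y. ((\<lambda>r. (f r)^2) has_real_derivative y) (at s) \<and> y < 0" by blast
  next
    show "continuous_on {rm..r} (\<lambda>r. (f r)^2)"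
      using cont_f[of rm r] rm01 r e by (intro continuous_on_power) auto
  qed
  define ym where "ym = (f rm)^2"
  have ym: "0 < ym" "ym < 1" "(g rm)^2 = 1 - ym"
    using frm f_bound[OF rm01] unit[OF rm01] by (auto simp: ym_def abs_square_less_1)
  \<comment> \<open>Since \<open>f\<close> tends to 1, \<open>f^2\<close> must climb back to its
    value at \<open>rm\<close>; \<open>c\<close> below is the first radius where it does.\<close>
  have "\<bar>f rm\<bar> < 1" using f_bound rm01 by auto
  then obtain t where t: "rm + e < t" "t < 1" "f t > \<bar>f rm\<bar>"
    using f_near_1[of "\<bar>f rm\<bar>" "rm + e"] e by auto
  have "(f t)^2 > ym" using t(3) unfolding ym_def by (metis abs_ge_zero power2_abs power_strict_mono zero_less_numeral)
  moreover have "continuous_on {rm + e..t} (\<lambda>r. (f r)^2 - ym)"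
    using cont_f[of "rm + e" t] t e rm01 by (intro continuous_intros) auto
  ultimately obtain c where c: "rm + e < c" "c \<le> t" "(f c)^2 - ym = 0" "\<And>r. rm + e \<le> r \<Longrightarrow> r < c \<Longrightarrow> (f r)^2 - ym < 0"
    using first_zero[of "rm + e" t "\<lambda>r. (f r)^2 - ym"] t e fdec[of "rm + e"] unfolding ym_def
    by (smt (verit, ccfv_SIG))
  \<comment> \<open>Obtained from the angle equation multiplied by \<open>2 r^2 p\<close>. The
    constants are chosen so that \<open>G rm = 0\<close> and
    \<open>G c = c^2 (p c)^2\<close>.\<close>
  define G where "G = (\<lambda>r. r^2 * (p r)^2 - m * ((f r)^2 - ym) - r^2 * (W ((g r)^2) - W (1 - ym)) / \<eta>^2)"
  have dG: "(G has_real_derivative - 2 * (m - 1) * r * (p r)^2 - 2 * r * (W ((g r)^2) - W (1 - ym)) / \<eta>^2) (at r)"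
    if r: "0 < r" "r < 1" for r
  proof -
    have "((\<lambda>r. W ((g r)^2)) has_real_derivative W1 ((g r)^2) * (2 * g r * (- f r * p r))) (at r)"
      using r g_pos[OF r] by (intro DERIV_chain2[OF W_deriv_at]) (auto intro!: derivative_eq_intros dg')
    then have "((\<lambda>r. W ((g r)^2)) has_real_derivative \<eta>^2 * w r * (2 * g r * (- f r * p r))) (at r)"
      using eta by (simp add: w_def)
    then have "(G has_real_derivative
       2 * r * (p r)^2 + r^2 * (2 * p r * (- m / r * p r + f r * g r * (m / r^2 - w r)))
       - m * (2 * f r * (g r * p r))
       - (2 * r * (W ((g r)^2) - W (1 - ym)) + r^2 * (\<eta>^2 * w r * (2 * g r * (- f r * p r)))) / \<eta>^2) (at r)"
      unfolding G_def using eta r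
      by (auto intro!: derivative_eq_intros df' dp simp: power2_eq_square)
    moreover have "2 * r * (p r)^2 + r^2 * (2 * p r * (- m / r * p r + f r * g r * (m / r^2 - w r)))
       - m * (2 * f r * (g r * p r))
       - (2 * r * (W ((g r)^2) - W (1 - ym)) + r^2 * (\<eta>^2 * w r * (2 * g r * (- f r * p r)))) / \<eta>^2
       = - 2 * (m - 1) * r * (p r)^2 - 2 * r * (W ((g r)^2) - W (1 - ym)) / \<eta>^2"
      using r eta by (simp add: field_simps power2_eq_square)
    ultimately show ?thesis by simp
  qed
  \<comment> \<open>Between \<open>rm\<close> and \<open>c\<close> one has
    \<open>g^2 > 1 - ym\<close>, so \<open>W\<close> strictly exceeds its value at
    \<open>1 - ym\<close>, where the slope is positive because \<open>w rm > 0\<close>. The kinetic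
    term has the right sign because \<open>m \<ge> 1\<close>.\<close>
  have "G c < G rm"
  proof (rule DERIV_neg_imp_decreasing_open[where f=G and a=rm and b=c])
    show "rm < c" using c e by simp
    fix r assume r: "rm < r" "r < c"
    then have r1: "0 < r" "r < 1" using rm01 c t by auto
    have "(f r)^2 < ym" using fdec[of r] c(4)[of r] r by (cases "r \<le> rm + e") (auto simp: ym_def)
    then have "1 - ym < (g r)^2" using unit[OF r1] by simp
    moreover have "W1 (1 - ym) > 0" using wrm ym(3) eta by (simp add: w_def zero_less_divide_iff)
    ultimately have "W ((g r)^2) - W (1 - ym) > 0" using W_strict[of "1 - ym" "(g r)^2"] ym by simp
    then have "2 * r * (W ((g r)^2) - W (1 - ym)) / \<eta>^2 > 0" using r1 eta by simp
    moreover have "2 * (m - 1) * r * (p r)^2 \<ge> 0" using m_ge r1 by simp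
    moreover have "- 2 * (m - 1) * r * (p r)^2 = - (2 * (m - 1) * r * (p r)^2)" by algebra
    ultimately have "- 2 * (m - 1) * r * (p r)^2 - 2 * r * (W ((g r)^2) - W (1 - ym)) / \<eta>^2 < 0"
      by linarith
    with dG[OF r1] show "\<exists>y. (G has_real_derivative y) (at r) \<and> y < 0" by blast
  next
    show "continuous_on {rm..c} G"
      by (rule DERIV_continuous_on[OF has_field_derivative_at_within[OF dG]]) (use rm01 c t in auto)
  qed
  moreover have "G rm = 0" using ym prm by (simp add: G_def ym_def)
  moreover have "(g c)^2 = 1 - ym" using unit[of c] c t rm01 e by auto
  then have "G c \<ge> 0" using c by (simp add: G_def)
  ultimately show False by simp
qed

lemma f_pos: assumes x: "0 < x" "x < 1" shows "f x > 0"
proof (rule ccontr)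
  assume "\<not> ?thesis"
  obtain t where t: "x < t" "t < 1" "f t > 0" using f_near_1[of 0 x] x by auto
  obtain y where "x \<le> y" "y \<le> t" "f y = 0"
    using IVT'[of f x 0 t] cont_f[of x t] t x \<open>\<not> f x > 0\<close> by auto
  then show False using S_pos[of y] x t by (simp add: S_def)
qed

lemma p_pos: assumes x: "0 < x" "x < 1" shows "p x > 0"
  using S_pos[OF x] f_pos[OF x] x by (simp add: S_def zero_less_mult_iff)

end

section \<open>Nonexistence in high dimensions\<close>

context mm_pos begin

text \<open>Hardy's inequality in Wronskian form: \<open>\<psi> = \<pi>/2 - \<theta>\<close> is compared with \<open>r\<^bsup>-(N-2)/2\<^esup>\<close>.\<close>
lemma dim_le_6: "N \<le> 6"
proof (rule ccontr)
  assume "\<not> ?thesis"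
  then have N7: "real N \<ge> 7" by simp
  define \<psi> where "\<psi> = (\<lambda>r. arccos (f r))"
  define q where "q = (real N - 2) / 2"
  have d\<psi>: "(\<psi> has_real_derivative - p r) (at r)" if r: "0 < r" "r < 1" for r
  proof -
    have "((\<lambda>r. arccos (f r)) has_real_derivative inverse (- sqrt (1 - (f r)^2)) * (g r * p r)) (at r)"
      using f_bound[OF r] by (intro DERIV_chain2[OF DERIV_arccos] df' r) auto
    moreover have "sqrt (1 - (f r)^2) = g r"
      using unit[OF r] g_pos[OF r] by (intro real_sqrt_unique) auto
    moreover have "inverse (- g r) * (g r * p r) = - p r" using g_pos[OF r] by simp
    ultimately show ?thesis unfolding \<psi>_def by metis
  qed
  have \<psi>: "0 < \<psi> r" "\<psi> r \<le> pi / 2" "f r * g r < \<psi> r" if r: "0 < r" "r < 1" for r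
  proof -
    have c: "cos (\<psi> r) = f r" unfolding \<psi>_def using f_bound[OF r] by (intro cos_arccos) auto
    have "0 \<le> \<psi> r" "\<psi> r \<le> pi/2" unfolding \<psi>_def
      using f_bound[OF r] f_pos[OF r] arccos_lbound[of "f r"] arccos_le_pi2[of "f r"] by auto
    moreover have "\<psi> r \<noteq> 0" using c f_bound[OF r] by auto
    ultimately show p0: "0 < \<psi> r" "\<psi> r \<le> pi / 2" by auto
    have "sin (\<psi> r) = g r"
    proof -
      have "(sin (\<psi> r))^2 = (g r)^2" using unit[OF r] c sin_cos_squared_add[of "\<psi> r"] by simp
      moreover have "sin (\<psi> r) \<ge> 0" using p0 pi_gt_zero by (intro sin_ge_zero) linarith+
      ultimately show ?thesis using g_pos[OF r] by (simp add: power2_eq_iff_nonneg)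
    qed
    then have "g r \<le> \<psi> r" using sin_x_le_x[of "\<psi> r"] p0 by simp
    then have "f r * g r \<le> f r * \<psi> r" using f_pos[OF r] by simp
    also have "\<dots> < 1 * \<psi> r" using p0 f_bound[OF r] by (intro mult_strict_right_mono) auto
    finally show "f r * g r < \<psi> r" by simp
  qed
  define h where "h = (\<lambda>r::real. r powr (- q))"
  have dh: "(h has_real_derivative - q / r * h r) (at r)" if "r > 0" for r
    unfolding h_def using that
    by (auto intro!: derivative_eq_intros simp: powr_diff field_simps)
  \<comment> \<open>This is the Wronskian \<open>r^(N-1) (h \<psi>' - h' \<psi>)\<close>.\<close>
  define X where "X = (\<lambda>r. r^(N-1) * h r * (q / r * \<psi> r - p r))"
  have dX: "\<exists>y. (X has_real_derivative y) (at r) \<and> y > 0" if r: "0 < r" "r < 1" for r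
  proof -
    define A where "A = r^(N-1) * h r"
    have A: "A > 0" using r by (simp add: A_def h_def)
    have "((\<lambda>r. r^(N-1) * h r) has_real_derivative (m - q) / r * A) (at r)"
    proof -
      have "((\<lambda>r. r^(N-1) * h r) has_real_derivative (real N - 1) / r * r^(N-1) * h r + (- q / r * h r) * r^(N-1)) (at r)"
        using r N2 by (intro DERIV_mult DERIV_power_dim dh) auto
      moreover have "(real N - 1) / r * r^(N-1) * h r + (- q / r * h r) * r^(N-1) = (m - q) / r * A"
        using r by (simp add: A_def m_def field_simps)
      ultimately show ?thesis by metis
    qed
    moreover have "((\<lambda>r. q / r * \<psi> r - p r) has_real_derivative
         (- q / r^2) * \<psi> r + (- p r) * (q / r) - (- m / r * p r + f r * g r * (m / r^2 - w r))) (at r)"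
      using r by (intro DERIV_diff DERIV_mult d\<psi> dp) (auto intro!: derivative_eq_intros simp: power2_eq_square)
    ultimately have "(X has_real_derivative (m - q) / r * A * (q / r * \<psi> r - p r)
       + ((- q / r^2) * \<psi> r + (- p r) * (q / r) - (- m / r * p r + f r * g r * (m / r^2 - w r))) * A) (at r)"
      unfolding X_def A_def by (rule DERIV_mult)
    moreover have "(m - q) / r * A * (q / r * \<psi> r - p r)
       + ((- q / r^2) * \<psi> r + (- p r) * (q / r) - (- m / r * p r + f r * g r * (m / r^2 - w r))) * A
       = A * (((m - q - 1) * q * \<psi> r - m * (f r * g r)) / r^2 + f r * g r * w r)"
      using r by (simp add: field_simps power2_eq_square)
    moreover have "((m - q - 1) * q * \<psi> r - m * (f r * g r)) / r^2 + f r * g r * w r > 0"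
    proof -
      \<comment> \<open>Here \<open>m - q - 1 = q\<close>, so this is Hardy's constant
        \<open>q^2\<close> minus \<open>N - 1\<close>; it is positive from \<open>N = 7\<close> on,
        where \<open>(N-4)^2 \<ge> 9\<close>.\<close>
      have "(m - q - 1) * q - m = ((real N - 4)^2 - 8) / 4"
        unfolding q_def m_def by (simp add: field_simps power2_eq_square)
      moreover have "(real N - 4)^2 \<ge> 3^2" using N7 by (intro power_mono) auto
      ultimately have "m \<le> (m - q - 1) * q" by simp
      then have "m * \<psi> r \<le> (m - q - 1) * q * \<psi> r" using \<psi>[OF r] by (intro mult_right_mono) auto
      moreover have "m * (f r * g r) < m * \<psi> r" using \<psi>[OF r] m_ge by simp
      ultimately have "((m - q - 1) * q * \<psi> r - m * (f r * g r)) / r^2 > 0" using r by simp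
      moreover have "f r * g r * w r \<ge> 0" using f_pos[OF r] g_pos[OF r] w_nonneg[of r] by simp
      ultimately show ?thesis by linarith
    qed
    ultimately show ?thesis using A by force
  qed
  have Xmono: "X x < X y" if "0 < x" "x < y" "y < 1" for x y
    by (rule DERIV_pos_imp_increasing[OF that(2)]) (use dX that in force)
  have hp: "r^(N-1) * h r \<le> 1" "r^(N-1) * h r * (1 / r) \<le> 1" if r: "0 < r" "r < 1" for r
  proof -
    have a: "r^(N-1) * h r = r powr (m - q)"
      using r N2 by (simp add: h_def powr_realpow[symmetric] powr_add[symmetric] m_def of_nat_diff)
    show "r^(N-1) * h r \<le> 1" unfolding a using r N7
      by (intro powr_le1) (auto simp: m_def q_def field_simps)
    have "r^(N-1) * h r * (1 / r) = r powr (m - q - 1)" unfolding a using r by (simp add: powr_diff)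
    also have "\<dots> \<le> 1" using r N7 by (intro powr_le1) (auto simp: m_def q_def field_simps)
    finally show "r^(N-1) * h r * (1 / r) \<le> 1" .
  qed
  \<comment> \<open>The exponent \<open>q\<close> is exactly the one for which
    \<open>(r^(N-1) h p)^2 = r^N p^2\<close>, the quantity that finite energy makes small near the
    origin. So the increasing function \<open>X\<close> cannot be negative at
    \<open>1/4\<close>.\<close>
  have Xhalf: "X (1/2) > 0"
  proof -
    have ge: "X (1/4) \<ge> 0"
    proof (rule ccontr)
      assume "\<not> ?thesis"
      then have e: "- X (1/4) > 0" by simp
      obtain r where r: "0 < r" "r < 1/4" "r < 1" "r^N * (p r)^2 < (- X (1/4))^2"
        using small_near_0[of "1/4" "(- X (1/4))^2"] e by auto
      have "r^(N-1) * h r * p r < - X (1/4)"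
      proof -
        have "(r^(N-1) * h r)^2 = r powr (2 * (m - q))"
          using r N2 by (simp add: h_def powr_realpow[symmetric] powr_add[symmetric] m_def of_nat_diff
              power2_eq_square algebra_simps)
        also have "2 * (m - q) = real N" by (simp add: m_def q_def field_simps)
        finally have "(r^(N-1) * h r * p r)^2 = r^N * (p r)^2"
          using r by (simp add: power_mult_distrib powr_realpow)
        with r have "(r^(N-1) * h r * p r)^2 < (- X (1/4))^2" by simp
        then show ?thesis using e by (meson less_eq_real_def power_less_imp_less_base)
      qed
      moreover have "X r \<ge> - (r^(N-1) * h r * p r)"
      proof -
        have "r^(N-1) * h r * (q / r * \<psi> r) \<ge> 0"
          using r \<psi>(1)[of r] N7 by (auto simp: h_def q_def)
        then show ?thesis unfolding X_def by (simp add: algebra_simps)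
      qed
      ultimately show False using Xmono[of r "1/4"] r by simp
    qed
    then show ?thesis using Xmono[of "1/4" "1/2"] by simp
  qed
  have q0: "q > 0" using N7 by (simp add: q_def)
  \<comment> \<open>Chosen so that \<open>f t > y\<close> forces
    \<open>q * \<psi> t < X (1/2) / 2\<close>. As \<open>X t \<le> q * \<psi> t\<close>, this
    contradicts the monotonicity of \<open>X\<close>. The cap \<open>pi/4\<close> keeps the argument
    in the range where \<open>arccos\<close> inverts \<open>cos\<close>.\<close>
  define y where "y = cos (min (pi/4) (X (1/2) / (2 * q)))"
  have mpos: "0 < min (pi/4) (X (1/2) / (2 * q))" "min (pi/4) (X (1/2) / (2 * q)) < pi"
    using Xhalf q0 pi_gt_zero by (auto intro!: min.strict_coboundedI1)
  have "y < 1" unfolding y_def using cos_monotone_0_pi[of 0 "min (pi/4) (X (1/2) / (2 * q))"] mpos by auto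
  then obtain t where t: "1/2 < t" "t < 1" "f t > y" using f_near_1[of y "1/2"] by auto
  have "\<psi> t < min (pi/4) (X (1/2) / (2 * q))"
  proof -
    have "\<psi> t < arccos y" unfolding \<psi>_def using t f_bound[of t]
      by (intro arccos_less_arccos) (auto simp: y_def)
    also have "arccos y = min (pi/4) (X (1/2) / (2 * q))"
      unfolding y_def using mpos by (intro arccos_cos) auto
    finally show ?thesis .
  qed
  then have st: "\<psi> t < X (1/2) / (2 * q)" by simp
  have t01: "0 < t" "t < 1" using t by auto
  have "X t \<le> r_bound" if "r_bound = q * \<psi> t" for r_bound
  proof -
    have "X t = r_bound * (t^(N-1) * h t * (1/t)) - t^(N-1) * h t * p t"
      unfolding X_def that by (simp add: algebra_simps)
    also have "\<dots> \<le> r_bound * 1 - 0"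
      using hp[OF t01] \<psi>[OF t01] q0 p_pos[OF t01] t01
      by (intro diff_mono mult_left_mono) (auto simp: that h_def)
    finally show ?thesis by simp
  qed
  then have "X t \<le> q * \<psi> t" by simp
  also have "\<dots> < X (1/2)" using st q0 Xhalf by (simp add: field_simps)
  finally show False using Xmono[of "1/2" t] t by simp
qed

end

section \<open>Minimality\<close>

text \<open>Identities are available on compact subintervals only. Continuity of the indefinite
  integral makes the error small as soon as both endpoints are close enough to 0 and 1, so each may
  later be chosen freely.\<close>

lemma integral_exhaust:
  fixes u :: "real \<Rightarrow> real"
  assumes u: "u integrable_on {0<..<1}" and "\<epsilon> > 0"
  obtains \<delta> where "\<delta> > 0"
    "\<And>a b. \<lbrakk>0 < a; a < \<delta>; 1 - \<delta> < b; b < 1; a \<le> b\<rbrakk> \<Longrightarrow> \<bar>integral {0<..<1} u - integral {a..b} u\<bar> < \<epsilon>"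
proof -
  have ui: "u integrable_on {0..1}" using u by (simp add: integrable_on_open_interval_real)
  define F where "F = (\<lambda>x. integral {0..x} u)"
  have cF: "continuous_on {0..1} F" unfolding F_def by (rule indefinite_integral_continuous_1[OF ui])
  have F0: "F 0 = 0" by (simp add: F_def)
  obtain d0 where d0: "d0 > 0" "\<And>x. x \<in> {0..1} \<Longrightarrow> \<bar>x - 0\<bar> < d0 \<Longrightarrow> \<bar>F x - F 0\<bar> < \<epsilon> / 2"
    using cF \<open>\<epsilon>>0\<close> unfolding continuous_on_iff dist_real_def
    by (metis atLeastAtMost_iff half_gt_zero order_refl zero_le_one)
  obtain d1 where d1: "d1 > 0" "\<And>x. x \<in> {0..1} \<Longrightarrow> \<bar>x - 1\<bar> < d1 \<Longrightarrow> \<bar>F x - F 1\<bar> < \<epsilon> / 2"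
    using cF \<open>\<epsilon>>0\<close> unfolding continuous_on_iff dist_real_def
    by (metis atLeastAtMost_iff half_gt_zero order_refl zero_le_one)
  show ?thesis
  proof (rule that[of "min d0 d1"])
    fix a b assume ab: "0 < a" "a < min d0 d1" "1 - min d0 d1 < b" "b < 1" "a \<le> b"
    have "integral {0..a} u + integral {a..b} u = integral {0..b} u"
      using ab by (intro Henstock_Kurzweil_Integration.integral_combine integrable_on_subinterval[OF ui]) auto
    then have "integral {a..b} u = F b - F a" by (simp add: F_def)
    moreover have "integral {0<..<1} u = F 1" by (simp add: F_def integral_open_interval_real)
    moreover have "\<bar>F a - F 0\<bar> < \<epsilon> / 2" "\<bar>F b - F 1\<bar> < \<epsilon> / 2"
      using d0(2)[of a] d1(2)[of b] ab by auto
    ultimately show "\<bar>integral {0<..<1} u - integral {a..b} u\<bar> < \<epsilon>" using F0 by linarith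
  qed (use d0 d1 in auto)
qed

lemma continuous_bounded_integrable_Ioo:
  fixes v :: "real \<Rightarrow> real"
  assumes "continuous_on {0<..<1} v" "\<And>r. 0 < r \<Longrightarrow> r < 1 \<Longrightarrow> \<bar>v r\<bar> \<le> C"
  shows "v integrable_on {0<..<1}"
proof (rule measurable_bounded_by_integrable_imp_integrable_real)
  show "v \<in> borel_measurable (lebesgue_on {0<..<1})"
    by (rule continuous_imp_measurable_on_sets_lebesgue) (use assms in auto)
  show "(\<lambda>_. C) integrable_on {0<..<1::real}" unfolding integrable_on_open_interval_real by (rule integrable_const_ivl)
qed (use assms in auto)

text \<open>The weak derivative is given only as a gauge integrand. Away from 0 the weight can be
  divided out, and \<open>2 \<bar>u'\<bar> \<le> 1 + u'^2\<close> upgrades it to absolute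
  integrability, as the product rule requires.\<close>

lemma weak_derivative_regularity:
  fixes u u' :: "real \<Rightarrow> real"
  assumes u: "\<And>a b. 0 < a \<Longrightarrow> a \<le> b \<Longrightarrow> b < 1 \<Longrightarrow> (u' has_integral (u b - u a)) {a..b}"
    and sq: "(\<lambda>r. (u' r)^2 * r^n) integrable_on {0<..<1}"
    and ab: "0 < a" "b < 1"
  shows "continuous_on {a..b} u" "(\<lambda>r. (u' r)^2) absolutely_integrable_on {a..b}" "u' absolutely_integrable_on {a..b}"
proof -
  have "continuous_on {a..b} u \<and> (\<lambda>r. (u' r)^2) absolutely_integrable_on {a..b} \<and> u' absolutely_integrable_on {a..b}"
  proof (cases "a \<le> b")
    case True
    have ui: "u' integrable_on {a..b}" using u[OF ab(1) True ab(2)] by blast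
    have "continuous_on {a..b} (\<lambda>x. u a + integral {a..x} u')"
      by (intro continuous_intros indefinite_integral_continuous_1 ui)
    moreover have "u a + integral {a..x} u' = u x" if "x \<in> {a..b}" for x
      using integral_unique[OF u[of a x]] ab that by auto
    ultimately have c: "continuous_on {a..b} u" by (rule continuous_on_eq)
    have "(\<lambda>r. (u' r)^2 * r^n) integrable_on {a..b}"
      by (rule integrable_on_subinterval[OF sq]) (use ab in auto)
    then have "(\<lambda>r. (u' r)^2 * r^n) absolutely_integrable_on {a..b}"
      by (rule nonnegative_absolutely_integrable_1) (use ab in auto)
    moreover have "continuous_on {a..b} (\<lambda>r. inverse (r^n))"
      using ab by (intro continuous_intros) auto
    ultimately have "(\<lambda>r. inverse (r^n) * ((u' r)^2 * r^n)) absolutely_integrable_on {a..b}"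
      by (rule absint_mult_continuous[rotated])
    moreover have "(\<lambda>r. inverse (r^n) * ((u' r)^2 * r^n)) absolutely_integrable_on {a..b}
        \<longleftrightarrow> (\<lambda>r. (u' r)^2) absolutely_integrable_on {a..b}"
      using ab by (intro set_integrable_cong) auto
    ultimately have s: "(\<lambda>r. (u' r)^2) absolutely_integrable_on {a..b}" by simp
    have "u' absolutely_integrable_on {a..b}"
    proof (rule absolutely_integrable_integrable_bound[OF _ ui])
      show "(\<lambda>r. 1 + (u' r)^2) integrable_on {a..b}"
        using s by (intro integrable_add set_lebesgue_integral_eq_integral(1)) auto
      fix x
      have "\<bar>u' x\<bar> * 2 \<le> 1 + (u' x)^2" using zero_le_power2[of "\<bar>u' x\<bar> - 1"] by (simp add: power2_diff)
      then show "norm (u' x) \<le> 1 + (u' x)^2" by simp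
    qed
    with c s show ?thesis by blast
  qed auto
  then show "continuous_on {a..b} u" "(\<lambda>r. (u' r)^2) absolutely_integrable_on {a..b}" "u' absolutely_integrable_on {a..b}"
    by auto
qed

text \<open>The Cauchy-Schwarz inequality in Young's form; the parameter \<open>s\<close> is
  optimised by the caller.\<close>

lemma weak_deriv_bound:
  fixes u u' :: "real \<Rightarrow> real"
  assumes "(u' has_integral d) {b..t}" "(\<lambda>r. (u' r)^2) integrable_on {b..t}" "b \<le> t" "s > 0"
  shows "\<bar>d\<bar> \<le> (s * (t - b) + integral {b..t} (\<lambda>r. (u' r)^2) / s) / 2"
proof -
  have i: "((\<lambda>r. (s + (u' r)^2 / s) / 2) has_integral (s * (t - b) + integral {b..t} (\<lambda>r. (u' r)^2) / s) / 2) {b..t}"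
    using assms(2,3) has_integral_const_real[of s b t]
    by (intro has_integral_divide has_integral_add integrable_integral) (auto simp: mult.commute)
  have "norm (integral {b..t} u') \<le> integral {b..t} (\<lambda>r. (s + (u' r)^2 / s) / 2)"
  proof (rule integral_norm_bound_integral)
    fix x
    have "\<bar>u' x\<bar> * 2 * s \<le> s^2 + (u' x)^2" using zero_le_power2[of "\<bar>u' x\<bar> - s"] by (simp add: power2_diff)
    then show "norm (u' x) \<le> (s + (u' x)^2 / s) / 2" using \<open>s>0\<close> by (simp add: field_simps power2_eq_square)
  qed (use assms i in blast)+
  then show ?thesis using integral_unique[OF i] integral_unique[OF assms(1)] by simp
qed

text \<open>Integration by parts behind the factorisation
  \<open>u'\<^sup>2 + Q u\<^sup>2 = (u' - \<rho> u)\<^sup>2 + r\<^bsup>1-N\<^esup> (r\<^bsup>N-1\<^esup> \<rho> u\<^sup>2)'\<close>, where \<open>\<rho>\<close> is the logarithmic derivative of a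
  positive solution \<open>\<phi>\<close> of \<open>\<phi>'' + (N-1)/r \<phi>' = Q \<phi>\<close>.\<close>
lemma hardy_decomposition:
  fixes u u' \<phi> \<phi>1 \<phi>2 Q :: "real \<Rightarrow> real"
  assumes u: "\<And>a b. 0 < a \<Longrightarrow> a \<le> b \<Longrightarrow> b < 1 \<Longrightarrow> (u' has_integral (u b - u a)) {a..b}"
    and sq: "(\<lambda>r. (u' r)^2 * r^(N-1)) integrable_on {0<..<1}"
    and ab: "0 < a" "a \<le> b" "b < 1" and N: "N \<ge> 1"
    and d: "\<And>r. 0 < r \<Longrightarrow> r < 1 \<Longrightarrow> (\<phi> has_real_derivative \<phi>1 r) (at r)"
    and d1: "\<And>r. 0 < r \<Longrightarrow> r < 1 \<Longrightarrow> (\<phi>1 has_real_derivative \<phi>2 r) (at r)"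
    and eq: "\<And>r. 0 < r \<Longrightarrow> r < 1 \<Longrightarrow> \<phi>2 r + (real N - 1) / r * \<phi>1 r = Q r * \<phi> r"
    and pos: "\<And>r. 0 < r \<Longrightarrow> r < 1 \<Longrightarrow> \<phi> r > 0"
    and cQ: "continuous_on {0<..<1} Q"
  shows "((\<lambda>r. r^(N-1) * (2 * (\<phi>1 r / \<phi> r) * u r * u' r + (Q r - (\<phi>1 r / \<phi> r)^2) * (u r)^2)) has_integral
     (b^(N-1) * (\<phi>1 b / \<phi> b) * (u b)^2 - a^(N-1) * (\<phi>1 a / \<phi> a) * (u a)^2)) {a..b}"
proof -
  define \<rho> where "\<rho> = (\<lambda>r. \<phi>1 r / \<phi> r)"
  define \<beta> where "\<beta> = (\<lambda>r. r^(N-1) * \<rho> r)"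
  define \<beta>' where "\<beta>' = (\<lambda>r. r^(N-1) * (Q r - (\<rho> r)^2))"
  have d\<beta>: "(\<beta> has_real_derivative \<beta>' r) (at r)" if r: "0 < r" "r < 1" for r
  proof -
    have "(\<rho> has_real_derivative (\<phi>2 r * \<phi> r - \<phi>1 r * \<phi>1 r) / (\<phi> r * \<phi> r)) (at r)"
      unfolding \<rho>_def using pos[OF r] by (intro DERIV_divide d d1 r) auto
    then have "(\<beta> has_real_derivative (real N - 1) / r * r^(N-1) * \<rho> r
        + (\<phi>2 r * \<phi> r - \<phi>1 r * \<phi>1 r) / (\<phi> r * \<phi> r) * r^(N-1)) (at r)"
      unfolding \<beta>_def using r N by (intro DERIV_mult DERIV_power_dim) auto
    moreover have "(real N - 1) / r * r^(N-1) * \<rho> r + (\<phi>2 r * \<phi> r - \<phi>1 r * \<phi>1 r) / (\<phi> r * \<phi> r) * r^(N-1) = \<beta>' r"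
    proof -
      define c where "c = (real N - 1) / r"
      have e: "\<phi>2 r = Q r * \<phi> r - c * \<phi>1 r" using eq[OF r] by (simp add: c_def)
      show ?thesis using pos[OF r] unfolding \<beta>'_def \<rho>_def c_def[symmetric] e
        by (simp add: field_simps power2_eq_square)
    qed
    ultimately show ?thesis by simp
  qed
  have reg: "continuous_on {a..b} u" "u' absolutely_integrable_on {a..b}"
    using weak_derivative_regularity[OF u sq ab(1,3)] by auto
  have c\<rho>: "continuous_on {a..b} \<rho>" unfolding \<rho>_def
    using ab pos
    by (intro continuous_on_divide DERIV_continuous_on[OF has_field_derivative_at_within[OF d]]
        DERIV_continuous_on[OF has_field_derivative_at_within[OF d1]]) (auto simp: less_imp_neq[symmetric])
  have c\<beta>: "continuous_on {a..b} \<beta>" unfolding \<beta>_def by (intro continuous_intros c\<rho>)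
  have c\<beta>': "continuous_on {a..b} \<beta>'" unfolding \<beta>'_def
    using ab by (intro continuous_intros c\<rho> continuous_on_subset[OF cQ]) auto
  have iu: "(u' has_integral (u y - u x)) {x..y}" if "a \<le> x" "x \<le> y" "y \<le> b" for x y
    using u that ab by auto
  have usq: "((\<lambda>t. u t * u' t + u t * u' t) has_integral (u y * u y - u x * u x)) {x..y}" if "a \<le> x" "x \<le> y" "y \<le> b" for x y
    using that iu reg
    by (intro has_integral_product) (auto intro: continuous_on_subset absolutely_integrable_on_subinterval)
  have "((\<lambda>t. \<beta> t * (u t * u' t + u t * u' t) + (u t * u t) * \<beta>' t) has_integral (\<beta> b * (u b * u b) - \<beta> a * (u a * u a))) {a..b}"
  proof (rule has_integral_product)
    show "(\<beta>' has_integral (\<beta> y - \<beta> x)) {x..y}" if "a \<le> x" "x \<le> y" "y \<le> b" for x y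
      using that ab d\<beta> by (intro fundamental_theorem_of_calculus)
        (auto simp: has_real_derivative_iff_has_vector_derivative[symmetric] intro: has_field_derivative_at_within)
    show "(\<lambda>t. u t * u' t + u t * u' t) absolutely_integrable_on {a..b}"
      using absint_mult_continuous[OF reg] by (intro set_integral_add)
    show "\<beta>' absolutely_integrable_on {a..b}"
      using c\<beta>' by (rule absolutely_integrable_continuous_real)
  qed (use ab usq c\<beta> reg in \<open>auto intro: continuous_intros\<close>)
  moreover have "(\<lambda>t. \<beta> t * (u t * u' t + u t * u' t) + (u t * u t) * \<beta>' t)
     = (\<lambda>r. r^(N-1) * (2 * \<rho> r * u r * u' r + (Q r - (\<rho> r)^2) * (u r)^2))"
    unfolding \<beta>_def \<beta>'_def by (rule ext) (simp add: algebra_simps power2_eq_square)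
  ultimately show ?thesis unfolding \<rho>_def \<beta>_def by (simp add: power2_eq_square mult.assoc)
qed

definition energy_density :: "nat \<Rightarrow> real \<Rightarrow> (real \<Rightarrow> real) \<Rightarrow> (real \<Rightarrow> real) \<Rightarrow> (real \<Rightarrow> real) \<Rightarrow> (real \<Rightarrow> real) \<Rightarrow> (real \<Rightarrow> real) \<Rightarrow> real \<Rightarrow> real" where
  "energy_density N \<eta> W f f' g g' r =
     ((f' r)^2 + (g' r)^2 + (real N - 1) / r^2 * (f r)^2 + W ((g r)^2) / \<eta>^2) * r^(N-1)"

lemma IMM_energy_density: "IMM N \<eta> W f f' g g' = 1/2 * integral {0<..<1} (energy_density N \<eta> W f f' g g')"
  by (simp add: IMM_def energy_density_def[abs_def])

lemma BMM_D:
  assumes "BMM N f f' g g'"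
  shows "\<And>a b. 0 < a \<Longrightarrow> a \<le> b \<Longrightarrow> b < 1 \<Longrightarrow> (f' has_integral (f b - f a)) {a..b}"
    "\<And>a b. 0 < a \<Longrightarrow> a \<le> b \<Longrightarrow> b < 1 \<Longrightarrow> (g' has_integral (g b - g a)) {a..b}"
    "(\<lambda>r. (f' r)^2 * r^(N-1)) integrable_on {0<..<1}"
    "(\<lambda>r. (f r)^2 / r^2 * r^(N-1)) integrable_on {0<..<1}"
    "(\<lambda>r. (g' r)^2 * r^(N-1)) integrable_on {0<..<1}"
    "\<And>r. 0 < r \<Longrightarrow> r < 1 \<Longrightarrow> (f r)^2 + (g r)^2 = 1"
    "(f \<longlongrightarrow> 1) (at_left 1)" "(g \<longlongrightarrow> 0) (at_left 1)"
  using assms by (auto simp: BMM_def)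

lemma BMM_cont:
  assumes "BMM N f f' g g'"
  shows "continuous_on {0<..<1} f" "continuous_on {0<..<1} g"
proof -
  have *: "continuous_on {0<..<1} u"
    if u: "\<And>a b. 0 < a \<Longrightarrow> b < 1 \<Longrightarrow> continuous_on {a..b} u" for u :: "real \<Rightarrow> real"
  proof (rule continuous_at_imp_continuous_on, rule ballI)
    fix r :: real assume r: "r \<in> {0<..<1}"
    have "continuous_on {r/2<..<(r+1)/2} u"
      by (rule continuous_on_subset[OF u[of "r/2" "(r+1)/2"]]) (use r in auto)
    then show "isCont u r" using r by (subst (asm) continuous_on_eq_continuous_at) auto
  qed
  show "continuous_on {0<..<1} f" "continuous_on {0<..<1} g"
    using weak_derivative_regularity(1)[OF BMM_D(1,3)[OF assms]]
      weak_derivative_regularity(1)[OF BMM_D(2,5)[OF assms]] * by blast+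
qed

lemma (in potential) energy_density_integrable:
  assumes b: "BMM N f f' g g'"
  shows "energy_density N \<eta> W f f' g g' integrable_on {0<..<1}"
proof -
  have g1: "(g r)^2 \<le> 1" if "0 < r" "r < 1" for r
    using BMM_D(6)[OF b that] by (metis le_add_same_cancel2 zero_le_power2)
  have W: "(\<lambda>r. W ((g r)^2) / \<eta>^2 * r^(N-1)) integrable_on {0<..<1}"
  proof (rule continuous_bounded_integrable_Ioo[where C="W 1 / \<eta>^2"])
    show "continuous_on {0<..<1} (\<lambda>r. W ((g r)^2) / \<eta>^2 * r^(N-1))"
      by (cases "\<eta> = 0") (auto intro!: continuous_intros continuous_on_compose2[OF W_cont] BMM_cont[OF b])
    fix r :: real assume r: "0 < r" "r < 1"
    have "W ((g r)^2) / \<eta>^2 * r^(N-1) \<le> W 1 / \<eta>^2 * 1"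
      using W_mono[of "(g r)^2" 1] W_nonneg[of "(g r)^2"] W_nonneg[of 1] g1[OF r] r
      by (intro mult_mono divide_right_mono) (auto intro: power_le_one)
    then show "\<bar>W ((g r)^2) / \<eta>^2 * r^(N-1)\<bar> \<le> W 1 / \<eta>^2"
      using W_nonneg[of "(g r)^2"] r by simp
  qed
  have "(\<lambda>r. (f' r)^2 * r^(N-1) + (g' r)^2 * r^(N-1) + (real N - 1) * ((f r)^2 / r^2 * r^(N-1))
      + W ((g r)^2) / \<eta>^2 * r^(N-1)) integrable_on {0<..<1}"
    by (intro integrable_add integrable_on_mult_right BMM_D[OF b] W)
  moreover have "energy_density N \<eta> W f f' g g' = (\<lambda>r. (f' r)^2 * r^(N-1) + (g' r)^2 * r^(N-1) + (real N - 1) * ((f r)^2 / r^2 * r^(N-1))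
      + W ((g r)^2) / \<eta>^2 * r^(N-1))"
    by (rule ext) (simp add: energy_density_def algebra_simps)
  ultimately show ?thesis by simp
qed


section \<open>Comparison with a competitor and control of the boundary term\<close>

context mm_pos begin

definition lam :: "real \<Rightarrow> real" where
  "lam r = (f1 r)^2 + m / r^2 * (f r)^2 + (g1 r)^2 + w r * (g r)^2"

text \<open>The sum of the boundary terms \<open>r^(N-1) (f'/f) (h^2 - f^2)\<close> and
  \<open>r^(N-1) (g'/g) (k^2 - g^2)\<close>, simplified by \<open>k^2 - g^2 = f^2 - h^2\<close> and
  \<open>f'/f - g'/g = p / (f g)\<close>.\<close>

definition B :: "(real \<Rightarrow> real) \<Rightarrow> real \<Rightarrow> real" where
  "B h r = r^(N-1) * p r * ((h r)^2 - (f r)^2) / (f r * g r)"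

lemma eq_f': "0 < r \<Longrightarrow> r < 1 \<Longrightarrow> f2 r + (real N - 1) / r * f1 r = (m / r^2 - lam r) * f r"
  using eq_f[of r] by (simp add: lam_def m_def w_def algebra_simps)

lemma eq_g': "0 < r \<Longrightarrow> r < 1 \<Longrightarrow> g2 r + (real N - 1) / r * g1 r = (w r - lam r) * g r"
  using eq_g[of r] by (simp add: lam_def m_def w_def algebra_simps)

lemma cont01:
  "continuous_on {0<..<1} f" "continuous_on {0<..<1} g" "continuous_on {0<..<1} f1"
  "continuous_on {0<..<1} g1" "continuous_on {0<..<1} w" "continuous_on {0<..<1} lam"
proof -
  show a: "continuous_on {0<..<1} f" "continuous_on {0<..<1} g" "continuous_on {0<..<1} f1"
    "continuous_on {0<..<1} g1"
    by (rule DERIV_continuous_on[OF has_field_derivative_at_within[OF df]]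
        DERIV_continuous_on[OF has_field_derivative_at_within[OF dg]]
        DERIV_continuous_on[OF has_field_derivative_at_within[OF df1]]
        DERIV_continuous_on[OF has_field_derivative_at_within[OF dg1]]; simp)+
  show w: "continuous_on {0<..<1} w" unfolding w_def[abs_def] using eta
    by (intro continuous_intros continuous_on_compose2[OF W1_cont] a) auto
  show "continuous_on {0<..<1} lam" unfolding lam_def[abs_def]
    by (intro continuous_intros a w) auto
qed

text \<open>\<open>f\<close> and \<open>g\<close> solve linear equations with potentials
  \<open>m / r^2 - lam\<close> and \<open>w - lam\<close>. Completing squares with both leaves
  \<open>lam\<close> times \<open>h^2 + k^2 - f^2 - g^2 = 0\<close> and the gap between
  \<open>W\<close> and its tangent at \<open>g^2\<close>. The square in \<open>k\<close> is dropped;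
  the one in \<open>h\<close> suffices for the equality case.\<close>

lemma energy_comparison:
  assumes b: "BMM N h h' k k'" and ab: "0 < a" "a \<le> b" "b < 1"
  shows "(\<lambda>r. (h' r - f1 r / f r * h r)^2 * r^(N-1)) integrable_on {a..b}" (is ?int)
    and "integral {a..b} (energy_density N \<eta> W h h' k k') \<ge>
       integral {a..b} (energy_density N \<eta> W f f1 g g1)
       + integral {a..b} (\<lambda>r. (h' r - f1 r / f r * h r)^2 * r^(N-1)) + B h b - B h a" (is ?ineq)
proof -
  define X where "X = (\<lambda>(\<phi>1::real \<Rightarrow> real) (\<phi>::real \<Rightarrow> real) (Q::real \<Rightarrow> real) u u' r.
      r^(N-1) * (2 * (\<phi>1 r / \<phi> r) * u r * u' r + (Q r - (\<phi>1 r / \<phi> r)^2) * (u r)^2))"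
  define Qf where "Qf = (\<lambda>r. m / r^2 - lam r)"
  define Qg where "Qg = (\<lambda>r. w r - lam r)"
  define Y where "Y = (\<lambda>(\<phi>1::real \<Rightarrow> real) (\<phi>::real \<Rightarrow> real) u.
     b^(N-1) * (\<phi>1 b / \<phi> b) * (u b)^2 - a^(N-1) * (\<phi>1 a / \<phi> a) * (u a)^2)"
  have cQ: "continuous_on {0<..<1} Qf" "continuous_on {0<..<1} Qg"
    unfolding Qf_def Qg_def by (intro continuous_intros cont01; auto)+
  have N1: "N \<ge> 1" using N2 by simp
  have Q: "f2 r + (real N - 1) / r * f1 r = Qf r * f r" "g2 r + (real N - 1) / r * g1 r = Qg r * g r"
    if "0 < r" "r < 1" for r
    unfolding Qf_def Qg_def using eq_f'[OF that] eq_g'[OF that] by auto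
  have XI: "(X f1 f Qf h h' has_integral Y f1 f h) {a..b}" "(X g1 g Qg k k' has_integral Y g1 g k) {a..b}"
     "(X f1 f Qf f f1 has_integral Y f1 f f) {a..b}" "(X g1 g Qg g g1 has_integral Y g1 g g) {a..b}"
    unfolding X_def Y_def
    by (rule hardy_decomposition[OF BMM_D(1,3)[OF b] ab N1 df df1 Q(1) f_pos cQ(1)]
        hardy_decomposition[OF BMM_D(2,5)[OF b] ab N1 dg dg1 Q(2) g_pos cQ(2)]
        hardy_decomposition[OF BMM_D(1,3)[OF bmm] ab N1 df df1 Q(1) f_pos cQ(1)]
        hardy_decomposition[OF BMM_D(2,5)[OF bmm] ab N1 dg dg1 Q(2) g_pos cQ(2)]; assumption?)+
  have sq: "(h' r - f1 r / f r * h r)^2 * r^(N-1) = (h' r)^2 * r^(N-1) - X f1 f Qf h h' r + (r^(N-1) * Qf r) * (h r)^2" for r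
    unfolding X_def by (simp add: algebra_simps power2_eq_square)
  have reg: "continuous_on {a..b} h" using weak_derivative_regularity(1)[OF BMM_D(1,3)[OF b] ab(1,3)] by blast
  have "(\<lambda>r. (r^(N-1) * Qf r) * (h r)^2) integrable_on {a..b}"
    using ab by (intro integrable_continuous_real continuous_intros reg continuous_on_subset[OF cQ(1)]) auto
  then have "(\<lambda>r. (h' r)^2 * r^(N-1) - X f1 f Qf h h' r + (r^(N-1) * Qf r) * (h r)^2) integrable_on {a..b}"
    using XI(1) ab by (intro integrable_add integrable_diff integrable_on_subinterval[OF BMM_D(3)[OF b]]) auto
  then show int: ?int unfolding sq .
  have ei: "energy_density N \<eta> W u u' v v' integrable_on {a..b}" if "BMM N u u' v v'" for u u' v v'
    by (rule integrable_on_subinterval[OF energy_density_integrable[OF that]]) (use ab in auto)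
  define Z where "Z = (\<lambda>r. X f1 f Qf h h' r + X g1 g Qg k k' r - X f1 f Qf f f1 r - X g1 g Qg g g1 r)"
  define YZ where "YZ = Y f1 f h + Y g1 g k - Y f1 f f - Y g1 g g"
  have Z: "(Z has_integral YZ) {a..b}" unfolding Z_def YZ_def
    by (intro has_integral_diff has_integral_add XI)
  have le: "energy_density N \<eta> W f f1 g g1 r + (h' r - f1 r / f r * h r)^2 * r^(N-1) + Z r
      \<le> energy_density N \<eta> W h h' k k' r" if r: "r \<in> {a..b}" for r
  proof -
    have r1: "0 < r" "r < 1" using r ab by auto
    define t where "t = r^(N-1)"
    have t: "t > 0" using r1 by (simp add: t_def)
    define \<rho> where "\<rho> = f1 r / f r"
    define \<sigma> where "\<sigma> = g1 r / g r"
    have e: "f1 r = \<rho> * f r" "g1 r = \<sigma> * g r" using f_pos[OF r1] g_pos[OF r1] by (auto simp: \<rho>_def \<sigma>_def)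
    have c: "(h r)^2 + (k r)^2 = 1" "(f r)^2 + (g r)^2 = 1" using BMM_D(6)[OF b r1] unit[OF r1] by auto
    have cv: "W ((k r)^2) / \<eta>^2 \<ge> W ((g r)^2) / \<eta>^2 + w r * ((k r)^2 - (g r)^2)"
      using divide_right_mono[OF W_convex[of "(g r)^2" "(k r)^2"], of "\<eta>^2"] unfolding w_def
      by (simp add: add_divide_distrib)
    have c2: "lam r * ((h r)^2 + (k r)^2 - (f r)^2 - (g r)^2) = 0" using c by simp
    have "energy_density N \<eta> W h h' k k' r - (energy_density N \<eta> W f f1 g g1 r + (h' r - f1 r / f r * h r)^2 * r^(N-1) + Z r)
      = t * ((k' r - \<sigma> * k r)^2 + (W ((k r)^2) / \<eta>^2 - W ((g r)^2) / \<eta>^2 - w r * ((k r)^2 - (g r)^2))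
        + lam r * ((h r)^2 + (k r)^2 - (f r)^2 - (g r)^2))"
      unfolding energy_density_def Z_def X_def Qf_def Qg_def m_def[symmetric] t_def[symmetric] \<rho>_def[symmetric] \<sigma>_def[symmetric] e
      using f_pos[OF r1] g_pos[OF r1] by (simp add: algebra_simps power2_eq_square)
    also have "\<dots> \<ge> 0" unfolding c2 using t cv by simp
    finally show ?thesis by simp
  qed
  have "integral {a..b} (energy_density N \<eta> W f f1 g g1) + integral {a..b} (\<lambda>r. (h' r - f1 r / f r * h r)^2 * r^(N-1)) + YZ
      \<le> integral {a..b} (energy_density N \<eta> W h h' k k')"
    by (rule has_integral_le[OF has_integral_add[OF has_integral_add[OF integrable_integral[OF ei[OF bmm]] integrable_integral[OF int]] Z]
          integrable_integral[OF ei[OF b]]]) (use le in auto)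
  moreover have "YZ = B h b - B h a"
  proof -
    have "r^(N-1) * (f1 r / f r) * (h r)^2 + r^(N-1) * (g1 r / g r) * (k r)^2 - r^(N-1) * (f1 r / f r) * (f r)^2 - r^(N-1) * (g1 r / g r) * (g r)^2
      = B h r" if r: "0 < r" "r < 1" for r
    proof -
      have fg: "f r > 0" "g r > 0" using f_pos[OF r] g_pos[OF r] by auto
      have k2: "(k r)^2 = (f r)^2 + (g r)^2 - (h r)^2" using BMM_D(6)[OF b r] unit[OF r] by simp
      have "r^(N-1) * (f1 r / f r) * (h r)^2 + r^(N-1) * (g1 r / g r) * (k r)^2 - r^(N-1) * (f1 r / f r) * (f r)^2 - r^(N-1) * (g1 r / g r) * (g r)^2
        = r^(N-1) * ((h r)^2 - (f r)^2) * (f1 r / f r - g1 r / g r)" unfolding k2 by (simp add: algebra_simps)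
      also have "f1 r / f r - g1 r / g r = p r * ((f r)^2 + (g r)^2) / (f r * g r)"
        unfolding f1_eq[OF r] g1_eq[OF r] using fg by (simp add: field_simps power2_eq_square)
      finally show ?thesis unfolding unit[OF r] B_def by simp
    qed
    from this[of a] this[of b] show ?thesis unfolding YZ_def Y_def using ab by simp
  qed
  ultimately show ?ineq by simp
qed

text \<open>The function \<open>r^(N-1) (r f' - f)\<close> has derivative
  \<open>- r^N lam f \<le> 0\<close> and is bounded above by small values at radii tending to 0, so
  it is nonpositive. This bounds \<open>p / (f g)\<close> by a multiple of \<open>1/r\<close> near
  the origin.\<close>

lemma f1_le: assumes r: "0 < r" "r < 1" shows "r * f1 r \<le> f r"
proof (rule ccontr)
  assume neg: "\<not> ?thesis"
  define Z where "Z = (\<lambda>r. r^(N-1) * (r * f1 r - f r))"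
  have Zr: "Z r > 0" using neg r by (simp add: Z_def)
  obtain x where x: "0 < x" "x < r" "x < 1" "x^(N-1) * \<bar>p x\<bar> < Z r" using flux_small_near_0[OF r(1) Zr] by auto
  have "Z r \<le> Z x"
  proof (rule DERIV_nonpos_imp_nonincreasing[where f=Z])
    fix s assume s: "x \<le> s" "s \<le> r"
    then have s1: "0 < s" "s < 1" using x r by auto
    have "(Z has_real_derivative (real N - 1) / s * s^(N-1) * (s * f1 s - f s) + (s * f2 s) * s^(N-1)) (at s)"
      unfolding Z_def using s1 N2
      by (intro DERIV_mult DERIV_power_dim) (auto intro!: derivative_eq_intros df df1)
    moreover have "(real N - 1) / s * s^(N-1) * (s * f1 s - f s) + (s * f2 s) * s^(N-1) = - (s^(N-1) * s * lam s * f s)"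
    proof -
      have e: "f2 s = (m / s^2 - lam s) * f s - m / s * f1 s" using eq_f'[OF s1] by (simp add: m_def)
      show ?thesis unfolding e m_def[symmetric] using s1 by (simp add: field_simps power2_eq_square)
    qed
    moreover have "s^(N-1) * s * lam s * f s \<ge> 0"
      using s1 f_pos[OF s1] w_nonneg[of s] m_ge by (simp add: lam_def)
    ultimately show "\<exists>y. (Z has_real_derivative y) (at s) \<and> y \<le> 0" by (metis neg_le_0_iff_le)
  qed (use x in simp)
  also have "Z x \<le> x^(N-1) * \<bar>p x\<bar>"
  proof -
    have "x * f1 x - f x \<le> x * (g x * p x)" using f1_eq[OF x(1,3)] f_pos[OF x(1,3)] by simp
    also have "\<dots> \<le> 1 * (1 * p x)"
      using x p_pos[OF x(1,3)] g_le[OF x(1,3)] g_pos[OF x(1,3)] by (intro mult_mono) auto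
    finally show ?thesis unfolding Z_def using x p_pos[OF x(1,3)] by (intro mult_left_mono) auto
  qed
  also have "\<dots> < Z r" by (rule x)
  finally show False by simp
qed

lemma g_decreasing: assumes "0 < x" "x \<le> y" "y < 1" shows "g y \<le> g x"
proof (rule DERIV_nonpos_imp_nonincreasing[OF assms(2)])
  fix r assume "x \<le> r" "r \<le> y"
  then have r: "0 < r" "r < 1" using assms by auto
  show "\<exists>y. (g has_real_derivative y) (at r) \<and> y \<le> 0"
    using dg'[OF r] f_pos[OF r] p_pos[OF r] by (intro exI[of _ "- f r * p r"]) auto
qed

lemma f_increasing: assumes "0 < x" "x \<le> y" "y < 1" shows "f x \<le> f y"
proof (rule DERIV_nonneg_imp_nondecreasing[OF assms(2)])
  fix r assume "x \<le> r" "r \<le> y"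
  then have r: "0 < r" "r < 1" using assms by auto
  show "\<exists>y. (f has_real_derivative y) (at r) \<and> 0 \<le> y"
    using df'[OF r] g_pos[OF r] p_pos[OF r] by (intro exI[of _ "g r * p r"]) auto
qed

text \<open>With the previous slope bound, \<open>B h\<close> is at most a constant times
  \<open>r\<close> times the integrable density \<open>h^2 / r^2 r^(N-1)\<close> of the competitor.
  An upper bound is enough, as the inner boundary term enters with a minus sign.\<close>

lemma B_near_0:
  assumes b: "BMM N h h' k k'" and "\<delta> > 0" "\<epsilon> > 0"
  shows "\<exists>a. 0 < a \<and> a < \<delta> \<and> a < 1 \<and> B h a < \<epsilon>"
proof -
  define c where "c = g (1/2)"
  have c: "c > 0" using g_pos by (simp add: c_def)
  obtain a where a: "0 < a" "a < min \<delta> (1/2)" "a < 1" "a * ((h a)^2 / a^2 * a^(N-1)) < \<epsilon> * c^2"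
    using integrable_small_near_0[OF BMM_D(4)[OF b], of "min \<delta> (1/2)" "\<epsilon> * c^2"] assms(2,3) c by auto
  have g: "g a \<ge> c" unfolding c_def using g_decreasing[of a "1/2"] a by auto
  have fa: "f a > 0" using f_pos a by auto
  have "a * (g a * p a) \<le> f a" using f1_le[of a] f1_eq[of a] a by simp
  then have pf: "p a / (f a * g a) \<le> 1 / (a * c^2)"
  proof -
    assume "a * (g a * p a) \<le> f a"
    then have "p a / (f a * g a) \<le> 1 / (a * (g a)^2)" using a fa g c by (simp add: field_simps power2_eq_square)
    also have "\<dots> \<le> 1 / (a * c^2)" using a g c by (intro divide_left_mono mult_left_mono power_mono) auto
    finally show ?thesis .
  qed
  have "B h a = p a / (f a * g a) * (a^(N-1) * ((h a)^2 - (f a)^2))" by (simp add: B_def)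
  also have "\<dots> \<le> p a / (f a * g a) * (a^(N-1) * (h a)^2)"
    using p_pos[of a] fa g c a by (intro mult_left_mono) auto
  also have "\<dots> \<le> 1 / (a * c^2) * (a^(N-1) * (h a)^2)"
    using pf a by (intro mult_right_mono) auto
  also have "\<dots> = a * ((h a)^2 / a^2 * a^(N-1)) / c^2" using a by (simp add: field_simps power2_eq_square)
  also have "\<dots> < \<epsilon>" using a(4) c by (subst pos_divide_less_eq) auto
  finally show ?thesis using a by auto
qed

text \<open>A quantitative Hopf estimate. From radius \<open>r\<close> on, the flux loses at most
  \<open>M * g r\<close>, hence stays above \<open>L\<close>; then \<open>g\<close> decreases at
  least at rate \<open>c * L\<close>. Since \<open>g\<close> remains positive up to 1,
  \<open>c * L * (1 - r)\<close> cannot exceed \<open>g r\<close>.\<close>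

lemma flux_le_near_1:
  "\<exists>C>0. \<forall>r. 1/2 \<le> r \<longrightarrow> r < 1 \<longrightarrow> (1 - r) * (r^(N-1) * p r) \<le> C * g r"
proof -
  define M where "M = W1 1 / \<eta>^2"
  define c where "c = f (1/2)"
  have c: "c > 0" using f_pos by (simp add: c_def)
  have M: "M \<ge> 0" using W1_nonneg[of 1] by (simp add: M_def)
  have "(1 - r) * (r^(N-1) * p r) \<le> (1/c + M) * g r" if r: "1/2 \<le> r" "r < 1" for r
  proof -
    have r1: "0 < r" "r < 1" using r by auto
    define L where "L = r^(N-1) * p r - M * g r"
    have flux: "s^(N-1) * p s \<ge> L" if s: "r \<le> s" "s < 1" for s
    proof -
      have "r^(N-1) * p r + M * g r * r \<le> s^(N-1) * p s + M * g r * s"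
      proof (rule DERIV_nonneg_imp_nondecreasing[OF s(1)])
        fix x assume x: "r \<le> x" "x \<le> s"
        then have x1: "0 < x" "x < 1" using r1 s by auto
        have "((\<lambda>x. x^(N-1) * p x + M * g r * x) has_real_derivative
            x^(N-1) * (f x * g x * (m / x^2 - w x)) + M * g r) (at x)"
          by (intro DERIV_add d_flux x1) (auto intro!: derivative_eq_intros)
        moreover have "x^(N-1) * (f x * g x * (m / x^2 - w x)) + M * g r \<ge> 0"
        proof -
          have "x^(N-1) * (f x * g x) * w x \<le> 1 * (1 * g r) * M"
            using x1 x f_bound[OF x1] f_pos[OF x1] g_pos[OF x1] g_decreasing[of r x] r1 w_le[OF x1] w_nonneg M
            by (intro mult_mono) (auto intro: power_le_one simp: M_def)
          moreover have "x^(N-1) * (f x * g x) * (m / x^2) \<ge> 0"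
            using x1 f_pos[OF x1] g_pos[OF x1] m_ge by simp
          ultimately show ?thesis by (simp add: algebra_simps)
        qed
        ultimately show "\<exists>y. ((\<lambda>x. x^(N-1) * p x + M * g r * x) has_real_derivative y) (at x) \<and> 0 \<le> y" by blast
      qed
      moreover have "M * g r * (s - r) \<le> M * g r * 1" using M g_pos[OF r1] s r1 by (intro mult_left_mono) auto
      ultimately show ?thesis by (simp add: L_def algebra_simps)
    qed
    have "c * L * (1 - r) \<le> g r"
    proof (rule ccontr)
      assume "\<not> ?thesis"
      then have gL: "c * L * (1 - r) > g r" by simp
      then have cL: "c * L > 0" using g_pos[OF r1] r
        by (smt (verit) mult_nonpos_nonneg)
      \<comment> \<open>The radius at which a line of slope \<open>- c * L\<close> starting from
        \<open>g r\<close> reaches zero.\<close>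
      define t where "t = r + g r / (c * L)"
      have "g r / (c * L) < 1 - r" using gL cL by (simp add: pos_divide_less_eq mult.commute)
      then have t: "r < t" "t < 1" using cL g_pos[OF r1] by (auto simp: t_def)
      have "g t + c * L * t \<le> g r + c * L * r"
      proof (rule DERIV_nonpos_imp_nonincreasing[where f="\<lambda>x. g x + c * L * x" and a=r and b=t])
        fix x assume x: "r \<le> x" "x \<le> t"
        then have x1: "0 < x" "x < 1" using r1 t by auto
        have "((\<lambda>x. g x + c * L * x) has_real_derivative - f x * p x + c * L) (at x)"
          by (intro DERIV_add dg' x1) (auto intro!: derivative_eq_intros)
        moreover have "- f x * p x + c * L \<le> 0"
        proof -
          have "c * L \<le> c * (x^(N-1) * p x)" using flux[of x] x t c by (intro mult_left_mono) auto
          also have "\<dots> \<le> f x * (1 * p x)"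
            using c f_increasing[of "1/2" x] x r x1 p_pos[OF x1] f_pos[OF x1]
            by (intro mult_mono mult_right_mono) (auto intro: power_le_one simp: c_def)
          finally show ?thesis by simp
        qed
        ultimately show "\<exists>y. ((\<lambda>x. g x + c * L * x) has_real_derivative y) (at x) \<and> y \<le> 0" by blast
      qed (use t in simp)
      moreover have "c * L * t = c * L * r + g r" using cL unfolding t_def by (auto simp: distrib_left)
      ultimately show False using g_pos[of t] t r1 by simp
    qed
    then have "L * (1 - r) \<le> g r / c" using c by (simp add: field_simps)
    moreover have "M * g r * (1 - r) \<le> M * g r * 1" using M g_pos[OF r1] r by (intro mult_left_mono) auto
    ultimately show ?thesis unfolding L_def by (simp add: algebra_simps)
  qed
  then show ?thesis using c M by (intro exI[of _ "1/c + M"]) (auto intro: add_pos_nonneg)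
qed

text \<open>\<open>k\<close> has trace 0 and the tail of the integral of \<open>k'^2\<close>
  vanishes, so Cauchy-Schwarz gives \<open>k^2 = o(1 - r)\<close>. A mere \<open>O(1 - r)\<close>
  would not make the boundary term disappear.\<close>

lemma k_near_1:
  assumes b: "BMM N h h' k k'" and e: "\<epsilon> > 0"
  shows "\<exists>\<delta>>0. \<forall>r. 1 - \<delta> < r \<longrightarrow> 1/2 \<le> r \<longrightarrow> r < 1 \<longrightarrow> (k r)^2 \<le> \<epsilon> * (1 - r)"
proof -
  define u where "u = (\<lambda>r. (k' r)^2 * r^(N-1))"
  have ui: "u integrable_on {0<..<1}" using BMM_D(5)[OF b] by (simp add: u_def)
  have un: "u r \<ge> 0" if "r \<ge> 0" for r using that by (simp add: u_def)
  have e': "\<epsilon> / 2^(N-1) > 0" using e by simp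
  obtain \<delta> where d: "\<delta> > 0"
    "\<And>a b. \<lbrakk>0 < a; a < \<delta>; 1 - \<delta> < b; b < 1; a \<le> b\<rbrakk> \<Longrightarrow> \<bar>integral {0<..<1} u - integral {a..b} u\<bar> < \<epsilon> / 2^(N-1)"
    using integral_exhaust[OF ui e'] by metis
  have "(k r)^2 \<le> \<epsilon> * (1 - r)" if r: "1 - \<delta> < r" "1/2 \<le> r" "r < 1" for r
  proof -
    define a where "a = min (\<delta>/2) (1/2)"
    have a: "0 < a" "a < \<delta>" "a \<le> r" using d(1) r by (auto simp: a_def)
    have J: "integral {r..t} (\<lambda>r. (k' r)^2) \<le> \<epsilon>" if t: "r \<le> t" "t < 1" for t
    proof -
      have uat: "u integrable_on {x..t}" if "0 < x" for x
        by (rule integrable_on_subinterval[OF ui]) (use that t in auto)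
      have "integral {a..r} u + integral {r..t} u = integral {a..t} u"
        using a t uat[of a] by (intro Henstock_Kurzweil_Integration.integral_combine) auto
      moreover have "integral {a..t} u \<le> integral {0<..<1} u"
      proof (rule integral_subset_le[OF _ uat[OF a(1)] ui])
        show "{a..t} \<subseteq> {0<..<1}" using a t by auto
      qed (use un in auto)
      moreover have "integral {0<..<1} u - integral {a..r} u < \<epsilon> / 2^(N-1)" using d(2)[of a r] a r by auto
      ultimately have 1: "integral {r..t} u \<le> \<epsilon> / 2^(N-1)" by linarith
      have "integral {r..t} (\<lambda>r. (k' r)^2) \<le> integral {r..t} (\<lambda>r. 2^(N-1) * u r)"
      proof (rule integral_le)
        show "(\<lambda>r. (k' r)^2) integrable_on {r..t}"
          using weak_derivative_regularity(2)[OF BMM_D(2,5)[OF b], of r t] r t set_lebesgue_integral_eq_integral(1) by auto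
        show "(\<lambda>r. 2^(N-1) * u r) integrable_on {r..t}" using uat[of r] r by (intro integrable_on_mult_right) auto
        fix x assume x: "x \<in> {r..t}"
        \<comment> \<open>On \<open>[1/2, 1)\<close> the weight costs at most the factor
          \<open>2^(N-1)\<close>, which is why the tail was chosen below
          \<open>\<epsilon> / 2^(N-1)\<close>.\<close>
        have "1 \<le> (2 * x)^(N-1)" using x r by (intro one_le_power) auto
        then have "(k' x)^2 * 1 \<le> (k' x)^2 * (2 * x)^(N-1)" by (intro mult_left_mono) auto
        then show "(k' x)^2 \<le> 2^(N-1) * u x" by (simp add: u_def power_mult_distrib algebra_simps)
      qed
      also have "\<dots> = 2^(N-1) * integral {r..t} u" by simp
      also have "\<dots> \<le> 2^(N-1) * (\<epsilon> / 2^(N-1))" using 1 by (intro mult_left_mono) auto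
      finally show ?thesis by simp
    qed
    have bd: "\<bar>k t - k r\<bar> \<le> sqrt (\<epsilon> * (1 - r))" if t: "r \<le> t" "t < 1" for t
    proof -
      \<comment> \<open>The value that balances the two terms of \<open>weak_deriv_bound\<close>
        when the interval length is bounded by \<open>1 - r\<close> and the integral by
        \<open>\<epsilon>\<close>.\<close>
      define s where "s = sqrt (\<epsilon> / (1 - r))"
      have s: "s > 0" using e r by (simp add: s_def)
      have sd: "\<epsilon> = s * s * (1 - r)" using e r by (simp add: s_def)
      have "\<bar>k t - k r\<bar> \<le> (s * (t - r) + integral {r..t} (\<lambda>r. (k' r)^2) / s) / 2"
        using r t weak_derivative_regularity(2)[OF BMM_D(2,5)[OF b], of r t] set_lebesgue_integral_eq_integral(1)
        by (intro weak_deriv_bound BMM_D(2)[OF b] s) auto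
      also have "\<dots> \<le> (s * (1 - r) + \<epsilon> / s) / 2"
        using J[OF t] s t by (intro divide_right_mono add_mono mult_left_mono) auto
      also have "\<epsilon> / s = s * (1 - r)" using s sd by (simp add: field_simps)
      also have "s * (1 - r) = sqrt (\<epsilon> * (1 - r))"
      proof (rule real_sqrt_unique[symmetric])
        show "(s * (1 - r))^2 = \<epsilon> * (1 - r)" by (subst sd) (simp add: power2_eq_square)
      qed (use s r in auto)
      finally show ?thesis by simp
    qed
    have "((\<lambda>t. \<bar>k t - k r\<bar>) \<longlongrightarrow> \<bar>0 - k r\<bar>) (at_left 1)"
      by (intro tendsto_intros BMM_D(8)[OF b])
    moreover have "\<forall>\<^sub>F t in at_left 1. \<bar>k t - k r\<bar> \<le> sqrt (\<epsilon> * (1 - r))"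
      using bd r by (auto simp: eventually_at_left intro!: exI[of _ r])
    ultimately have "\<bar>0 - k r\<bar> \<le> sqrt (\<epsilon> * (1 - r))"
      by (intro tendsto_upperbound) auto
    then have "\<bar>k r\<bar>^2 \<le> (sqrt (\<epsilon> * (1 - r)))^2" by (intro power_mono) auto
    then show ?thesis using e r by simp
  qed
  then show ?thesis using d(1) by blast
qed

text \<open>Here \<open>h^2 - f^2 = g^2 - k^2\<close>, and the \<open>g^2\<close> part is
  favourable. In the \<open>k^2\<close> part the factor \<open>1 - r\<close> gained by
  \<open>k\<close> compensates the bound \<open>C g / (1 - r)\<close> of the flux.\<close>

lemma B_near_1:
  assumes b: "BMM N h h' k k'" and e: "\<epsilon> > 0"
  shows "\<exists>\<delta>>0. \<forall>r. 1 - \<delta> < r \<longrightarrow> 1/2 \<le> r \<longrightarrow> r < 1 \<longrightarrow> B h r \<ge> - \<epsilon>"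
proof -
  obtain C where C: "C > 0" "\<And>r. 1/2 \<le> r \<Longrightarrow> r < 1 \<Longrightarrow> (1 - r) * (r^(N-1) * p r) \<le> C * g r"
    using flux_le_near_1 by blast
  define c where "c = f (1/2)"
  have c: "c > 0" using f_pos by (simp add: c_def)
  have "\<epsilon> * c / C > 0" using e c C by simp
  then obtain \<delta> where d: "\<delta> > 0" "\<And>r. 1 - \<delta> < r \<Longrightarrow> 1/2 \<le> r \<Longrightarrow> r < 1 \<Longrightarrow> (k r)^2 \<le> \<epsilon> * c / C * (1 - r)"
    using k_near_1[OF b] by blast
  have "B h r \<ge> - \<epsilon>" if r: "1 - \<delta> < r" "1/2 \<le> r" "r < 1" for r
  proof -
    have r1: "0 < r" "r < 1" using r by auto
    have fg: "f r \<ge> c" "f r > 0" "g r > 0" using f_increasing[of "1/2" r] r f_pos[OF r1] g_pos[OF r1] by (auto simp: c_def)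
    define q where "q = r^(N-1) * p r"
    have q: "q > 0" using p_pos[OF r1] r1 by (simp add: q_def)
    have "(h r)^2 - (f r)^2 = (g r)^2 - (k r)^2" using BMM_D(6)[OF b r1] unit[OF r1] by simp
    then have "B h r = q * ((g r)^2 - (k r)^2) / (f r * g r)" by (simp add: B_def q_def)
    also have "\<dots> \<ge> - (q * (k r)^2) / (f r * g r)" using q fg by (intro divide_right_mono) (auto simp: algebra_simps)
    finally have 1: "B h r \<ge> - (q * (k r)^2 / (f r * g r))" by simp
    have "q * (k r)^2 \<le> q * (\<epsilon> * c / C * (1 - r))" using q d(2)[OF r] by (intro mult_left_mono) auto
    also have "\<dots> = \<epsilon> * c / C * ((1 - r) * q)" by simp
    also have "\<dots> \<le> \<epsilon> * c / C * (C * g r)" using C(2)[of r] r e c C(1) unfolding q_def by (intro mult_left_mono) auto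
    also have "\<dots> = \<epsilon> * (c * g r)" using C by simp
    also have "\<dots> \<le> \<epsilon> * (f r * g r)" using fg e by (intro mult_left_mono mult_right_mono) auto
    finally have "q * (k r)^2 / (f r * g r) \<le> \<epsilon>" using fg by (simp add: field_simps)
    with 1 show ?thesis by linarith
  qed
  then show ?thesis using d(1) by blast
qed

text \<open>The square is kept on a fixed compact interval while the interval of comparison exhausts
  \<open>(0,1)\<close>; this makes it available in the equality case.\<close>

lemma IMM_comparison:
  assumes b: "BMM N h h' k k'" and ab: "0 < \<alpha>" "\<alpha> \<le> \<beta>" "\<beta> < 1"
  shows "2 * IMM N \<eta> W f f1 g g1 + integral {\<alpha>..\<beta>} (\<lambda>r. (h' r - f1 r / f r * h r)^2 * r^(N-1))
     \<le> 2 * IMM N \<eta> W h h' k k'"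
proof (rule field_le_epsilon)
  fix e :: real assume "e > 0"
  \<comment> \<open>One third each for the energy outside \<open>[a, x]\<close> and for the two
    boundary terms.\<close>
  define \<epsilon> where "\<epsilon> = e / 3"
  have e: "\<epsilon> > 0" using \<open>e > 0\<close> by (simp add: \<epsilon>_def)
  define E where "E = energy_density N \<eta> W f f1 g g1"
  define H where "H = energy_density N \<eta> W h h' k k'"
  define Q where "Q = (\<lambda>r. (h' r - f1 r / f r * h r)^2 * r^(N-1))"
  have EI: "E integrable_on {0<..<1}" and HI: "H integrable_on {0<..<1}"
    unfolding E_def H_def by (intro energy_density_integrable bmm b)+
  obtain d1 where d1: "d1 > 0"
    "\<And>a b. \<lbrakk>0 < a; a < d1; 1 - d1 < b; b < 1; a \<le> b\<rbrakk> \<Longrightarrow> \<bar>integral {0<..<1} E - integral {a..b} E\<bar> < \<epsilon>"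
    using integral_exhaust[OF EI e] by metis
  obtain d2 where d2: "d2 > 0" "\<And>r. 1 - d2 < r \<Longrightarrow> 1/2 \<le> r \<Longrightarrow> r < 1 \<Longrightarrow> B h r \<ge> - \<epsilon>"
    using B_near_1[OF b e] by blast
  obtain a where a: "0 < a" "a < min d1 \<alpha>" "a < 1" "B h a < \<epsilon>"
    using B_near_0[OF b _ e, of "min d1 \<alpha>"] d1 ab by auto
  define \<mu> where "\<mu> = min (min d1 d2) (min (1 - \<beta>) (1/2))"
  have \<mu>: "0 < \<mu>" "\<mu> \<le> d1" "\<mu> \<le> d2" "\<mu> \<le> 1 - \<beta>" "\<mu> \<le> 1/2"
    using d1(1) d2(1) ab unfolding \<mu>_def by linarith+
  define x where "x = 1 - \<mu> / 2"
  have x: "1 - d1 < x" "1 - d2 < x" "\<beta> \<le> x" "1/2 \<le> x" "x < 1"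
    using \<mu> unfolding x_def by linarith+
  have ax: "a \<le> x" using a ab x by auto
  have "integral {\<alpha>..\<beta>} Q \<le> integral {a..x} Q"
    unfolding Q_def using a ab x ax energy_comparison(1)[OF b]
    by (intro integral_subset_le) auto
  moreover have "integral {a..x} H \<ge> integral {a..x} E + integral {a..x} Q + B h x - B h a"
    unfolding H_def E_def Q_def by (rule energy_comparison(2)[OF b a(1) ax x(5)])
  moreover have "integral {a..x} H \<le> integral {0<..<1} H"
  proof (rule integral_subset_le[OF _ _ HI])
    show "{a..x} \<subseteq> {0<..<1}" using a x by auto
    then show "H integrable_on {a..x}" by (rule integrable_on_subinterval[OF HI])
    show "\<forall>r\<in>{0<..<1}. 0 \<le> H r" unfolding H_def energy_density_def using W_nonneg N2
      by (auto intro!: mult_nonneg_nonneg add_nonneg_nonneg divide_nonneg_nonneg)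
  qed
  moreover have "integral {a..x} E > integral {0<..<1} E - \<epsilon>" using d1(2)[of a x] a x ax by auto
  moreover have "B h x \<ge> - \<epsilon>" using d2(2)[of x] x by auto
  ultimately show "2 * IMM N \<eta> W f f1 g g1 + integral {\<alpha>..\<beta>} (\<lambda>r. (h' r - f1 r / f r * h r)^2 * r^(N-1))
     \<le> 2 * IMM N \<eta> W h h' k k' + e"
    unfolding IMM_energy_density E_def[symmetric] H_def[symmetric] Q_def[symmetric] using a(4)
    by (simp add: \<epsilon>_def)
qed

lemma minimal: assumes b: "BMM N h h' k k'" shows "IMM N \<eta> W f f1 g g1 \<le> IMM N \<eta> W h h' k k'"
  using IMM_comparison[OF b, of "1/2" "1/2"] by simp

text \<open>The retained square is that of \<open>f (h/f)'\<close>, so \<open>h/f\<close> is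
  constant, and the traces at 1 make the constant 1. Then \<open>k^2 = g^2 > 0\<close>, and
  continuity of \<open>k\<close> fixes one sign.\<close>

lemma equality_case:
  assumes b: "BMM N h h' k k'" and le: "IMM N \<eta> W h h' k k' \<le> IMM N \<eta> W f f1 g g1"
  shows "(\<forall>r\<in>{0<..<1}. h r = f r \<and> k r = g r) \<or> (\<forall>r\<in>{0<..<1}. h r = f r \<and> k r = - g r)"
proof -
  have const: "h b / f b = h a / f a" if ab: "0 < a" "a \<le> b" "b < 1" for a b
  proof -
    define D where "D = (\<lambda>r. h' r - f1 r / f r * h r)"
    have Qi: "(\<lambda>r. (D r)^2 * r^(N-1)) integrable_on {a..b}"
      unfolding D_def by (rule energy_comparison(1)[OF b ab])
    have Q0: "integral {a..b} (\<lambda>r. (D r)^2 * r^(N-1)) = 0"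
    proof (rule antisym)
      show "integral {a..b} (\<lambda>r. (D r)^2 * r^(N-1)) \<le> 0"
        using IMM_comparison[OF b ab] le by (simp add: D_def)
      show "0 \<le> integral {a..b} (\<lambda>r. (D r)^2 * r^(N-1))"
        using Qi ab by (intro integral_nonneg) auto
    qed
    have nz: "f r \<noteq> 0" if "r \<in> {a..b}" for r using f_pos[of r] that ab by auto
    have "{a..b} \<subseteq> {0<..<1}" using ab by auto
    then have cf: "continuous_on {a..b} f" "continuous_on {a..b} f1"
      using cont01(1,3) continuous_on_subset by blast+
    have cf': "continuous_on {a..b} (\<lambda>r. 1 / f r)" using nz by (intro continuous_intros cf) auto
    have reg: "continuous_on {a..b} h" "h' absolutely_integrable_on {a..b}"
      using weak_derivative_regularity[OF BMM_D(1,3)[OF b] ab(1,3)] by auto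
    have "((\<lambda>t. h t * (- f1 t / (f t)^2) + 1 / f t * h' t) has_integral (h b * (1 / f b) - h a * (1 / f a))) {a..b}"
    proof (rule has_integral_product[OF ab(2)])
      show "(h' has_integral h y - h x) {x..y}" if "a \<le> x" "x \<le> y" "y \<le> b" for x y
        using BMM_D(1)[OF b] that ab by auto
      show "((\<lambda>t. - f1 t / (f t)^2) has_integral 1 / f y - 1 / f x) {x..y}" if "a \<le> x" "x \<le> y" "y \<le> b" for x y
      proof (rule fundamental_theorem_of_calculus[OF that(2)])
        fix r assume "r \<in> {x..y}"
        then have r: "0 < r" "r < 1" using that ab by auto
        have "((\<lambda>r. 1 / f r) has_real_derivative - f1 r / (f r)^2) (at r)"
          using f_pos[OF r] by (auto intro!: derivative_eq_intros df r simp: power2_eq_square)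
        then show "((\<lambda>r. 1 / f r) has_vector_derivative - f1 r / (f r)^2) (at r within {x..y})"
          by (simp add: has_real_derivative_iff_has_vector_derivative[symmetric] has_field_derivative_at_within)
      qed
      show "(\<lambda>t. - f1 t / (f t)^2) absolutely_integrable_on {a..b}"
        using nz by (intro absolutely_integrable_continuous_real continuous_intros cf) auto
    qed (use reg cf cf' in auto)
    moreover have "h t * (- f1 t / (f t)^2) + 1 / f t * h' t = D t / f t" if "t \<in> {a..b}" for t
      using nz[OF that] by (simp add: D_def field_simps power2_eq_square)
    ultimately have I: "((\<lambda>t. D t / f t) has_integral (h b / f b - h a / f a)) {a..b}"
      by (subst (asm) has_integral_cong[where g="\<lambda>t. D t / f t"]) auto
    define C where "C = 1 / ((f a)^2 * a^(N-1))"
    have C: "C > 0" using f_pos[of a] ab by (simp add: C_def)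
    \<comment> \<open>A vanishing square integral is converted directly into a bound for the
      increment of \<open>h/f\<close> by Young's inequality
      \<open>y \<le> e + y^2 / (4 e)\<close>.\<close>
    have small: "norm (h b / f b - h a / f a) \<le> e" if e: "e > 0" for e
    proof -
      have "norm (integral {a..b} (\<lambda>t. D t / f t)) \<le> integral {a..b} (\<lambda>t. e + C / (4 * e) * ((D t)^2 * t^(N-1)))"
      proof (rule integral_norm_bound_integral)
        show "(\<lambda>t. e + C / (4 * e) * ((D t)^2 * t^(N-1))) integrable_on {a..b}"
          by (intro integrable_add integrable_on_mult_right Qi integrable_const_ivl)
        fix t assume t: "t \<in> {a..b}"
        have ft: "f t \<ge> f a" "f a > 0" using f_increasing[of a t] f_pos[of a] t ab by auto
        define y where "y = \<bar>D t / f t\<bar>"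
        have "y^2 \<le> C * ((D t)^2 * t^(N-1))"
        proof -
          have "y^2 = (D t)^2 / (f t)^2" by (simp add: y_def power_divide)
          also have "\<dots> \<le> (D t)^2 / (f a)^2" using ft by (intro divide_left_mono power_mono) auto
          also have "\<dots> \<le> (D t)^2 * t^(N-1) / ((f a)^2 * a^(N-1))"
          proof -
            have "(D t)^2 * a^(N-1) \<le> (D t)^2 * t^(N-1)" using t ab by (intro mult_left_mono power_mono) auto
            then show ?thesis using ft ab by (simp add: field_simps)
          qed
          finally show ?thesis by (simp add: C_def)
        qed
        moreover have "y * (4 * e) \<le> 4 * e^2 + y^2" using zero_le_power2[of "2 * e - y"] by (simp add: power2_diff power2_eq_square algebra_simps)
        ultimately have "y * (4 * e) \<le> 4 * e^2 + C * ((D t)^2 * t^(N-1))" by simp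
        then have "y \<le> e + C / (4 * e) * ((D t)^2 * t^(N-1))" using e by (simp add: field_simps power2_eq_square)
        then show "norm (D t / f t) \<le> e + C / (4 * e) * ((D t)^2 * t^(N-1))" by (simp add: y_def)
      qed (use I in blast)
      also have "\<dots> = e * (b - a)"
      proof (rule integral_unique)
        have "((\<lambda>t. e + C / (4 * e) * ((D t)^2 * t^(N-1))) has_integral (e * (b - a) + C / (4 * e) * 0)) {a..b}"
          using has_integral_const_real[of e a b] integrable_integral[OF Qi] ab unfolding Q0
          by (intro has_integral_add has_integral_mult_right) (auto simp: mult.commute)
        then show "((\<lambda>t. e + C / (4 * e) * ((D t)^2 * t^(N-1))) has_integral (e * (b - a))) {a..b}" by simp
      qed
      also have "\<dots> \<le> e * 1" using ab e by (intro mult_left_mono) auto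
      finally show ?thesis using integral_unique[OF I] by simp
    qed
    have "norm (h b / f b - h a / f a) \<le> 0"
    proof (rule field_le_epsilon)
      fix e :: real assume "e > 0"
      then show "norm (h b / f b - h a / f a) \<le> 0 + e" using small[of e] by simp
    qed
    then show ?thesis by simp
  qed
  have hf: "h r = f r" if r: "0 < r" "r < 1" for r
  proof -
    define c where "c = h r / f r"
    have "((\<lambda>t. h t - c * f t) \<longlongrightarrow> 1 - c * 1) (at_left 1)"
      by (intro tendsto_intros BMM_D(7)[OF b] BMM_D(7)[OF bmm])
    moreover have "\<forall>\<^sub>F t in at_left 1. h t - c * f t = 0"
    proof -
      have "h t - c * f t = 0" if "r < t" "t < 1" for t
        using const[of r t] that r f_pos[of t] by (simp add: c_def field_simps)
      then show ?thesis using r by (auto simp: eventually_at_left intro!: exI[of _ r])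
    qed
    ultimately have "((\<lambda>_. 0) \<longlongrightarrow> 1 - c * 1) (at_left (1::real))"
      by (rule Lim_transform_eventually)
    moreover have "((\<lambda>_. 0::real) \<longlongrightarrow> 0) (at_left (1::real))" by (rule tendsto_const)
    ultimately have "1 - c * 1 = 0" by (rule tendsto_unique[OF trivial_limit_at_left_real])
    then have "c = 1" by simp
    then show ?thesis using f_pos[OF r] by (simp add: c_def field_simps)
  qed
  have kg: "k r = g r \<or> k r = - g r" if r: "0 < r" "r < 1" for r
    using BMM_D(6)[OF b r] unit[OF r] hf[OF r] power2_eq_iff[of "k r" "g r"] by auto
  have knz: "k r \<noteq> 0" if "0 < r" "r < 1" for r using kg[OF that] g_pos[OF that] by auto
  have kc: "continuous_on {x..y} k" if "0 < x" "y < 1" for x y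
    using weak_derivative_regularity(1)[OF BMM_D(2,5)[OF b] that] by blast
  have no: False if xy: "0 < x" "x < 1" "0 < y" "y < 1" "k x > 0" "k y < 0" for x y
  proof (cases "x \<le> y")
    case True
    then obtain z where "x \<le> z" "z \<le> y" "k z = 0" using IVT2'[of k y 0 x] kc[of x y] xy by auto
    then show False using knz[of z] xy by auto
  next
    case False
    then obtain z where "y \<le> z" "z \<le> x" "k z = 0" using IVT'[of k y 0 x] kc[of y x] xy by auto
    then show False using knz[of z] xy by auto
  qed
  show ?thesis
  proof (cases "k (1/2) > 0")
    case True
    then have "k r = g r" if "0 < r" "r < 1" for r
      using no[of "1/2" r] kg[OF that] g_pos[OF that] that by auto
    then show ?thesis using hf by auto
  next
    case False
    then have "k (1/2) < 0" using knz[of "1/2"] by auto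
    then have "k r = - g r" if "0 < r" "r < 1" for r
      using no[of r "1/2"] kg[OF that] g_pos[OF that] that by auto
    then show ?thesis using hf by auto
  qed
qed

end

section \<open>The initial value problem\<close>

definition powser :: "(nat \<Rightarrow> real) \<Rightarrow> real \<Rightarrow> real" where
  "powser c x = (\<Sum>n. c n * x^n)"

definition entire_coeffs :: "(nat \<Rightarrow> real) \<Rightarrow> bool" where
  "entire_coeffs c \<longleftrightarrow> (\<forall>x. summable (\<lambda>n. c n * x^n))"

lemma entire_coeffs_diffs: "entire_coeffs c \<Longrightarrow> entire_coeffs (diffs c)"
  unfolding entire_coeffs_def using termdiff_converges_all by blast

lemma powser_deriv: "entire_coeffs c \<Longrightarrow> (powser c has_real_derivative powser (diffs c) x) (at x)"
  unfolding entire_coeffs_def powser_def[abs_def] by (intro termdiffs_strong_converges_everywhere) auto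

lemma powser_cont: "entire_coeffs c \<Longrightarrow> continuous_on S (powser c)"
  using powser_deriv[of c] by (intro DERIV_continuous_on[OF has_field_derivative_at_within])

lemma entire_coeffs_Suc: "entire_coeffs c \<Longrightarrow> entire_coeffs (\<lambda>n. c (Suc n))"
  unfolding entire_coeffs_def by (simp add: summable_powser_split_head)

lemma powser_Suc:
  assumes "entire_coeffs c"
  shows "powser c x = c 0 + x * powser (\<lambda>n. c (Suc n)) x"
proof -
  have s: "summable (\<lambda>n. c n * x^n)" using assms by (auto simp: entire_coeffs_def)
  have "summable (\<lambda>n. c (Suc n) * x^n)" using entire_coeffs_Suc[OF assms] by (auto simp: entire_coeffs_def)
  from suminf_mult[OF this, of x] suminf_split_head[OF s]
  show ?thesis by (simp add: powser_def algebra_simps)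
qed

text \<open>The entire functions \<open>sin x / x\<close> and \<open>(sin x - x) / x\<^sup>3\<close>.\<close>
definition sinc :: "real \<Rightarrow> real" where "sinc = powser (\<lambda>n. sin_coeff (Suc n))"
definition sin3 :: "real \<Rightarrow> real" where "sin3 = powser (\<lambda>n. sin_coeff (Suc (Suc (Suc n))))"

lemma entire_sin: "entire_coeffs sin_coeff"
  unfolding entire_coeffs_def using sin_converges[where 'a=real] by (auto simp: sums_iff)

lemma sin_powser: "sin x = powser sin_coeff x"
  unfolding powser_def using sin_converges[of x] by (simp add: sums_iff)

lemma sin_sinc: "sin x = x * sinc x"
  unfolding sin_powser sinc_def using powser_Suc[OF entire_sin] by simp

lemma sin_sin3: "sin x = x + x^3 * sin3 x"
proof -
  note e1 = entire_coeffs_Suc[OF entire_sin] and e2 = entire_coeffs_Suc[OF entire_coeffs_Suc[OF entire_sin]]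
  have "sinc x = 1 + x * (0 + x * sin3 x)"
    unfolding sinc_def sin3_def powser_Suc[OF e1] powser_Suc[OF e2] by (simp add: sin_coeff_def)
  then show ?thesis unfolding sin_sinc[of x] by (simp add: algebra_simps power3_eq_cube)
qed

lemma sinc_C2:
  obtains s1 s2 where "\<And>x. (sinc has_real_derivative s1 x) (at x)" "\<And>x. (s1 has_real_derivative s2 x) (at x)"
    "continuous_on UNIV s2"
proof -
  note e = entire_coeffs_Suc[OF entire_sin]
  show ?thesis
    by (rule that[unfolded sinc_def, OF powser_deriv[OF e] powser_deriv[OF entire_coeffs_diffs[OF e]]
          powser_cont[OF entire_coeffs_diffs[OF entire_coeffs_diffs[OF e]]]])
qed

lemma sinc_0: "sinc 0 = 1"
  unfolding sinc_def powser_Suc[OF entire_coeffs_Suc[OF entire_sin]] by (simp add: sin_coeff_def)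

text \<open>Together with the sign of \<open>sin3\<close> this shows that the absolute values in the
  force are inactive while the angle is in \<open>[0, pi/2]\<close>.\<close>

lemma sinc_nonneg: "0 \<le> x \<Longrightarrow> x \<le> pi \<Longrightarrow> sinc x \<ge> 0"
  using sin_ge_zero[of x] sinc_0 unfolding sin_sinc by (cases "x = 0") (auto simp: zero_le_mult_iff)

lemma sin3_nonpos: "0 < x \<Longrightarrow> sin3 x \<le> 0"
  using sin_x_le_x[of x] unfolding sin_sin3 by (auto simp: mult_le_0_iff)

lemma C1_lipschitz:
  fixes u u' :: "real \<Rightarrow> real"
  assumes d: "\<And>x. x \<in> {a..b} \<Longrightarrow> (u has_real_derivative u' x) (at x within {a..b})" and c: "continuous_on {a..b} u'"
  obtains C where "C \<ge> 0" "\<And>x. x \<in> {a..b} \<Longrightarrow> \<bar>u x\<bar> \<le> C"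
    "\<And>x y. x \<in> {a..b} \<Longrightarrow> y \<in> {a..b} \<Longrightarrow> \<bar>u x - u y\<bar> \<le> C * \<bar>x - y\<bar>"
proof -
  have "bounded (u' ` {a..b})" "bounded (u ` {a..b})"
    using c DERIV_continuous_on[OF d] by (auto intro!: compact_imp_bounded compact_continuous_image)
  then obtain C1 C2 where C: "\<forall>x\<in>{a..b}. \<bar>u' x\<bar> \<le> C1" "\<forall>x\<in>{a..b}. \<bar>u x\<bar> \<le> C2"
    unfolding bounded_iff by auto
  then have C1: "\<bar>u' x\<bar> \<le> C1" and C2: "\<bar>u x\<bar> \<le> C2" if "x \<in> {a..b}" for x
    using that by auto
  have "norm (u x - u y) \<le> max 0 (max C1 C2) * norm (x - y)" if "x \<in> {a..b}" "y \<in> {a..b}" for x y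
    by (rule field_differentiable_bound[OF _ d]) (use C1 that in \<open>auto simp: le_max_iff_disj\<close>)
  then show ?thesis using that[of "max 0 (max C1 C2)"] C2 by (force simp: le_max_iff_disj)
qed

text \<open>Here \<open>r\<close> is the radius and \<open>c\<close> the unknown value. Requiring
  boundedness along with the Lipschitz condition makes the class closed under products.\<close>

definition lip_bdd :: "real \<Rightarrow> (real \<Rightarrow> real \<Rightarrow> real) \<Rightarrow> bool" where
  "lip_bdd A u \<longleftrightarrow> (\<exists>C\<ge>0. \<forall>r\<in>{0..1}. \<forall>c\<in>{0..A}. \<forall>d\<in>{0..A}. \<bar>u r c\<bar> \<le> C \<and> \<bar>u r c - u r d\<bar> \<le> C * \<bar>c - d\<bar>)"

lemma lip_bdd_add: assumes "lip_bdd A u" "lip_bdd A v" shows "lip_bdd A (\<lambda>r c. u r c + v r c)"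
proof -
  obtain C where C: "C \<ge> 0" "\<And>r c d. r \<in> {0..1} \<Longrightarrow> c \<in> {0..A} \<Longrightarrow> d \<in> {0..A} \<Longrightarrow> \<bar>u r c\<bar> \<le> C \<and> \<bar>u r c - u r d\<bar> \<le> C * \<bar>c - d\<bar>"
    using assms(1) unfolding lip_bdd_def by blast
  obtain D where D: "D \<ge> 0" "\<And>r c d. r \<in> {0..1} \<Longrightarrow> c \<in> {0..A} \<Longrightarrow> d \<in> {0..A} \<Longrightarrow> \<bar>v r c\<bar> \<le> D \<and> \<bar>v r c - v r d\<bar> \<le> D * \<bar>c - d\<bar>"
    using assms(2) unfolding lip_bdd_def by blast
  show ?thesis unfolding lip_bdd_def
  proof (intro exI[of _ "C + D"] conjI ballI)
    fix r c d :: real assume *: "r \<in> {0..1}" "c \<in> {0..A}" "d \<in> {0..A}"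
    from C(2)[OF *] D(2)[OF *] show "\<bar>u r c + v r c\<bar> \<le> C + D" by linarith
    from C(2)[OF *] D(2)[OF *] show "\<bar>u r c + v r c - (u r d + v r d)\<bar> \<le> (C + D) * \<bar>c - d\<bar>"
      unfolding distrib_right by linarith
  qed (use C D in auto)
qed

lemma lip_bdd_mult: assumes "lip_bdd A u" "lip_bdd A v" shows "lip_bdd A (\<lambda>r c. u r c * v r c)"
proof -
  obtain C where C: "C \<ge> 0" "\<And>r c d. r \<in> {0..1} \<Longrightarrow> c \<in> {0..A} \<Longrightarrow> d \<in> {0..A} \<Longrightarrow> \<bar>u r c\<bar> \<le> C \<and> \<bar>u r c - u r d\<bar> \<le> C * \<bar>c - d\<bar>"
    using assms(1) unfolding lip_bdd_def by blast
  obtain D where D: "D \<ge> 0" "\<And>r c d. r \<in> {0..1} \<Longrightarrow> c \<in> {0..A} \<Longrightarrow> d \<in> {0..A} \<Longrightarrow> \<bar>v r c\<bar> \<le> D \<and> \<bar>v r c - v r d\<bar> \<le> D * \<bar>c - d\<bar>"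
    using assms(2) unfolding lip_bdd_def by blast
  show ?thesis unfolding lip_bdd_def
  proof (intro exI[of _ "2 * C * D"] conjI ballI)
    fix r c d :: real assume *: "r \<in> {0..1}" "c \<in> {0..A}" "d \<in> {0..A}"
    note c = C(2)[OF *] and d = D(2)[OF *] and d' = D(2)[OF *(1) *(3) *(3)]
    have "\<bar>u r c * v r c\<bar> \<le> C * D" unfolding abs_mult using c d C(1) by (intro mult_mono) auto
    also have "\<dots> \<le> 2 * C * D" using C(1) D(1) by simp
    finally show "\<bar>u r c * v r c\<bar> \<le> 2 * C * D" .
    have "\<bar>u r c * v r c - u r d * v r d\<bar> = \<bar>u r c * (v r c - v r d) + (u r c - u r d) * v r d\<bar>"
      by (simp add: algebra_simps)
    also have "\<dots> \<le> \<bar>u r c\<bar> * \<bar>v r c - v r d\<bar> + \<bar>u r c - u r d\<bar> * \<bar>v r d\<bar>"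
      by (metis abs_mult abs_triangle_ineq)
    also have "\<dots> \<le> C * (D * \<bar>c - d\<bar>) + (C * \<bar>c - d\<bar>) * D"
      using c d d' C(1) D(1) by (intro add_mono mult_mono) auto
    finally show "\<bar>u r c * v r c - u r d * v r d\<bar> \<le> 2 * C * D * \<bar>c - d\<bar>" by (simp add: algebra_simps)
  qed (use C D in auto)
qed

lemma lip_bdd_abs: assumes "lip_bdd A u" shows "lip_bdd A (\<lambda>r c. \<bar>u r c\<bar>)"
proof -
  obtain C where C: "C \<ge> 0" "\<And>r c d. r \<in> {0..1} \<Longrightarrow> c \<in> {0..A} \<Longrightarrow> d \<in> {0..A} \<Longrightarrow> \<bar>u r c\<bar> \<le> C \<and> \<bar>u r c - u r d\<bar> \<le> C * \<bar>c - d\<bar>"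
    using assms(1) unfolding lip_bdd_def by blast
  show ?thesis unfolding lip_bdd_def
  proof (intro exI[of _ C] conjI ballI)
    fix r c d :: real assume *: "r \<in> {0..1}" "c \<in> {0..A}" "d \<in> {0..A}"
    from C(2)[OF *] show "\<bar>\<bar>u r c\<bar>\<bar> \<le> C" "\<bar>\<bar>u r c\<bar> - \<bar>u r d\<bar>\<bar> \<le> C * \<bar>c - d\<bar>" by linarith+
  qed (use C in auto)
qed

lemma lip_bdd_const: "lip_bdd A (\<lambda>_ _. k)"
  unfolding lip_bdd_def by (intro exI[of _ "\<bar>k\<bar>"]) auto

lemma lip_bdd_id: "lip_bdd A (\<lambda>_ c. c)"
  unfolding lip_bdd_def
  by (intro exI[of _ "1 + \<bar>A\<bar>"]) (auto simp: distrib_right)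

lemma lip_bdd_scaled:
  assumes "C \<ge> 0" and k: "k \<ge> 0"
    and b: "\<And>x. x \<in> {0..k*A} \<Longrightarrow> \<bar>u x\<bar> \<le> C"
    and l: "\<And>x y. x \<in> {0..k*A} \<Longrightarrow> y \<in> {0..k*A} \<Longrightarrow> \<bar>u x - u y\<bar> \<le> C * \<bar>x - y\<bar>"
  shows "lip_bdd A (\<lambda>r c. u (k * (r * c)))"
  unfolding lip_bdd_def
proof (intro exI[of _ "C * (1 + k)"] conjI ballI)
  fix r c d :: real assume *: "r \<in> {0..1}" "c \<in> {0..A}" "d \<in> {0..A}"
  have m: "k * (r * c) \<in> {0..k*A}" "k * (r * d) \<in> {0..k*A}"
    using * k mult_mono[of r 1 c A] mult_mono[of r 1 d A] by (auto intro!: mult_left_mono)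
  show "\<bar>u (k * (r * c))\<bar> \<le> C * (1 + k)"
    using b[OF m(1)] assms(1) k by (simp add: algebra_simps add_increasing2)
  have "\<bar>u (k * (r * c)) - u (k * (r * d))\<bar> \<le> C * \<bar>k * (r * c) - k * (r * d)\<bar>" by (rule l[OF m])
  also have "\<bar>k * (r * c) - k * (r * d)\<bar> = (k * r) * \<bar>c - d\<bar>"
    using * k by (simp add: abs_mult right_diff_distrib[symmetric] mult.assoc)
  also have "C * ((k * r) * \<bar>c - d\<bar>) \<le> C * ((1 + k) * \<bar>c - d\<bar>)"
    using * k assms(1) mult_left_mono[of r 1 k] by (intro mult_left_mono mult_right_mono) auto
  finally show "\<bar>u (k * (r * c)) - u (k * (r * d))\<bar> \<le> C * (1 + k) * \<bar>c - d\<bar>" by (simp add: mult.assoc)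
qed (use assms in auto)

lemma lip_bdd_powser:
  assumes "entire_coeffs p" "k \<ge> 0" shows "lip_bdd A (\<lambda>r c. powser p (k * (r * c)))"
proof -
  obtain C where "C \<ge> 0" "\<And>x. x \<in> {0..k*A} \<Longrightarrow> \<bar>powser p x\<bar> \<le> C"
    "\<And>x y. x \<in> {0..k*A} \<Longrightarrow> y \<in> {0..k*A} \<Longrightarrow> \<bar>powser p x - powser p y\<bar> \<le> C * \<bar>x - y\<bar>"
    using C1_lipschitz[of 0 "k*A" "powser p" "powser (diffs p)"] powser_deriv[OF assms(1)]
      powser_cont[OF entire_coeffs_diffs[OF assms(1)]] by (metis has_field_derivative_at_within)
  then show ?thesis using assms(2) by (intro lip_bdd_scaled) auto
qed

text \<open>For \<open>s > 0\<close> this is \<open>s^-(N+2)\<close> times the integral of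
  \<open>t^(N+1) h t\<close> over \<open>[0, s]\<close>; thus \<open>s * radial_mean N h s\<close>
  is the derivative of the regular solution of \<open>u'' + (N+1)/r u' = h\<close>. Rescaling to
  \<open>[0,1]\<close> makes it continuous at \<open>s = 0\<close>.\<close>

definition radial_mean :: "nat \<Rightarrow> (real \<Rightarrow> real) \<Rightarrow> real \<Rightarrow> real" where
  "radial_mean N h s = integral {0..1} (\<lambda>\<tau>. \<tau>^(N+1) * h (s * \<tau>))"

context
  fixes N :: nat and h :: "real \<Rightarrow> real"
  assumes ch: "continuous_on {0..1} h"
begin

lemma radial_mean_cont: "continuous_on {0..1} (radial_mean N h)"
proof -
  have "continuous_on ({0..1} \<times> cbox 0 1) (\<lambda>x::real \<times> real. snd x ^ (N+1) * h (fst x * snd x))"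
    by (intro continuous_intros continuous_on_compose2[OF ch]) (auto intro: mult_le_one)
  then have "continuous_on {0..1} (\<lambda>s. integral (cbox 0 1) (\<lambda>\<tau>::real. \<tau>^(N+1) * h (s * \<tau>)))"
    by (intro integral_continuous_on_param) (simp add: split_beta)
  then show ?thesis by (simp add: radial_mean_def[abs_def])
qed

lemma radial_mean_integrable:
  assumes "0 \<le> s" "s \<le> 1" shows "(\<lambda>\<tau>. \<tau>^(N+1) * h (s * \<tau>)) integrable_on {0..1}"
  using assms by (intro integrable_continuous_real continuous_intros continuous_on_compose2[OF ch]) (auto intro: mult_le_one)

lemma radial_mean_power: "((\<lambda>\<tau>::real. \<tau>^(N+1)) has_integral 1 / (real N + 2)) {0..1}"
proof -
  have "((\<lambda>\<tau>. \<tau>^(N+1)) has_integral (1^(N+2) / (real N + 2) - 0^(N+2) / (real N + 2))) {0..1}"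
  proof (rule fundamental_theorem_of_calculus)
    fix x :: real
    have "((\<lambda>\<tau>. \<tau>^(N+2) / (real N + 2)) has_real_derivative real (N+2) * x^(N+2-1) / (real N + 2)) (at x within {0..1})"
      using DERIV_pow[of "N+2" x "{0..1}"] by (intro DERIV_cdivide) simp
    then show "((\<lambda>\<tau>. \<tau>^(N+2) / (real N + 2)) has_vector_derivative x^(N+1)) (at x within {0..1})"
      by (simp add: has_real_derivative_iff_has_vector_derivative add.commute)
  qed simp
  then show ?thesis by simp
qed

lemma radial_mean_0: "radial_mean N h 0 = h 0 / (real N + 2)"
  unfolding radial_mean_def
  using has_integral_mult_left[OF radial_mean_power, of "h 0"] by (intro integral_unique) simp

lemma radial_mean_ge:
  assumes "0 \<le> s" "s \<le> 1" "\<And>t. 0 \<le> t \<Longrightarrow> t \<le> s \<Longrightarrow> h t \<ge> - C" "C \<ge> 0"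
  shows "radial_mean N h s \<ge> - C"
proof -
  have "(1 / (real N + 2)) * (- C) \<le> radial_mean N h s"
    unfolding radial_mean_def
  proof (rule has_integral_le[OF has_integral_mult_left[OF radial_mean_power, of "- C"] integrable_integral[OF radial_mean_integrable[OF assms(1,2)]]])
    fix \<tau> :: real assume "\<tau> \<in> {0..1}"
    then show "\<tau>^(N+1) * (- C) \<le> \<tau>^(N+1) * h (s * \<tau>)"
      using assms mult_left_mono[of \<tau> 1 s] by (intro mult_left_mono assms(3)) auto
  qed
  moreover have "(1 / (real N + 2)) * C \<le> 1 * C" using assms(4) by (intro mult_right_mono) auto
  ultimately show ?thesis by simp
qed

lemma radial_mean_le:
  assumes "0 \<le> s" "s \<le> 1" "\<And>t. 0 \<le> t \<Longrightarrow> t \<le> s \<Longrightarrow> h t \<le> C" "C \<ge> 0"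
  shows "radial_mean N h s \<le> C"
proof -
  have "radial_mean N h s \<le> (1 / (real N + 2)) * C"
    unfolding radial_mean_def
  proof (rule has_integral_le[OF integrable_integral[OF radial_mean_integrable[OF assms(1,2)]] has_integral_mult_left[OF radial_mean_power, of C]])
    fix \<tau> :: real assume "\<tau> \<in> {0..1}"
    then show "\<tau>^(N+1) * h (s * \<tau>) \<le> \<tau>^(N+1) * C"
      using assms mult_left_mono[of \<tau> 1 s] by (intro mult_left_mono assms(3)) auto
  qed
  moreover have "(1 / (real N + 2)) * C \<le> 1 * C" using assms(4) by (intro mult_right_mono) auto
  ultimately show ?thesis by simp
qed

lemma radial_mean_deriv:
  assumes s: "0 < s" "s \<le> 1"
  shows "(radial_mean N h has_real_derivative (h s - (real N + 2) * radial_mean N h s) / s) (at s within {0..1})"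
proof -
  define P where "P = (\<lambda>s. integral {0..s} (\<lambda>t. t^(N+1) * h t))"
  have cP: "continuous_on {0..1} (\<lambda>t. t^(N+1) * h t)" by (intro continuous_intros ch)
  have M: "radial_mean N h x = P x / x^(N+2)" if x: "0 < x" "x \<le> 1" for x
  proof -
    have "(\<lambda>t. t^(N+1) * h t) integrable_on {0..x}"
      using cP x by (intro integrable_continuous_real) (auto elim: continuous_on_subset)
    then have "((\<lambda>t. t^(N+1) * h t) has_integral P x) {0..x}" unfolding P_def by (rule integrable_integral)
    from has_integral_stretch_real[OF this, of x] x
    have "((\<lambda>\<tau>. (x * \<tau>)^(N+1) * h (x * \<tau>)) has_integral (1 / x) * P x) ((\<lambda>t. t / x) ` {0..x})" by simp
    moreover have "(\<lambda>t. t / x) ` {0..x} = {0..1}"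
      using x by (auto simp: image_iff intro!: bexI[of _ "x * _"])
    ultimately have "((\<lambda>\<tau>. (1 / x^(N+1)) * ((x * \<tau>)^(N+1) * h (x * \<tau>))) has_integral (1 / x^(N+1)) * ((1 / x) * P x)) {0..1}"
      by (metis has_integral_mult_right)
    moreover have "(1 / x^(N+1)) * ((x * \<tau>)^(N+1) * h (x * \<tau>)) = \<tau>^(N+1) * h (x * \<tau>)" for \<tau>
      using x by (simp add: power_mult_distrib)
    ultimately have "((\<lambda>\<tau>. \<tau>^(N+1) * h (x * \<tau>)) has_integral (1 / x^(N+1)) * ((1 / x) * P x)) {0..1}"
      by (simp only:)
    then show ?thesis unfolding radial_mean_def by (subst integral_unique, assumption) (simp add: mult.commute)
  qed
  have dP: "(P has_real_derivative s^(N+1) * h s) (at s within {0..1})"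
    unfolding P_def using s by (intro integral_has_real_derivative cP) auto
  have "((\<lambda>x. P x / x^(N+2)) has_real_derivative
       (s^(N+1) * h s * s^(N+2) - P s * (real (N+2) * s^(N+1))) / (s^(N+2) * s^(N+2))) (at s within {0..1})"
  proof (rule DERIV_divide[OF dP])
    show "((\<lambda>x. x^(N+2)) has_real_derivative real (N+2) * s^(N+1)) (at s within {0..1})"
      using DERIV_pow[of "N+2" s "{0..1}"] by simp
  qed (use s in simp)
  moreover have "(s^(N+1) * h s * s^(N+2) - P s * (real (N+2) * s^(N+1))) / (s^(N+2) * s^(N+2))
     = (h s - (real N + 2) * radial_mean N h s) / s"
  proof -
    have "P s = radial_mean N h s * s^(N+2)" using M[OF s] s by simp
    then have "s^(N+1) * h s * s^(N+2) - P s * (real (N+2) * s^(N+1)) = (s^(N+1) * s^(N+2)) * (h s - (real N + 2) * radial_mean N h s)"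
      by (simp add: algebra_simps)
    moreover have "s^(N+2) * s^(N+2) = (s^(N+1) * s^(N+2)) * s" by simp
    moreover have "s^(N+1) * s^(N+2) \<noteq> 0" using s by simp
    ultimately show ?thesis by (metis mult_divide_mult_cancel_left)
  qed
  ultimately have "((\<lambda>x. P x / x^(N+2)) has_real_derivative (h s - (real N + 2) * radial_mean N h s) / s) (at s within {0..1})"
    by simp
  then show ?thesis
    by (rule has_field_derivative_transform_within[where d=s]) (use s M in \<open>auto simp: dist_real_def\<close>)
qed

lemma radial_potential_deriv:
  assumes "r \<in> {0..1}"
  shows "((\<lambda>r. integral {0..r} (\<lambda>s. s * radial_mean N h s)) has_real_derivative r * radial_mean N h r) (at r within {0..1})"
  using assms by (intro integral_has_real_derivative continuous_intros radial_mean_cont)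

end

definition trunc :: "real \<Rightarrow> real \<Rightarrow> real" where "trunc A c = max 0 (min A c)"

lemma trunc_range: "A \<ge> 0 \<Longrightarrow> trunc A c \<in> {0..A}"
  by (auto simp: trunc_def)

lemma trunc_lip: "\<bar>trunc A c - trunc A d\<bar> \<le> \<bar>c - d\<bar>"
  by (auto simp: trunc_def max_def min_def)

lemma trunc_id: "0 \<le> c \<Longrightarrow> c \<le> A \<Longrightarrow> trunc A c = c"
  by (auto simp: trunc_def)

lemma trunc_cont: "continuous_on S f \<Longrightarrow> continuous_on S (\<lambda>x. trunc A (f x))"
  unfolding trunc_def by (intro continuous_on_max continuous_on_min continuous_intros)

text \<open>Writing \<open>\<theta> = r \<phi>\<close>, the angle equation becomes \<open>\<phi>'' + (N+1)/r \<phi>' = force\<close>. The truncation and the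
  absolute values are inactive as long as \<open>0 \<le> \<phi> \<le> A\<close> and \<open>\<theta> \<le> \<pi>/2\<close>; they make the right-hand
  side globally Lipschitz and nonpositive.\<close>
locale shooting = potential W W1 W2 for W W1 W2 :: "real \<Rightarrow> real" +
  fixes N :: nat and \<eta> :: real
  assumes N2: "N \<ge> 2" and eta: "\<eta> > 0"
begin

definition wx :: "real \<Rightarrow> real" where "wx x = W1 ((cos x)^2) / \<eta>^2"

text \<open>With \<open>\<theta> = r \<phi>\<close>,
  \<open>sin (2 x) = 2 x + 8 x^3 sin3 (2 x)\<close> and \<open>sin (2 x) = 2 x sinc (2 x)\<close>,
  all negative powers of \<open>r\<close> cancel, so the singular problem at the origin becomes an
  ordinary fixed-point problem.\<close>

definition force :: "real \<Rightarrow> real \<Rightarrow> real \<Rightarrow> real" where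
  "force A r c = - (4 * (real N - 1) * (trunc A c)^3 * \<bar>sin3 (2 * (r * trunc A c))\<bar>
     + trunc A c * \<bar>sinc (2 * (r * trunc A c))\<bar> * wx (r * trunc A c))"

lemma wx_nonneg: "wx x \<ge> 0"
  using W1_nonneg[of "(cos x)^2"] by (simp add: wx_def)

lemma wx_le: "wx x \<le> W1 1 / \<eta>^2"
  unfolding wx_def by (intro divide_right_mono W1_mono) (auto simp: abs_square_le_1)

lemma wx_cont: "continuous_on S wx"
  unfolding wx_def[abs_def] using eta by (intro continuous_intros continuous_on_compose2[OF W1_cont]) auto

lemma wx_lip: "lip_bdd A (\<lambda>r c. wx (1 * (r * c)))"
proof -
  obtain C where C: "C \<ge> 0" "\<And>x. x \<in> {0..1} \<Longrightarrow> \<bar>W1 x\<bar> \<le> C"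
    "\<And>x y. x \<in> {0..1} \<Longrightarrow> y \<in> {0..1} \<Longrightarrow> \<bar>W1 x - W1 y\<bar> \<le> C * \<bar>x - y\<bar>"
  proof (rule C1_lipschitz[of 0 1 W1 W2])
    show "(W1 has_real_derivative W2 x) (at x within {0..1})" if "x \<in> {0..1}" for x
      by (rule DERIV_subset[OF W_d2]) (use that in auto)
    show "continuous_on {0..1} W2" by (rule continuous_on_subset[OF W_C2]) auto
  qed blast
  have cs: "\<bar>(cos x)^2 - (cos y)^2\<bar> \<le> 2 * \<bar>x - y\<bar>" for x y :: real
  proof -
    have "norm ((cos x)^2 - (cos y)^2) \<le> 2 * norm (x - y)"
    proof (rule field_differentiable_bound[where S=UNIV and f="\<lambda>x. (cos x)^2" and f'="\<lambda>x. 2 * cos x * (- sin x)"])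
      fix z :: real
      show "((\<lambda>x. (cos x)^2) has_real_derivative 2 * cos z * (- sin z)) (at z)"
        by (auto intro!: derivative_eq_intros)
      have "\<bar>cos z\<bar> * \<bar>sin z\<bar> \<le> 1 * 1" by (intro mult_mono) auto
      then show "norm (2 * cos z * (- sin z)) \<le> 2" by (simp add: abs_mult)
    qed auto
    then show ?thesis by simp
  qed
  have c01: "(cos x)^2 \<in> {0..1}" for x :: real by (auto simp: abs_square_le_1)
  show ?thesis
  proof (rule lip_bdd_scaled[where C="2 * C / \<eta>^2"])
    show "\<bar>wx x\<bar> \<le> 2 * C / \<eta>^2" for x
      using C(2)[OF c01[of x]] C(1) unfolding wx_def by (simp add: divide_right_mono)
    fix x y
    have "\<bar>W1 ((cos x)^2) - W1 ((cos y)^2)\<bar> \<le> C * (2 * \<bar>x - y\<bar>)"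
      using C(3)[OF c01[of x] c01[of y]] mult_left_mono[OF cs[of x y] C(1)] by simp
    then have "\<bar>W1 ((cos x)^2) - W1 ((cos y)^2)\<bar> / \<eta>^2 \<le> C * (2 * \<bar>x - y\<bar>) / \<eta>^2" by (rule divide_right_mono) simp
    then show "\<bar>wx x - wx y\<bar> \<le> 2 * C / \<eta>^2 * \<bar>x - y\<bar>"
      unfolding wx_def by (simp add: diff_divide_distrib[symmetric] mult.assoc mult.left_commute)
  qed (use C in auto)
qed

lemma force_lip:
  assumes "A \<ge> 0"
  obtains L where "L \<ge> 0" "\<And>r c d. r \<in> {0..1} \<Longrightarrow> \<bar>force A r c - force A r d\<bar> \<le> L * \<bar>c - d\<bar>"
proof -
  have "lip_bdd A (\<lambda>r c. 4 * (real N - 1) * (c * (c * c)) * \<bar>sin3 (2 * (r * c))\<bar> + c * \<bar>sinc (2 * (r * c))\<bar> * wx (1 * (r * c)))"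
    unfolding sin3_def sinc_def
    by (intro lip_bdd_add lip_bdd_mult lip_bdd_abs lip_bdd_const lip_bdd_id wx_lip lip_bdd_powser
        entire_coeffs_Suc entire_sin) auto
  then obtain C where C: "C \<ge> 0" "\<And>r c d. r \<in> {0..1} \<Longrightarrow> c \<in> {0..A} \<Longrightarrow> d \<in> {0..A} \<Longrightarrow>
      \<bar>(4 * (real N - 1) * (c * (c * c)) * \<bar>sin3 (2 * (r * c))\<bar> + c * \<bar>sinc (2 * (r * c))\<bar> * wx (1 * (r * c)))
       - (4 * (real N - 1) * (d * (d * d)) * \<bar>sin3 (2 * (r * d))\<bar> + d * \<bar>sinc (2 * (r * d))\<bar> * wx (1 * (r * d)))\<bar> \<le> C * \<bar>c - d\<bar>"
    unfolding lip_bdd_def by blast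
  show ?thesis
  proof (rule that[OF C(1)])
    fix r c d :: real assume r: "r \<in> {0..1}"
    define G where "G = (\<lambda>c. 4 * (real N - 1) * (c * (c * c)) * \<bar>sin3 (2 * (r * c))\<bar> + c * \<bar>sinc (2 * (r * c))\<bar> * wx (1 * (r * c)))"
    have f: "force A r c = - G (trunc A c)" for c
      unfolding force_def G_def by (simp add: power3_eq_cube mult.assoc)
    have "\<bar>G (trunc A c) - G (trunc A d)\<bar> \<le> C * \<bar>trunc A c - trunc A d\<bar>"
      unfolding G_def by (rule C(2)[OF r trunc_range[OF assms] trunc_range[OF assms]])
    then have "\<bar>force A r c - force A r d\<bar> \<le> C * \<bar>trunc A c - trunc A d\<bar>"
      unfolding f by linarith
    also have "\<dots> \<le> C * \<bar>c - d\<bar>" by (intro mult_left_mono trunc_lip C)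
    finally show "\<bar>force A r c - force A r d\<bar> \<le> C * \<bar>c - d\<bar>" .
  qed
qed

lemma force_nonpos: "A \<ge> 0 \<Longrightarrow> force A r c \<le> 0"
  unfolding force_def neg_le_0_iff_le using N2 trunc_range[of A c] wx_nonneg
  by (intro add_nonneg_nonneg mult_nonneg_nonneg) auto

lemma force_cont:
  assumes "continuous_on S \<phi>" shows "continuous_on S (\<lambda>t. force A t (\<phi> t))"
  unfolding force_def sin3_def sinc_def
  by (intro continuous_intros trunc_cont assms continuous_on_compose2[OF powser_cont[OF entire_coeffs_Suc[OF entire_sin]]]
     continuous_on_compose2[OF powser_cont[OF entire_coeffs_Suc[OF entire_coeffs_Suc[OF entire_coeffs_Suc[OF entire_sin]]]]]
     continuous_on_compose2[OF wx_cont]) auto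

text \<open>The inverse of the radial Laplacian in dimension \<open>N + 2\<close> with zero data at
  the origin. It turns the initial value problem into an integral equation.\<close>

definition potl :: "(real \<Rightarrow> real) \<Rightarrow> real \<Rightarrow> real" where
  "potl h r = integral {0..r} (\<lambda>s. s * radial_mean N h s)"

text \<open>Integrating the weight \<open>exp (\<kappa> s)\<close> gains the factor
  \<open>1 / \<kappa>\<close>, so a large \<open>\<kappa>\<close> yields a contraction on all of
  \<open>[0,1]\<close> at once.\<close>

lemma potl_weighted:
  assumes h1: "continuous_on {0..1} h1" and h2: "continuous_on {0..1} h2" and \<kappa>: "\<kappa> > 0" and "D \<ge> 0"
    and b: "\<And>t. t \<in> {0..1} \<Longrightarrow> \<bar>h1 t - h2 t\<bar> \<le> D * exp (\<kappa> * t)" and r: "r \<in> {0..1}"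
  shows "\<bar>potl h1 r - potl h2 r\<bar> \<le> D / \<kappa> * exp (\<kappa> * r)"
proof -
  have ci: "(\<lambda>s. s * radial_mean N h s) integrable_on {0..r}" if "continuous_on {0..1} h" for h
    using r by (intro integrable_continuous_real continuous_intros continuous_on_subset[OF radial_mean_cont[OF that]]) auto
  have E: "((\<lambda>s. D * exp (\<kappa> * s)) has_integral D / \<kappa> * exp (\<kappa> * r) - D / \<kappa> * exp (\<kappa> * 0)) {0..r}"
    using r \<kappa> by (intro fundamental_theorem_of_calculus)
      (auto intro!: derivative_eq_intros simp: has_real_derivative_iff_has_vector_derivative[symmetric])
  have "potl h1 r - potl h2 r = integral {0..r} (\<lambda>s. s * radial_mean N h1 s - s * radial_mean N h2 s)"
    unfolding potl_def by (subst Henstock_Kurzweil_Integration.integral_diff) (auto intro: ci h1 h2)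
  also have "norm \<dots> \<le> integral {0..r} (\<lambda>s. D * exp (\<kappa> * s))"
  proof (rule integral_norm_bound_integral)
    show "(\<lambda>s. s * radial_mean N h1 s - s * radial_mean N h2 s) integrable_on {0..r}"
      by (intro integrable_diff ci h1 h2)
    fix s assume s: "s \<in> {0..r}"
    then have s1: "0 \<le> s" "s \<le> 1" using r by auto
    have ch: "continuous_on {0..1} (\<lambda>t. h1 t - h2 t)" by (intro continuous_intros h1 h2)
    have "radial_mean N (\<lambda>t. h1 t - h2 t) s = radial_mean N h1 s - radial_mean N h2 s"
      unfolding radial_mean_def right_diff_distrib
      by (intro Henstock_Kurzweil_Integration.integral_diff radial_mean_integrable h1 h2 s1)
    moreover have bd: "\<bar>h1 t - h2 t\<bar> \<le> D * exp (\<kappa> * s)" if "0 \<le> t" "t \<le> s" for t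
    proof -
      have "D * exp (\<kappa> * t) \<le> D * exp (\<kappa> * s)" using that \<kappa> \<open>D \<ge> 0\<close> by (intro mult_left_mono) auto
      then show ?thesis using b[of t] that s1 by auto
    qed
    have "radial_mean N (\<lambda>t. h1 t - h2 t) s \<le> D * exp (\<kappa> * s)" "radial_mean N (\<lambda>t. h1 t - h2 t) s \<ge> - (D * exp (\<kappa> * s))"
      using bd \<open>D \<ge> 0\<close> s1
      by (intro radial_mean_le[OF ch] radial_mean_ge[OF ch]; force simp: abs_le_iff)+
    ultimately have "\<bar>radial_mean N h1 s - radial_mean N h2 s\<bar> \<le> D * exp (\<kappa> * s)" by simp
    then have "s * \<bar>radial_mean N h1 s - radial_mean N h2 s\<bar> \<le> 1 * (D * exp (\<kappa> * s))"
      using s1 by (intro mult_mono) auto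
    then show "norm (s * radial_mean N h1 s - s * radial_mean N h2 s) \<le> D * exp (\<kappa> * s)"
      using s1 by (simp add: right_diff_distrib[symmetric] abs_mult)
  qed (use E in blast)
  also have "\<dots> = D / \<kappa> * exp (\<kappa> * r) - D / \<kappa> * exp (\<kappa> * 0)" by (rule integral_unique[OF E])
  also have "\<dots> \<le> D / \<kappa> * exp (\<kappa> * r)" using \<kappa> \<open>D \<ge> 0\<close> by simp
  finally show ?thesis by simp
qed

text \<open>Banach's theorem is applied to \<open>exp (- \<kappa> r) \<phi>\<close>. The amplitude
  enters the map additively, so the contraction estimate also gives Lipschitz dependence on
  \<open>a\<close>, needed for the intermediate value argument.\<close>

lemma ex_trajectories:
  assumes A: "A \<ge> 0"
  obtains \<Phi> C where "\<And>a. continuous_on {0..1} (\<Phi> a)"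
    "\<And>a r. r \<in> {0..1} \<Longrightarrow> \<Phi> a r = a + potl (\<lambda>t. force A t (\<Phi> a t)) r"
    "\<And>a b r. r \<in> {0..1} \<Longrightarrow> \<bar>\<Phi> a r - \<Phi> b r\<bar> \<le> C * \<bar>a - b\<bar>"
proof -
  obtain L where L: "L \<ge> 0" "\<And>r c d. r \<in> {0..1} \<Longrightarrow> \<bar>force A r c - force A r d\<bar> \<le> L * \<bar>c - d\<bar>"
    using force_lip[OF A] by blast
  \<comment> \<open>Makes \<open>L / \<kappa> \<le> 1/2\<close>; the extra 1 keeps
    \<open>\<kappa>\<close> positive when \<open>L = 0\<close>.\<close>
  define \<kappa> where "\<kappa> = 2 * (L + 1)"
  have \<kappa>: "\<kappa> > 0" "L / \<kappa> \<le> 1/2" using L(1) by (auto simp: \<kappa>_def)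
  define H where "H = (\<lambda>(u :: real \<Rightarrow>\<^sub>C real) t. force A t (exp (\<kappa> * t) * u t))"
  \<comment> \<open>Clamping the radius to \<open>[0,1]\<close> yields bounded continuous functions
    on the whole line, a complete space.\<close>
  define F where "F = (\<lambda>a (u :: real \<Rightarrow>\<^sub>C real) r. exp (- \<kappa> * trunc 1 r) * (a + potl (H u) (trunc 1 r)))"
  have cH: "continuous_on {0..1} (H u)" for u
    unfolding H_def by (intro force_cont continuous_intros) auto
  have t01: "trunc 1 r \<in> {0..1}" for r by (rule trunc_range) simp
  have cp: "continuous_on {0..1} (potl (H u))" for u
    unfolding potl_def[abs_def] by (rule DERIV_continuous_on[OF radial_potential_deriv[OF cH]])
  have bc: "F a u \<in> bcontfun" for a u
  proof -
    have "continuous_on UNIV (F a u)"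
      unfolding F_def using t01 by (intro continuous_intros trunc_cont continuous_on_compose2[OF cp]) auto
    moreover have "bounded (range (F a u))"
    proof -
      have "range (F a u) \<subseteq> (\<lambda>x. exp (- \<kappa> * x) * (a + potl (H u) x)) ` {0..1}"
        using t01 by (auto simp: F_def)
      moreover have "bounded ((\<lambda>x. exp (- \<kappa> * x) * (a + potl (H u) x)) ` {0..1})"
        by (intro compact_imp_bounded compact_continuous_image continuous_intros cp) auto
      ultimately show ?thesis by (rule bounded_subset[rotated])
    qed
    ultimately show ?thesis by (simp add: bcontfun_def)
  qed
  define T where "T = (\<lambda>a u. Bcontfun (F a u))"
  have T: "apply_bcontfun (T a u) = F a u" for a u
    unfolding T_def using bc by (rule Bcontfun_inverse)
  have dT: "dist (T a u) (T b v) \<le> \<bar>a - b\<bar> + 1/2 * dist u v" for a b u v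
  proof (rule dist_bound)
    fix r
    define s where "s = trunc 1 r"
    have s: "s \<in> {0..1}" using t01 by (simp add: s_def)
    have Hb: "\<bar>H u t - H v t\<bar> \<le> (L * dist u v) * exp (\<kappa> * t)" if "t \<in> {0..1}" for t
    proof -
      have "\<bar>H u t - H v t\<bar> \<le> L * \<bar>exp (\<kappa> * t) * u t - exp (\<kappa> * t) * v t\<bar>"
        unfolding H_def by (rule L(2)[OF that])
      also have "\<dots> = L * (exp (\<kappa> * t) * dist (u t) (v t))"
        by (simp add: right_diff_distrib[symmetric] abs_mult dist_real_def)
      also have "\<dots> \<le> L * (exp (\<kappa> * t) * dist u v)"
        using L(1) dist_bounded[of u t v] by (intro mult_left_mono) auto
      finally show ?thesis by (simp add: algebra_simps)
    qed
    have "\<bar>potl (H u) s - potl (H v) s\<bar> \<le> (L * dist u v) / \<kappa> * exp (\<kappa> * s)"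
      using L(1) Hb s by (intro potl_weighted cH \<kappa>(1)) auto
    also have "(L * dist u v) / \<kappa> = (L / \<kappa>) * dist u v" by simp
    also have "\<dots> * exp (\<kappa> * s) \<le> (1/2 * dist u v) * exp (\<kappa> * s)"
      using \<kappa>(2) by (intro mult_right_mono) auto
    finally have P: "\<bar>potl (H u) s - potl (H v) s\<bar> \<le> (1/2 * dist u v) * exp (\<kappa> * s)" .
    have e1: "exp (- \<kappa> * s) * exp (\<kappa> * s) = 1" by (simp add: exp_add[symmetric])
    have "F a u r - F b v r = exp (- \<kappa> * s) * ((a - b) + (potl (H u) s - potl (H v) s))"
      by (simp add: F_def s_def algebra_simps)
    then have "dist (T a u r) (T b v r) = exp (- \<kappa> * s) * \<bar>(a - b) + (potl (H u) s - potl (H v) s)\<bar>"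
      by (simp add: T dist_real_def abs_mult)
    also have "\<dots> \<le> exp (- \<kappa> * s) * (\<bar>a - b\<bar> + (1/2 * dist u v) * exp (\<kappa> * s))"
    proof (rule mult_left_mono)
      show "\<bar>(a - b) + (potl (H u) s - potl (H v) s)\<bar> \<le> \<bar>a - b\<bar> + (1/2 * dist u v) * exp (\<kappa> * s)"
        using P by linarith
    qed simp
    also have "\<dots> = exp (- \<kappa> * s) * \<bar>a - b\<bar> + 1/2 * dist u v * (exp (- \<kappa> * s) * exp (\<kappa> * s))"
      by (simp add: algebra_simps)
    also have "\<dots> \<le> 1 * \<bar>a - b\<bar> + 1/2 * dist u v * 1"
      unfolding e1 using s \<kappa>(1) by (intro add_mono mult_right_mono) auto
    finally show "dist (T a u r) (T b v r) \<le> \<bar>a - b\<bar> + 1/2 * dist u v" by simp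
  qed
  have "\<exists>!u. T a u = u" for a
    by (rule banach_fix_type[where c="1/2"]) (use dT[of a _ a] in auto)
  then obtain U where U: "\<And>a. T a (U a) = U a" by metis
  define \<Phi> where "\<Phi> = (\<lambda>a r. exp (\<kappa> * r) * U a r)"
  show ?thesis
  proof (rule that[of \<Phi> "exp \<kappa> * 2"])
    show "continuous_on {0..1} (\<Phi> a)" for a unfolding \<Phi>_def by (intro continuous_intros) auto
    show "\<Phi> a r = a + potl (\<lambda>t. force A t (\<Phi> a t)) r" if r: "r \<in> {0..1}" for a r
    proof -
      have "trunc 1 r = r" using r by (intro trunc_id) auto
      then have "U a r = exp (- \<kappa> * r) * (a + potl (H (U a)) r)"
        using T[of a "U a"] unfolding U F_def by simp
      then have "\<Phi> a r = (exp (\<kappa> * r) * exp (- \<kappa> * r)) * (a + potl (H (U a)) r)"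
        by (simp add: \<Phi>_def)
      also have "exp (\<kappa> * r) * exp (- \<kappa> * r) = 1" by (simp add: exp_add[symmetric])
      finally show ?thesis by (simp add: H_def \<Phi>_def)
    qed
    show "\<bar>\<Phi> a r - \<Phi> b r\<bar> \<le> exp \<kappa> * 2 * \<bar>a - b\<bar>" if r: "r \<in> {0..1}" for a b r
    proof -
      have "dist (U a) (U b) \<le> \<bar>a - b\<bar> + 1/2 * dist (U a) (U b)"
        using dT[of a "U a" b "U b"] unfolding U .
      then have "dist (U a) (U b) \<le> 2 * \<bar>a - b\<bar>" by simp
      then have "\<bar>U a r - U b r\<bar> \<le> 2 * \<bar>a - b\<bar>"
        using dist_bounded[of "U a" r "U b"] by (simp add: dist_real_def)
      moreover have "exp (\<kappa> * r) \<le> exp \<kappa>" using r \<kappa>(1) by simp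
      ultimately have "exp (\<kappa> * r) * \<bar>U a r - U b r\<bar> \<le> exp \<kappa> * (2 * \<bar>a - b\<bar>)"
        by (intro mult_mono) auto
      then show ?thesis unfolding \<Phi>_def by (simp add: right_diff_distrib[symmetric] abs_mult mult.assoc)
    qed
  qed
qed

end

section \<open>Trajectories and their return to the angle equation\<close>

locale trajectory = shooting W W1 W2 N \<eta> for W W1 W2 :: "real \<Rightarrow> real" and N :: nat and \<eta> :: real +
  fixes A a :: real and \<phi> :: "real \<Rightarrow> real"
  assumes A: "A \<ge> 0" and c\<phi>: "continuous_on {0..1} \<phi>"
    and \<phi>_eq: "\<And>r. r \<in> {0..1} \<Longrightarrow> \<phi> r = a + potl (\<lambda>t. force A t (\<phi> t)) r"
begin

definition h :: "real \<Rightarrow> real" where "h t = force A t (\<phi> t)"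
definition q :: "real \<Rightarrow> real" where "q = radial_mean N h"
definition \<theta> :: "real \<Rightarrow> real" where "\<theta> r = r * \<phi> r"
text \<open>The derivative of \<open>\<theta> = r \<phi>\<close>, because
  \<open>\<phi>' = r q\<close>.\<close>

definition p :: "real \<Rightarrow> real" where "p r = \<phi> r + r^2 * q r"

lemma ch: "continuous_on {0..1} h"
  unfolding h_def[abs_def] by (intro force_cont c\<phi>)

lemma cq: "continuous_on {0..1} q"
  unfolding q_def by (rule radial_mean_cont[OF ch])

lemma h_nonpos: "h t \<le> 0"
  unfolding h_def by (rule force_nonpos[OF A])

lemma q_nonpos: "r \<in> {0..1} \<Longrightarrow> q r \<le> 0"
  unfolding q_def using h_nonpos by (intro radial_mean_le[OF ch]) auto

lemma q_0: "q 0 = h 0 / (real N + 2)"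
  unfolding q_def by (rule radial_mean_0[OF ch])

lemma \<phi>_0: "\<phi> 0 = a"
  using \<phi>_eq[of 0] by (simp add: potl_def)

lemma d\<phi>:
  assumes "r \<in> {0..1}" shows "(\<phi> has_real_derivative r * q r) (at r within {0..1})"
proof -
  have "((\<lambda>r. a + potl h r) has_real_derivative 0 + r * q r) (at r within {0..1})"
    unfolding potl_def[abs_def] q_def by (intro DERIV_add DERIV_const radial_potential_deriv[OF ch] assms)
  then show ?thesis
    unfolding add_0
    by (rule has_field_derivative_transform_within[where d=1]) (use assms \<phi>_eq in \<open>auto simp: h_def[abs_def]\<close>)
qed

lemma dq: "0 < r \<Longrightarrow> r \<le> 1 \<Longrightarrow> (q has_real_derivative (h r - (real N + 2) * q r) / r) (at r within {0..1})"
  unfolding q_def by (rule radial_mean_deriv[OF ch])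

lemma at_interior: "0 < r \<Longrightarrow> r < 1 \<Longrightarrow> at r within {0..1::real} = at r"
  by (intro at_within_interior) simp

lemma \<phi>_decreasing: assumes "0 \<le> x" "x \<le> y" "y \<le> 1" shows "\<phi> y \<le> \<phi> x"
proof (rule DERIV_nonpos_imp_decreasing_open[OF assms(2)])
  show "continuous_on {x..y} \<phi>" by (rule continuous_on_subset[OF c\<phi>]) (use assms in auto)
  fix r assume "x < r" "r < y"
  then have r: "0 < r" "r < 1" using assms by auto
  show "\<exists>y. (\<phi> has_real_derivative y) (at r) \<and> y \<le> 0"
    using d\<phi>[of r] q_nonpos[of r] r by (intro exI[of _ "r * q r"]) (auto simp: at_interior mult_le_0_iff)
qed

lemma c\<theta>: "continuous_on {0..1} \<theta>" unfolding \<theta>_def[abs_def] by (intro continuous_intros c\<phi>)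
lemma cp: "continuous_on {0..1} p" unfolding p_def[abs_def] by (intro continuous_intros c\<phi> cq)

lemma d\<theta>:
  assumes "r \<in> {0..1}" shows "(\<theta> has_real_derivative p r) (at r within {0..1})"
proof -
  have "(\<theta> has_real_derivative 1 * \<phi> r + r * q r * r) (at r within {0..1})"
    unfolding \<theta>_def[abs_def] by (intro DERIV_mult DERIV_ident d\<phi> assms)
  then show ?thesis by (simp add: p_def power2_eq_square algebra_simps)
qed

definition regular :: "real \<Rightarrow> bool" where
  "regular r \<longleftrightarrow> 0 \<le> \<phi> r \<and> \<phi> r \<le> A \<and> \<theta> r \<le> pi / 2"

lemma h_regular:
  assumes r: "0 < r" "regular r"
  shows "r * h r = (real N - 1) / r^2 * (sin (\<theta> r) * cos (\<theta> r) - \<theta> r) - sin (\<theta> r) * cos (\<theta> r) * wx (\<theta> r)"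
proof -
  define x where "x = \<theta> r"
  have t: "trunc A (\<phi> r) = \<phi> r" using r by (intro trunc_id) (auto simp: regular_def)
  have x: "0 \<le> x" "x \<le> pi/2" using r by (auto simp: regular_def \<theta>_def x_def)
  have sc: "2 * (sin x * cos x) = sin (2 * x)" by (simp add: sin_double)
  \<comment> \<open>\<open>sin3_nonpos\<close> requires a positive argument; at \<open>x = 0\<close>
    the factor \<open>\<phi> r\<close> vanishes instead.\<close>
  have s3: "(\<phi> r)^3 * \<bar>sin3 (2 * x)\<bar> = - ((\<phi> r)^3 * sin3 (2 * x))"
  proof (cases "x = 0")
    case True
    then have "\<phi> r = 0" using r(1) by (simp add: x_def \<theta>_def)
    then show ?thesis by simp
  next
    case False
    then have "sin3 (2 * x) \<le> 0" using sin3_nonpos[of "2 * x"] x by simp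
    then show ?thesis by simp
  qed
  have s1: "\<bar>sinc (2 * x)\<bar> = sinc (2 * x)" using sinc_nonneg[of "2 * x"] x by simp
  have "r * h r = (real N - 1) * (4 * (r * (\<phi> r)^3 * sin3 (2 * x))) - (x * sinc (2 * x)) * wx x"
    unfolding h_def force_def t x_def[symmetric, unfolded \<theta>_def]
    using s3 s1 by (simp add: algebra_simps x_def \<theta>_def)
  moreover have "x * sinc (2 * x) = sin x * cos x" using sin_sinc[of "2 * x"] sc by simp
  moreover have "4 * (r * (\<phi> r)^3 * sin3 (2 * x)) = (sin x * cos x - x) / r^2"
  proof -
    have "sin x * cos x - x = 4 * (x^3 * sin3 (2 * x))"
      using sin_sin3[of "2 * x"] sc by (simp add: power_mult_distrib)
    also have "x^3 = r^2 * (r * (\<phi> r)^3)" by (simp add: x_def \<theta>_def power_mult_distrib power2_eq_square power3_eq_cube)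
    finally show ?thesis using r(1) by simp
  qed
  ultimately have "r * h r = (real N - 1) * ((sin x * cos x - x) / r^2) - (sin x * cos x) * wx x"
    by simp
  then show ?thesis unfolding x_def[symmetric] by simp
qed

lemma dp:
  assumes r: "0 < r" "r \<le> 1" "regular r"
  shows "(p has_real_derivative - (real N - 1) / r * p r
     + sin (\<theta> r) * cos (\<theta> r) * ((real N - 1) / r^2 - wx (\<theta> r))) (at r within {0..1})"
proof -
  define D where "D = (h r - (real N + 2) * q r) / r"
  have rD: "r * D = h r - (real N + 2) * q r" using r by (simp add: D_def)
  have "((\<lambda>x. \<phi> x + x^2 * q x) has_real_derivative r * q r + (2 * r * q r + r^2 * D)) (at r within {0..1})"
    using r d\<phi>[of r] dq[OF r(1,2)] unfolding D_def[symmetric]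
    by (auto intro!: derivative_eq_intros)
  moreover have "r * q r + (2 * r * q r + r^2 * D) = r * h r - (real N - 1) * r * q r"
  proof -
    have "r^2 * D = r * (h r - (real N + 2) * q r)" unfolding rD[symmetric] by (simp add: power2_eq_square)
    then show ?thesis by (simp add: algebra_simps)
  qed
  moreover have "r * h r - (real N - 1) * r * q r = - (real N - 1) / r * p r
     + sin (\<theta> r) * cos (\<theta> r) * ((real N - 1) / r^2 - wx (\<theta> r))"
    unfolding h_regular[OF r(1,3)] p_def \<theta>_def[of r] using r(1)
    by (simp add: field_simps power2_eq_square)
  ultimately show ?thesis unfolding p_def[abs_def, symmetric] by simp
qed

end

section \<open>Oscillation and shooting\<close>

text \<open>Solutions of \<open>\<chi>'' + (N-1)/r \<chi>' + q/r\<^sup>2 \<chi> = 0\<close> with \<open>q = (N-2)\<^sup>2/4 + 1/4\<close>. They oscillate, and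
  \<open>q < N - 1\<close> holds exactly for \<open>2 \<le> N \<le> 6\<close>.\<close>
definition chi :: "nat \<Rightarrow> real \<Rightarrow> real \<Rightarrow> real" where
  "chi N R r = r powr (- (real N - 2) / 2) * sin (ln (r / R) / 2)"

definition chi1 :: "nat \<Rightarrow> real \<Rightarrow> real \<Rightarrow> real" where
  "chi1 N R r = r powr (- (real N - 2) / 2) * (- (real N - 2) / 2 * sin (ln (r / R) / 2) + cos (ln (r / R) / 2) / 2) / r"

definition hardy_const :: "nat \<Rightarrow> real" where "hardy_const N = (real N - 2)^2 / 4 + 1/4"

lemma DERIV_powr_log:
  fixes r k :: real
  assumes "r > 0" shows "((\<lambda>r. r powr k) has_real_derivative k / r * r powr k) (at r)"
  using assms by (auto intro!: derivative_eq_intros simp: powr_diff field_simps)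

lemma chi_deriv:
  assumes r: "r > 0" and R: "R > 0"
  shows "(chi N R has_real_derivative chi1 N R r) (at r)"
proof -
  have "((\<lambda>r. r powr (- (real N - 2) / 2)) has_real_derivative (- (real N - 2) / 2) / r * r powr (- (real N - 2) / 2)) (at r)"
    by (rule DERIV_powr_log[OF r])
  moreover have "((\<lambda>r. sin (ln (r / R) / 2)) has_real_derivative cos (ln (r / R) / 2) * (1 / (2 * r))) (at r)"
    using r R by (auto intro!: derivative_eq_intros simp: field_simps)
  ultimately have "(chi N R has_real_derivative (- (real N - 2) / 2) / r * r powr (- (real N - 2) / 2) * sin (ln (r / R) / 2)
     + cos (ln (r / R) / 2) * (1 / (2 * r)) * r powr (- (real N - 2) / 2)) (at r)"
    unfolding chi_def[abs_def] by (rule DERIV_mult)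
  moreover have "(- (real N - 2) / 2) / r * r powr (- (real N - 2) / 2) * sin (ln (r / R) / 2)
     + cos (ln (r / R) / 2) * (1 / (2 * r)) * r powr (- (real N - 2) / 2) = chi1 N R r"
    unfolding chi1_def using r by (simp add: field_simps)
  ultimately show ?thesis by metis
qed

lemma chi1_deriv:
  assumes r: "r > 0" and R: "R > 0" and N: "N \<ge> 1"
  shows "((\<lambda>r. r^(N-1) * chi1 N R r) has_real_derivative - (r^(N-1) * (hardy_const N / r^2 * chi N R r))) (at r)"
proof -
  define k where "k = (real N - 2) / 2"
  have Nk: "real N = 2 * k + 2" by (simp add: k_def field_simps)
  define s where "s = sin (ln (r / R) / 2)"
  define c where "c = cos (ln (r / R) / 2)"
  define w where "w = r powr (- k)"
  have e: "chi1 N R = (\<lambda>r. r powr (- k) * (- k * sin (ln (r / R) / 2) + cos (ln (r / R) / 2) / 2) / r)"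
    by (rule ext) (simp add: chi1_def k_def minus_divide_left)
  have 1: "((\<lambda>r. r powr (- k)) has_real_derivative - k / r * w) (at r)"
    using DERIV_powr_log[OF r, of "- k"] by (simp add: w_def)
  have 2: "((\<lambda>r. - k * sin (ln (r / R) / 2) + cos (ln (r / R) / 2) / 2) has_real_derivative (- k * c / 2 - s / 4) / r) (at r)"
    using r R unfolding s_def c_def by (auto intro!: derivative_eq_intros simp: field_simps)
  have "(chi1 N R has_real_derivative ((- k / r * w * (- k * s + c / 2) + (- k * c / 2 - s / 4) / r * w) * r - w * (- k * s + c / 2) * 1) / (r * r)) (at r)"
    unfolding e using DERIV_divide[OF DERIV_mult[OF 1 2] DERIV_ident] r by (simp add: s_def c_def w_def)
  then have "((\<lambda>r. r^(N-1) * chi1 N R r) has_real_derivative (real N - 1) / r * r^(N-1) * chi1 N R r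
      + ((- k / r * w * (- k * s + c / 2) + (- k * c / 2 - s / 4) / r * w) * r - w * (- k * s + c / 2) * 1) / (r * r) * r^(N-1)) (at r)"
    using r N by (intro DERIV_mult DERIV_power_dim) auto
  moreover have "(real N - 1) / r * r^(N-1) * chi1 N R r
      + ((- k / r * w * (- k * s + c / 2) + (- k * c / 2 - s / 4) / r * w) * r - w * (- k * s + c / 2) * 1) / (r * r) * r^(N-1)
      = - (r^(N-1) * (hardy_const N / r^2 * chi N R r))"
  proof -
    define P where "P = r^(N-1)"
    have c1: "chi1 N R r = w * (- k * s + c / 2) / r" unfolding e by (simp add: w_def s_def c_def)
    have c0: "chi N R r = w * s" by (simp add: chi_def w_def s_def k_def minus_divide_left)
    have hc: "hardy_const N = k^2 + 1/4" by (simp add: hardy_const_def k_def power_divide)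
    show ?thesis unfolding c1 c0 hc P_def[symmetric] Nk using r
      by (simp add: field_simps power2_eq_square)
  qed
  ultimately show ?thesis by simp
qed

lemma chi_start: "R > 0 \<Longrightarrow> chi N R R = 0" "R > 0 \<Longrightarrow> chi1 N R R > 0"
  by (auto simp: chi_def chi1_def)

lemma chi_end:
  assumes "R > 0"
  shows "chi N R (R * exp (2 * pi)) = 0" "chi1 N R (R * exp (2 * pi)) < 0"
  using assms by (auto simp: chi_def chi1_def divide_less_0_iff)

lemma chi_pos:
  assumes "R > 0" "R < r" "r < R * exp (2 * pi)"
  shows "chi N R r > 0"
proof -
  have "ln (r / R) > 0" using assms by (intro ln_gt_zero) auto
  moreover have "ln (r / R) < ln (exp (2 * pi))" using assms by (subst ln_less_cancel_iff) (auto simp: field_simps)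
  ultimately have "sin (ln (r / R) / 2) > 0" by (intro sin_gt_zero) auto
  then show ?thesis using assms by (simp add: chi_def)
qed

text \<open>The margins used later: \<open>19/20\<close> is the lower bound for \<open>sin^2\<close>
  near \<open>pi/2\<close>, and \<open>1/4\<close> absorbs the potential \<open>r^2 w\<close>. The
  second estimate leaves \<open>1/2\<close> to spare for instability; it is an equality for
  \<open>N = 2\<close> and \<open>N = 6\<close>.\<close>

lemma hardy_const_le: assumes "2 \<le> N" "N \<le> 6" shows "hardy_const N \<le> (19/20) * (real N - 1 - 1/4)" "hardy_const N \<le> real N - 1 - 3/4"
proof -
  have "N = 2 \<or> N = 3 \<or> N = 4 \<or> N = 5 \<or> N = 6" using assms by auto
  then show "hardy_const N \<le> (19/20) * (real N - 1 - 1/4)" "hardy_const N \<le> real N - 1 - 3/4"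
    by (auto simp: hardy_const_def)
qed

section \<open>Monotonicity, transversality and oscillation of trajectories\<close>

context trajectory begin

lemma regular_before:
  assumes "a \<le> A" "0 \<le> r" "r \<le> r0" "r0 \<le> 1" "\<phi> r0 \<ge> 0" "\<theta> r \<le> pi / 2"
  shows "regular r"
  using assms \<phi>_decreasing[of 0 r] \<phi>_decreasing[of r r0] \<phi>_0 by (auto simp: regular_def)

text \<open>The constant \<open>pi/2\<close> solves the angle equation. A trajectory touching it
  with zero slope would coincide with it on an interval to the left.\<close>

lemma transversal:
  assumes aA: "a \<le> A" and r0: "0 < r0" "r0 < 1" and hit: "\<theta> r0 = pi / 2"
    and before: "\<And>r. 0 \<le> r \<Longrightarrow> r < r0 \<Longrightarrow> \<theta> r < pi / 2"
  shows "p r0 > 0"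
proof (rule ccontr)
  assume "\<not> ?thesis"
  have "r0 * \<phi> r0 = pi / 2" using hit by (simp add: \<theta>_def)
  then have "r0 * \<phi> r0 > 0" using pi_gt_zero by linarith
  then have \<phi>0: "\<phi> r0 \<ge> 0" using r0 by (simp add: zero_less_mult_iff)
  have reg: "regular r" if "0 < r" "r \<le> r0" for r
    using regular_before[OF aA _ that(2) _ \<phi>0] that r0 before[of r] hit by (cases "r = r0") auto
  have "p r0 \<ge> 0"
  proof (rule ccontr)
    assume "\<not> ?thesis"
    moreover have "(\<theta> has_real_derivative p r0) (at r0)" using d\<theta>[of r0] r0 by (simp add: at_interior)
    ultimately obtain d where d: "d > 0" "\<And>h. 0 < h \<Longrightarrow> h < d \<Longrightarrow> \<theta> (r0 - h) > \<theta> r0"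
      using DERIV_neg_dec_left[of \<theta> "p r0" r0] by auto
    define t where "t = min (d/2) r0"
    have "0 < t" "t < d" "t \<le> r0" using d(1) r0 by (auto simp: t_def)
    then show False using d(2)[of t] before[of "r0 - t"] hit by auto
  qed
  with \<open>\<not> p r0 > 0\<close> have p0: "p r0 = 0" by simp
  define x where "x = r0 / 2"
  have x: "0 < x" "x < r0" using r0 by (auto simp: x_def)
  define m where "m = real N - 1"
  have m: "m \<ge> 0" using N2 by (simp add: m_def)
  define M where "M = W1 1 / \<eta>^2"
  define E where "E = (\<lambda>r. (pi/2 - \<theta> r)^2 + (p r)^2)"
  define E' where "E' = (\<lambda>r. 2 * (pi/2 - \<theta> r) * (- 1 * p r) + 2 * p r * (- m / r * p r + sin (\<theta> r) * cos (\<theta> r) * (m / r^2 - wx (\<theta> r))))"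
  define C where "C = 1 + 2 * m / x + m / x^2 + M"
  have "E x = 0"
  proof (rule gronwall_zero[where E=E and s=x and x=x and y=r0 and E'=E' and C=C])
    fix r assume r: "x \<le> r" "r \<le> r0"
    then have r1: "0 < r" "r < 1" "r \<le> r0" using x r0 by auto
    have dt: "(\<theta> has_real_derivative p r) (at r)" using d\<theta>[of r] r1 by (simp add: at_interior)
    have dpp: "(p has_real_derivative - m / r * p r + sin (\<theta> r) * cos (\<theta> r) * (m / r^2 - wx (\<theta> r))) (at r)"
      using dp[OF r1(1) _ reg[OF r1(1,3)]] r1 by (simp add: at_interior m_def)
    show "(E has_real_derivative E' r) (at r)"
      unfolding E_def E'_def by (auto intro!: derivative_eq_intros dt dpp)
    have "\<bar>sin (\<theta> r)\<bar> * \<bar>sin (pi/2 - \<theta> r)\<bar> \<le> 1 * \<bar>pi/2 - \<theta> r\<bar>"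
      using abs_sin_x_le_abs_x[of "pi/2 - \<theta> r"] by (intro mult_mono) auto
    then have k: "\<bar>sin (\<theta> r) * cos (\<theta> r)\<bar> \<le> \<bar>pi/2 - \<theta> r\<bar>" by (simp add: abs_mult cos_sin_eq)
    show "\<bar>E' r\<bar> \<le> C * E r"
      unfolding E_def E'_def C_def
      by (rule damped_energy_bound[OF m x(1) r(1) _ k]) (auto simp: wx_nonneg wx_le M_def)
  qed (use x p0 hit in \<open>auto simp: E_def\<close>)
  then have "pi/2 - \<theta> x = 0" unfolding E_def by (simp add: sum_power2_eq_zero_iff)
  then show False using before[of x] x by simp
qed

text \<open>While the angle is in \<open>[0, pi/2]\<close> and
  \<open>r^2 w \<le> 1/4 < N - 1\<close>, the flux \<open>r^(N-1) p\<close> has a nonnegative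
  derivative, and it starts from 0.\<close>

lemma flux_nonneg:
  assumes aA: "a \<le> A" and R: "0 < R" "R \<le> 1" "\<phi> R \<ge> 0" and small: "R^2 * (W1 1 / \<eta>^2) \<le> 1/4"
    and below: "\<forall>r. 0 \<le> r \<longrightarrow> r \<le> R \<longrightarrow> \<theta> r \<le> pi / 2"
  shows "\<And>r. 0 < r \<Longrightarrow> r \<le> R \<Longrightarrow> regular r \<and> real N - 1 - r^2 * wx (\<theta> r) \<ge> real N - 1 - 1/4 \<and> sin (\<theta> r) \<ge> 0 \<and> cos (\<theta> r) \<ge> 0"
    "\<And>r. 0 < r \<Longrightarrow> r \<le> R \<Longrightarrow> p r \<ge> 0"
    "\<And>x y. 0 \<le> x \<Longrightarrow> x \<le> y \<Longrightarrow> y \<le> R \<Longrightarrow> \<theta> x \<le> \<theta> y"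
proof -
  show reg: "regular r \<and> real N - 1 - r^2 * wx (\<theta> r) \<ge> real N - 1 - 1/4 \<and> sin (\<theta> r) \<ge> 0 \<and> cos (\<theta> r) \<ge> 0" if r: "0 < r" "r \<le> R" for r
  proof -
    have 1: "regular r" using regular_before[OF aA _ r(2) R(2,3)] below r by auto
    have "r^2 * wx (\<theta> r) \<le> R^2 * (W1 1 / \<eta>^2)"
      using r wx_le[of "\<theta> r"] wx_nonneg[of "\<theta> r"] by (intro mult_mono power_mono) auto
    moreover have "0 \<le> \<theta> r" "\<theta> r \<le> pi/2" using 1 r by (auto simp: regular_def \<theta>_def)
    then have "sin (\<theta> r) \<ge> 0" "cos (\<theta> r) \<ge> 0"
      by (auto intro!: sin_ge_zero cos_ge_zero)
    ultimately show ?thesis using 1 small by (intro conjI; (assumption | linarith))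
  qed
  show pn: "p r \<ge> 0" if r: "0 < r" "r \<le> R" for r
  proof -
    \<comment> \<open>\<open>p\<close> is continuous up to the origin, so the flux vanishes there
      because \<open>N \<ge> 2\<close>.\<close>
    have "0^(N-1) * p 0 \<le> r^(N-1) * p r"
    proof (rule DERIV_nonneg_imp_increasing_open[where f="\<lambda>r. r^(N-1) * p r"])
      show "continuous_on {0..r} (\<lambda>r. r^(N-1) * p r)"
        using r R by (intro continuous_intros continuous_on_subset[OF cp]) auto
      fix x assume x: "0 < x" "x < r"
      then have x1: "0 < x" "x < 1" "x \<le> R" using r R by auto
      note rx = reg[OF x1(1,3)]
      have "(p has_real_derivative - (real N - 1) / x * p x + sin (\<theta> x) * cos (\<theta> x) * ((real N - 1) / x^2 - wx (\<theta> x))) (at x)"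
        using dp[of x] rx x1 by (simp add: at_interior)
      then have "((\<lambda>r. r^(N-1) * p r) has_real_derivative (real N - 1) / x * x^(N-1) * p x +
          (- (real N - 1) / x * p x + sin (\<theta> x) * cos (\<theta> x) * ((real N - 1) / x^2 - wx (\<theta> x))) * x^(N-1)) (at x)"
        using x1 N2 by (intro DERIV_mult DERIV_power_dim) auto
      moreover have "(real N - 1) / x * x^(N-1) * p x +
          (- (real N - 1) / x * p x + sin (\<theta> x) * cos (\<theta> x) * ((real N - 1) / x^2 - wx (\<theta> x))) * x^(N-1)
         = x^(N-1) * (sin (\<theta> x) * cos (\<theta> x)) * ((real N - 1) / x^2 - wx (\<theta> x))"
      proof -
        have "c / x * X * y + (- c / x * y + k * l) * X = X * k * l" for c X y k l
          by (simp add: algebra_simps)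
        then show ?thesis .
      qed
      moreover have "x^(N-1) * (sin (\<theta> x) * cos (\<theta> x)) * ((real N - 1) / x^2 - wx (\<theta> x)) \<ge> 0"
      proof -
        have "real N - 1 - x^2 * wx (\<theta> x) \<ge> 0" using rx N2 by auto
        then have "(real N - 1) / x^2 - wx (\<theta> x) \<ge> 0" using x1 by (simp add: field_simps)
        then show ?thesis using rx x1 by simp
      qed
      ultimately show "\<exists>y. ((\<lambda>r. r^(N-1) * p r) has_real_derivative y) (at x) \<and> 0 \<le> y" by force
    qed (use r in simp)
    moreover have "(0::real)^(N-1) = 0" using N2 by simp
    ultimately have "0 \<le> r^(N-1) * p r" by (metis mult_zero_left)
    moreover have "r^(N-1) > 0" using r by simp
    ultimately show ?thesis by (meson mult_pos_neg not_le)
  qed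
  show "\<theta> x \<le> \<theta> y" if "0 \<le> x" "x \<le> y" "y \<le> R" for x y
  proof (rule DERIV_nonneg_imp_increasing_open[OF that(2)])
    show "continuous_on {x..y} \<theta>" using that R by (intro continuous_on_subset[OF c\<theta>]) auto
    fix r assume "x < r" "r < y"
    then show "\<exists>l. (\<theta> has_real_derivative l) (at r) \<and> 0 \<le> l"
      using d\<theta>[of r] pn[of r] that R by (intro exI[of _ "p r"]) (auto simp: at_interior)
  qed
qed

text \<open>For \<open>N \<le> 6\<close> the value \<open>\<pi>/2\<close> cannot be approached without being crossed: once \<open>\<theta>\<close> is close to
  \<open>\<pi>/2\<close>, \<open>cos \<theta>\<close> satisfies a linear equation whose solutions oscillate faster than \<open>chi\<close>.\<close>
lemma oscillation_hits:
  assumes N6: "N \<le> 6" and aA: "a \<le> A" and R: "0 < R" "R * exp (2 * pi) \<le> r1" and r1: "r1 \<le> 1" "\<phi> r1 \<ge> 0"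
    and small: "r1^2 * (W1 1 / \<eta>^2) \<le> 1/4"
    and below: "\<And>r. 0 \<le> r \<Longrightarrow> r \<le> r1 \<Longrightarrow> \<theta> r < pi / 2"
    and near: "(sin (\<theta> R))^2 \<ge> 19/20"
  shows False
proof -
  define e where "e = R * exp (2 * pi)"
  have Re: "R < e" using R by (simp add: e_def)
  have r10: "0 < r1" using R Re unfolding e_def by linarith
  have below': "\<forall>r. 0 \<le> r \<longrightarrow> r \<le> r1 \<longrightarrow> \<theta> r \<le> pi / 2" using below less_imp_le by blast
  note fl = flux_nonneg[OF aA r10 r1 small below']
  define g where "g = (\<lambda>r. cos (\<theta> r))"
  define g1 where "g1 = (\<lambda>r. - sin (\<theta> r) * p r)"
  \<comment> \<open>The Wronskian \<open>r^(N-1) (g' chi - g chi')\<close>. It is nonincreasing on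
    one half-period of \<open>chi\<close>, yet the opposite slopes of \<open>chi\<close> at its two
    zeros make it negative at \<open>R\<close> and positive at \<open>R * exp (2 * pi)\<close> if
    \<open>g\<close> stays positive.\<close>
  define V where "V = (\<lambda>r. (r^(N-1) * g1 r) * chi N R r - g r * (r^(N-1) * chi1 N R r))"
  have in01: "0 < r \<and> r < 1 \<and> r \<le> r1" if "R < r" "r < e" for r
    using that R r1 by (auto simp: e_def)
  have dV: "\<exists>y. (V has_real_derivative y) (at r) \<and> y \<le> 0" if r: "R < r" "r < e" for r
  proof -
    have r1': "0 < r" "r < 1" "r \<le> r1" using in01[OF r] by auto
    note rr = fl(1)[OF r1'(1,3)]
    have dt: "(\<theta> has_real_derivative p r) (at r)" using d\<theta>[of r] r1' by (simp add: at_interior)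
    define m where "m = real N - 1"
    define z where "z = m / r^2 - wx (\<theta> r)"
    define S where "S = sin (\<theta> r)"
    define C where "C = cos (\<theta> r)"
    have dpp: "(p has_real_derivative - m / r * p r + S * C * z) (at r)"
      using dp[of r] rr r1' by (simp add: at_interior m_def z_def S_def C_def)
    have dg: "(g has_real_derivative g1 r) (at r)"
      unfolding g_def g1_def by (auto intro!: derivative_eq_intros dt)
    have "((\<lambda>r. - sin (\<theta> r)) has_real_derivative - (C * p r)) (at r)"
      unfolding C_def by (auto intro!: derivative_eq_intros dt)
    from DERIV_mult[OF this dpp]
    have dg1: "(g1 has_real_derivative - (C * p r) * p r + (- m / r * p r + S * C * z) * (- S)) (at r)"
      unfolding g1_def S_def .
    have "((\<lambda>r. r^(N-1) * g1 r) has_real_derivative (real N - 1) / r * r^(N-1) * g1 r +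
       (- (C * p r) * p r + (- m / r * p r + S * C * z) * (- S)) * r^(N-1)) (at r)"
      using r1' N2 by (intro DERIV_mult DERIV_power_dim dg1) auto
    moreover have "(real N - 1) / r * r^(N-1) * g1 r + (- (C * p r) * p r + (- m / r * p r + S * C * z) * (- S)) * r^(N-1)
      = - (r^(N-1) * C * ((p r)^2 + S^2 * z))"
      unfolding m_def[symmetric] g1_def S_def[symmetric] by (simp add: algebra_simps power2_eq_square)
    ultimately have dgg: "((\<lambda>r. r^(N-1) * g1 r) has_real_derivative - (r^(N-1) * C * ((p r)^2 + S^2 * z))) (at r)"
      by simp
    have "(V has_real_derivative (- (r^(N-1) * C * ((p r)^2 + S^2 * z))) * chi N R r + chi1 N R r * (r^(N-1) * g1 r)
        - (g1 r * (r^(N-1) * chi1 N R r) + (- (r^(N-1) * (hardy_const N / r^2 * chi N R r))) * g r)) (at r)"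
      unfolding V_def using r1' R N2
      by (intro DERIV_diff DERIV_mult dgg dg chi_deriv chi1_deriv) auto
    moreover have "(- (r^(N-1) * C * ((p r)^2 + S^2 * z))) * chi N R r + chi1 N R r * (r^(N-1) * g1 r)
        - (g1 r * (r^(N-1) * chi1 N R r) + (- (r^(N-1) * (hardy_const N / r^2 * chi N R r))) * g r)
        = - (r^(N-1) * C * chi N R r * ((p r)^2 + S^2 * z - hardy_const N / r^2))"
      unfolding g_def C_def[symmetric] by (simp add: algebra_simps)
    moreover have "(p r)^2 + S^2 * z - hardy_const N / r^2 \<ge> 0"
    proof -
      have "\<theta> R \<le> \<theta> r" using fl(3)[of R r] R r r1' by auto
      moreover have "0 \<le> \<theta> R" using fl(1)[of R] R r r1' by (auto simp: regular_def \<theta>_def)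
      moreover have "\<theta> r \<le> pi/2" using below[of r] r1' by auto
      ultimately have "sin (\<theta> R) \<le> S" "0 \<le> sin (\<theta> R)" unfolding S_def
        by (auto intro!: sin_monotone_2pi_le sin_ge_zero)
      then have "(sin (\<theta> R))^2 \<le> S^2" by (intro power_mono) auto
      then have S: "S^2 \<ge> 19/20" using near by simp
      have rz: "r^2 * z = m - r^2 * wx (\<theta> r)" using r1' by (simp add: z_def field_simps)
      have rz2: "r^2 * z \<ge> m - 1/4" using rr rz by (simp add: m_def)
      have m1: "m - 1/4 \<ge> 0" using N2 by (simp add: m_def)
      have "hardy_const N \<le> (19/20) * (m - 1/4)" using hardy_const_le[OF N2 N6] by (simp add: m_def)
      also have "\<dots> \<le> S^2 * (r^2 * z)" using S rz2 m1 by (intro mult_mono) auto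
      finally have "hardy_const N / r^2 \<le> S^2 * z" using r1' by (simp add: field_simps)
      then show ?thesis using zero_le_power2[of "p r"] by linarith
    qed
    moreover have "r^(N-1) * C * chi N R r \<ge> 0"
      using rr r1' chi_pos[of R r N] R r by (auto simp: C_def e_def)
    ultimately show ?thesis by (metis mult_nonneg_nonneg neg_le_0_iff_le)
  qed
  have e1: "e \<le> 1" using R r1 by (simp add: e_def)
  have VV: "V e \<le> V R"
  proof (rule DERIV_nonpos_imp_decreasing_open[OF less_imp_le[OF Re]])
    have sub: "{R..e} \<subseteq> {0..1}" using R e1 by auto
    have cc: "continuous_on {R..e} (chi N R)"
      by (rule DERIV_continuous_on[OF has_field_derivative_at_within[OF chi_deriv]]) (use R in auto)
    have cc1: "continuous_on {R..e} (\<lambda>r. r^(N-1) * chi1 N R r)"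
      by (rule DERIV_continuous_on[OF has_field_derivative_at_within[OF chi1_deriv]]) (use R N2 in auto)
    show "continuous_on {R..e} V" unfolding V_def g_def g1_def
      by (intro continuous_intros cc cc1 continuous_on_subset[OF c\<theta> sub] continuous_on_subset[OF cp sub])
  qed (use dV in blast)
  have gp: "g r > 0" if r: "0 < r" "r \<le> r1" for r
  proof -
    have "0 \<le> \<theta> r" using fl(1)[OF r] r by (auto simp: regular_def \<theta>_def)
    then show ?thesis unfolding g_def using below[of r] r pi_gt_zero by (intro cos_gt_zero_pi) linarith+
  qed
  have er1: "0 < e" "e \<le> r1" "R \<le> r1" using R(1) R(2)[folded e_def] Re by linarith+
  have "g R * (R^(N-1) * chi1 N R R) > 0" using chi_start(2)[of R N] R gp[OF R(1) er1(3)] by (intro mult_pos_pos) auto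
  then have "V R < 0" unfolding V_def using chi_start(1)[of R N] R by simp
  moreover have "g e * (e^(N-1) * - chi1 N R e) > 0"
    using chi_end(2)[of R N] R gp[OF er1(1,2)] er1(1) unfolding e_def by (intro mult_pos_pos) auto
  then have "V e > 0" unfolding V_def using chi_end(1)[of R N] R by (simp add: e_def)
  ultimately show False using VV by simp
qed

end

section \<open>Choice of the amplitude and instability of the trivial solution\<close>

context shooting begin

text \<open>For large \<open>A\<close> the trajectory lives on the scale \<open>1/A\<close>. At
  \<open>\<rho> = \<kappa> / A\<close> the angle already exceeds a value independent of
  \<open>A\<close>. Over the next logarithmic length \<open>T\<close>, also independent of
  \<open>A\<close>, it must come close to \<open>pi/2\<close>; from there one half-period of
  oscillation forces a hit. All this fits below \<open>r1\<close> once \<open>A\<close> is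
  large.\<close>

lemma ex_hitting_amplitude:
  assumes N6: "N \<le> 6"
  obtains A where "A \<ge> 0"
    "\<And>\<phi>. trajectory W W1 W2 N \<eta> A A \<phi> \<Longrightarrow> \<exists>r\<in>{0..1}. r * \<phi> r \<ge> pi / 2"
proof -
  define wb where "wb = W1 1 / \<eta>^2"
  have wb: "wb \<ge> 0" using W1_nonneg[of 1] by (simp add: wb_def)
  \<comment> \<open>Below \<open>r1\<close> the potential is a small perturbation:
    \<open>r1^2 * wb \<le> 1/4\<close>.\<close>
  define r1 where "r1 = 1 / (2 * (1 + wb))"
  have r1: "0 < r1" "r1 \<le> 1" using wb by (auto simp: r1_def field_simps)
  have small: "r1^2 * wb \<le> 1/4"
  proof -
    have "4 * wb \<le> (2 * (1 + wb))^2" using wb by (simp add: power2_eq_square algebra_simps)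
    moreover have "r1^2 * wb = wb / (2 * (1 + wb))^2" by (simp add: r1_def power_divide)
    ultimately show ?thesis using wb by (simp add: pos_divide_le_eq)
  qed
  have "continuous_on {0..pi} sin3" unfolding sin3_def
    by (intro powser_cont entire_coeffs_Suc entire_sin)
  then have "bounded (sin3 ` {0..pi})" by (intro compact_imp_bounded compact_continuous_image) auto
  then obtain B3 where B3: "\<forall>x\<in>{0..pi}. \<bar>sin3 x\<bar> \<le> B3" unfolding bounded_iff by auto
  have B30: "B3 \<ge> 0" using B3 by (force dest: bspec[of _ _ 0])
  define C1 where "C1 = 4 * (real N - 1) * B3 + wb"
  have C1: "C1 \<ge> 0" using B30 wb N2 by (simp add: C1_def)
  \<comment> \<open>Keeps the loss of \<open>\<phi>\<close> up to radius \<open>\<kappa> / A\<close>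
    below \<open>C1 * \<kappa>^2 * A \<le> A / 2\<close>.\<close>
  define \<kappa> where "\<kappa> = 1 / (1 + C1)"
  have \<kappa>: "0 < \<kappa>" "\<kappa> \<le> 1" using C1 by (auto simp: \<kappa>_def field_simps)
  have C1\<kappa>: "C1 * \<kappa>^2 \<le> 1/2"
  proof -
    have "2 * C1 \<le> (1 + C1)^2" using zero_le_power2[of "C1"] by (simp add: power2_eq_square algebra_simps)
    then show ?thesis using C1 by (simp add: \<kappa>_def power_divide field_simps)
  qed
  \<comment> \<open>Lower bound for \<open>sin * cos\<close> between the angle
    \<open>\<kappa> / 2\<close> and the region where \<open>sin^2 \<ge> 19/20\<close>: before that
    region \<open>cos^2 > 1/20 > (1/5)^2\<close>.\<close>
  define s0 where "s0 = sin (\<kappa> / 2) / 5"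
  have s0: "s0 > 0" unfolding s0_def using \<kappa> pi_gt3 by (auto intro!: sin_gt_zero)
  \<comment> \<open>The factor \<open>3/4\<close> bounds \<open>N - 1 - r^2 w\<close> from below;
    dividing by \<open>N - 1\<close> compensates the derivative of \<open>r^(N-1)\<close> in
    \<open>Y\<close>.\<close>
  define c where "c = 3/4 * s0 / (real N - 1)"
  have c: "c > 0" using s0 N2 by (simp add: c_def)
  define T where "T = pi / c"
  have T: "T > 0" using c by (simp add: T_def)
  \<comment> \<open>The second entry ensures \<open>r2 * exp (2 * pi) \<le> r1\<close>, leaving room
    for a half-period of \<open>chi\<close> starting at any radius up to \<open>r2\<close>.\<close>
  define A where "A = max 1 (2 * \<kappa> * exp T * exp (2 * pi) / r1)"
  have A1: "A \<ge> 1" by (simp add: A_def)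
  define \<rho> where "\<rho> = \<kappa> / A"
  have \<rho>0: "0 < \<rho>" using \<kappa> A1 by (simp add: \<rho>_def)
  define r2 where "r2 = 2 * \<rho> * exp T"
  have r2e: "r2 * exp (2 * pi) \<le> r1"
  proof -
    have "2 * \<kappa> * exp T * exp (2 * pi) \<le> A * r1" using r1 by (simp add: A_def pos_divide_le_eq[symmetric])
    then show ?thesis using A1 by (simp add: r2_def \<rho>_def field_simps)
  qed
  have r2: "2 * \<rho> < r2" "0 < r2" using T \<rho>0 by (auto simp: r2_def)
  have "r2 * 1 \<le> r2 * exp (2 * pi)" using r2 by (intro mult_left_mono) auto
  then have r2r1: "r2 \<le> r1" using r2e by simp
  show ?thesis
  proof (rule that[of A])
    fix \<phi> assume "trajectory W W1 W2 N \<eta> A A \<phi>"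
    then interpret trajectory W W1 W2 N \<eta> A A \<phi> .
    show "\<exists>r\<in>{0..1}. r * \<phi> r \<ge> pi / 2"
    proof (rule ccontr)
      assume neg: "\<not> ?thesis"
      have below: "\<theta> r < pi / 2" if "0 \<le> r" "r \<le> 1" for r
        using neg that by (force simp: \<theta>_def)
      have below': "\<forall>r. 0 \<le> r \<longrightarrow> r \<le> R \<longrightarrow> \<theta> r \<le> pi / 2" if "R \<le> 1" for R
        using below that by (meson less_imp_le order_trans)
      \<comment> \<open>At a first zero of \<open>\<phi>\<close> the angle would be 0 again,
        although it is nondecreasing and was positive before.\<close>
      have \<phi>pos: "\<phi> r > 0" if r: "0 \<le> r" "r \<le> r1" for r
      proof (rule ccontr)
        assume "\<not> ?thesis"
        moreover have "continuous_on {0..r} (\<lambda>r. - \<phi> r)"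
          using r r1 by (intro continuous_intros continuous_on_subset[OF c\<phi>]) auto
        ultimately obtain x where x: "0 < x" "x \<le> r" "- \<phi> x = 0" "\<And>t. 0 \<le> t \<Longrightarrow> t < x \<Longrightarrow> - \<phi> t < 0"
          using first_zero[of 0 r "\<lambda>r. - \<phi> r"] r \<phi>_0 A1 by auto
        have "x^2 * wb \<le> r1^2 * wb" using x r wb by (intro mult_right_mono power_mono) auto
        then have sx: "x^2 * (W1 1 / \<eta>^2) \<le> 1/4" using small unfolding wb_def by linarith
        have "\<theta> (x/2) \<le> \<theta> x"
          using flux_nonneg(3)[OF order_refl x(1) _ _ sx below', of "x/2" x] x r r1 by auto
        moreover have "\<theta> (x/2) > 0" using x by (auto simp: \<theta>_def)
        moreover have "\<theta> x = 0" using x by (simp add: \<theta>_def)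
        ultimately show False by simp
      qed
      note fl = flux_nonneg[OF order_refl r1 less_imp_le[OF \<phi>pos[OF less_imp_le[OF r1(1)] order_refl]]
          small[unfolded wb_def] below'[OF r1(2)]]
      have hb: "h t \<ge> - (C1 * A^3)" if t: "0 \<le> t" "t \<le> r1" for t
      proof -
        have f: "0 \<le> \<phi> t" "\<phi> t \<le> A" using \<phi>pos[OF t] \<phi>_decreasing[of 0 t] t r1 \<phi>_0 by auto
        have tr: "trunc A (\<phi> t) = \<phi> t" using f by (rule trunc_id)
        define x where "x = 2 * (t * \<phi> t)"
        have x: "0 \<le> x" "x \<le> pi" using t f below[of t] r1 by (auto simp: x_def \<theta>_def)
        have si: "\<bar>sinc x\<bar> \<le> 1"
        proof (cases "x = 0")
          case False
          have "x * sinc x \<le> x * 1" using sin_x_le_x[OF x(1)] sin_sinc[of x] by simp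
          then show ?thesis using False x sinc_nonneg[OF x] by simp
        qed (simp add: sinc_0)
        have "4 * (real N - 1) * (\<phi> t)^3 * \<bar>sin3 x\<bar> \<le> 4 * (real N - 1) * A^3 * B3"
          using f B3 x N2 by (intro mult_mono power_mono) auto
        moreover have "\<phi> t * \<bar>sinc x\<bar> * wx (t * \<phi> t) \<le> A * 1 * wb"
          using f si wx_le[of "t * \<phi> t"] wx_nonneg[of "t * \<phi> t"] A1 unfolding wb_def by (intro mult_mono) auto
        moreover have "A * 1 * wb \<le> A^3 * wb"
          using wb A1 self_le_power[of A 3] by (intro mult_right_mono) auto
        ultimately have "4 * (real N - 1) * (\<phi> t)^3 * \<bar>sin3 x\<bar> + \<phi> t * \<bar>sinc x\<bar> * wx (t * \<phi> t) \<le> C1 * A^3"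
          by (simp add: C1_def algebra_simps)
        then show ?thesis unfolding h_def force_def tr x_def by simp
      qed
      have qb: "q s \<ge> - (C1 * A^3)" if "0 \<le> s" "s \<le> r1" for s
        unfolding q_def using that r1 hb C1 A1 by (intro radial_mean_ge[OF ch]) auto
      have \<rho>1: "\<rho> \<le> r1" using r2 r2r1 \<rho>0 by linarith
      have "\<phi> 0 + C1 * A^3 * 0^2 \<le> \<phi> \<rho> + C1 * A^3 * \<rho>^2"
      proof (rule DERIV_nonneg_imp_increasing_open[where f="\<lambda>r. \<phi> r + C1 * A^3 * r^2"])
        show "continuous_on {0..\<rho>} (\<lambda>r. \<phi> r + C1 * A^3 * r^2)"
          using \<rho>1 r1 by (intro continuous_intros continuous_on_subset[OF c\<phi>]) auto
        fix r assume r: "0 < r" "r < \<rho>"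
        have "(\<phi> has_real_derivative r * q r) (at r)" using d\<phi>[of r] r \<rho>1 r1 by (simp add: at_interior)
        then have "((\<lambda>r. \<phi> r + C1 * A^3 * r^2) has_real_derivative r * q r + C1 * A^3 * (2 * r)) (at r)"
          by (auto intro!: derivative_eq_intros)
        moreover have "r * q r + C1 * A^3 * (2 * r) \<ge> 0"
        proof -
          have "r * q r \<ge> r * (- (C1 * A^3))" using qb[of r] r \<rho>1 by (intro mult_left_mono) auto
          moreover have "r * (C1 * A^3) \<ge> 0" using r C1 A1 by simp
          ultimately show ?thesis by (simp add: algebra_simps)
        qed
        ultimately show "\<exists>y. ((\<lambda>r. \<phi> r + C1 * A^3 * r^2) has_real_derivative y) (at r) \<and> 0 \<le> y" by blast
      qed (use \<rho>0 in simp)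
      moreover have "C1 * A^3 * \<rho>^2 = (C1 * \<kappa>^2) * A"
        using A1 by (simp add: \<rho>_def power_divide power2_eq_square power3_eq_cube)
      moreover have "(C1 * \<kappa>^2) * A \<le> 1/2 * A" using C1\<kappa> A1 by (intro mult_right_mono) auto
      ultimately have "\<phi> \<rho> \<ge> A / 2" using \<phi>_0 by simp
      then have "\<rho> * \<phi> \<rho> \<ge> \<rho> * (A / 2)" using \<rho>0 by (intro mult_left_mono) auto
      then have \<theta>\<rho>: "\<theta> \<rho> \<ge> \<kappa> / 2" using A1 by (simp add: \<theta>_def \<rho>_def)
      have "\<exists>R. \<rho> \<le> R \<and> R \<le> r2 \<and> (sin (\<theta> R))^2 \<ge> 19/20"
      proof (rule ccontr)
        assume no: "\<not> ?thesis"
        have SC: "sin (\<theta> r) * cos (\<theta> r) \<ge> s0" if r: "\<rho> \<le> r" "r \<le> r2" for r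
        proof -
          have "(sin (\<theta> r))^2 < 19/20" using no r by force
          then have "(cos (\<theta> r))^2 > (1/5)^2" using sin_cos_squared_add[of "\<theta> r"] by (simp add: power2_eq_square)
          moreover have "cos (\<theta> r) \<ge> 0" using fl(1)[of r] r \<rho>0 r2r1 by auto
          ultimately have C: "cos (\<theta> r) \<ge> 1/5" by (meson less_imp_le power_less_imp_less_base)
          have "\<theta> \<rho> \<le> \<theta> r" using fl(3)[of \<rho> r] r \<rho>0 r2r1 by auto
          then have "sin (\<kappa>/2) \<le> sin (\<theta> r)"
            using \<theta>\<rho> \<kappa> below[of r] r r2r1 r1 \<rho>0 pi_gt3 by (intro sin_monotone_2pi_le) auto
          moreover have "sin (\<kappa>/2) \<ge> 0" using s0 by (simp add: s0_def)
          ultimately have "sin (\<theta> r) * cos (\<theta> r) \<ge> sin (\<kappa>/2) * (1/5)" using C by (intro mult_mono) auto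
          then show ?thesis by (simp add: s0_def)
        qed
        \<comment> \<open>Its monotonicity integrates the angle equation into
          \<open>p r \<ge> (c / r) (1 - (\<rho> / r)^(N-1))\<close>, and from
          \<open>2 * \<rho>\<close> on the bracket is at least \<open>1/2\<close>.\<close>
        define Y where "Y = (\<lambda>r. r^N * p r - c * r^(N-1))"
        have Ymono: "Y \<rho> \<le> Y r" if r: "\<rho> \<le> r" "r \<le> r2" for r
        proof (rule DERIV_nonneg_imp_increasing_open[OF r(1)])
          show "continuous_on {\<rho>..r} Y" unfolding Y_def
            using r \<rho>0 r2r1 r1 by (intro continuous_intros continuous_on_subset[OF cp]) auto
          fix x assume x: "\<rho> < x" "x < r"
          then have x1: "0 < x" "x < 1" "x \<le> r1" "\<rho> \<le> x" "x \<le> r2" using r \<rho>0 r2r1 r1 by auto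
          note rx = fl(1)[OF x1(1,3)]
          define k where "k = sin (\<theta> x) * cos (\<theta> x)"
          define z where "z = (real N - 1) / x^2 - wx (\<theta> x)"
          have dpp: "(p has_real_derivative - (real N - 1) / x * p x + k * z) (at x)"
            using dp[of x] rx x1 by (simp add: at_interior k_def z_def)
          have dN: "((\<lambda>r. r^N) has_real_derivative real N / x * x^N) (at x)"
            using DERIV_power_dim[of "N+1" x] x1 by simp
          have "(Y has_real_derivative (real N / x * x^N * p x + (- (real N - 1) / x * p x + k * z) * x^N)
              - c * ((real N - 1) / x * x^(N-1))) (at x)"
            unfolding Y_def using x1 N2
            by (intro DERIV_diff DERIV_mult DERIV_cmult dN dpp DERIV_power_dim) auto
          moreover have "(real N / x * x^N * p x + (- (real N - 1) / x * p x + k * z) * x^N)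
              - c * ((real N - 1) / x * x^(N-1)) = x^(N-1) * (p x + (k * (x^2 * z) - 3/4 * s0) / x)"
          proof -
            have "x^N = x * x^(N-1)" using N2 by (metis Suc_diff_1 power_Suc pos2 less_le_trans)
            moreover have "real N - 1 \<noteq> 0" using N2 by simp
            then have "c * (real N - 1) = 3/4 * s0" by (metis c_def nonzero_eq_divide_eq)
            then have "c * ((real N - 1) / x * x^(N-1)) = 3/4 * s0 / x * x^(N-1)"
              by (metis times_divide_eq_right mult.assoc)
            ultimately show ?thesis using x1 by (simp add: field_simps power2_eq_square)
          qed
          moreover have "x^(N-1) * (p x + (k * (x^2 * z) - 3/4 * s0) / x) \<ge> 0"
          proof -
            have "x^2 * z = real N - 1 - x^2 * wx (\<theta> x)" using x1 by (simp add: z_def field_simps)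
            then have "x^2 * z \<ge> 3/4" using rx N2 by auto
            moreover have "k \<ge> s0" unfolding k_def by (rule SC[OF x1(4,5)])
            ultimately have "s0 * (3/4) \<le> k * (x^2 * z)" using s0 by (intro mult_mono) auto
            then have "(k * (x^2 * z) - 3/4 * s0) / x \<ge> 0" using x1 by simp
            then show ?thesis using fl(2)[OF x1(1,3)] x1 by simp
          qed
          ultimately show "\<exists>y. (Y has_real_derivative y) (at x) \<and> 0 \<le> y" by metis
        qed
        have pl: "p r \<ge> c / (2 * r)" if r: "2 * \<rho> \<le> r" "r \<le> r2" for r
        proof -
          have r0: "0 < r" using r \<rho>0 by linarith
          have "Y \<rho> \<ge> - (c * \<rho>^(N-1))" using fl(2)[of \<rho>] \<rho>0 \<rho>1 by (simp add: Y_def)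
          moreover have "Y \<rho> \<le> Y r" using Ymono[of r] r \<rho>0 by auto
          ultimately have 1: "r^N * p r \<ge> c * r^(N-1) - c * \<rho>^(N-1)" by (simp add: Y_def)
          have "\<rho>^(N-1) \<le> (r / 2)^(N-1)" using r \<rho>0 by (intro power_mono) auto
          also have "\<dots> = r^(N-1) * (1/2)^(N-1)" by (simp add: power_divide)
          also have "\<dots> \<le> r^(N-1) * (1/2)^1" using r0 N2 by (intro mult_left_mono power_decreasing) auto
          finally have "c * \<rho>^(N-1) \<le> c * (r^(N-1) / 2)" using c by (intro mult_left_mono) auto
          with 1 have "r^N * p r \<ge> c * r^(N-1) / 2" by simp
          moreover have "r^N = r * r^(N-1)" using N2 by (metis Suc_diff_1 power_Suc pos2 less_le_trans)
          ultimately have "(r * p r) * r^(N-1) \<ge> (c / 2) * r^(N-1)" by (simp add: mult.commute mult.left_commute)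
          then have "r * p r \<ge> c / 2" using r0 by simp
          then show ?thesis using r0 by (simp add: field_simps)
        qed
        \<comment> \<open>Integrating \<open>c / (2 r)\<close> from \<open>2 * \<rho>\<close> to
          \<open>2 * \<rho> * exp T\<close> gives a gain of \<open>c/2 * T = pi/2\<close>, more than
          the angle has left.\<close>
        have "\<theta> (2 * \<rho>) - c/2 * ln (2 * \<rho>) \<le> \<theta> r2 - c/2 * ln r2"
        proof (rule DERIV_nonneg_imp_increasing_open[where f="\<lambda>r. \<theta> r - c/2 * ln r"])
          show "continuous_on {2 * \<rho>..r2} (\<lambda>r. \<theta> r - c/2 * ln r)"
            using \<rho>0 r2r1 r1 by (intro continuous_intros continuous_on_subset[OF c\<theta>]) auto
          fix r assume r: "2 * \<rho> < r" "r < r2"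
          then have rr: "0 < r" "r < 1" using \<rho>0 r2r1 r1 by auto
          have dt: "(\<theta> has_real_derivative p r) (at r)" using d\<theta>[of r] rr by (simp add: at_interior)
          have "((\<lambda>r. \<theta> r - c/2 * ln r) has_real_derivative p r - c/2 * (1 / r)) (at r)"
            using rr by (auto intro!: derivative_eq_intros dt)
          moreover have "p r - c/2 * (1 / r) \<ge> 0" using pl[of r] r rr by simp
          ultimately show "\<exists>y. ((\<lambda>r. \<theta> r - c/2 * ln r) has_real_derivative y) (at r) \<and> 0 \<le> y" by blast
        qed (use r2 in simp)
        moreover have "ln r2 = ln (2 * \<rho>) + T" unfolding r2_def using \<rho>0 by (subst ln_mult) auto
        moreover have "c/2 * T = pi/2" using c by (simp add: T_def)
        moreover have "\<theta> (2 * \<rho>) \<ge> 0" using \<phi>pos[of "2 * \<rho>"] \<rho>0 r2 r2r1 by (simp add: \<theta>_def)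
        ultimately have "\<theta> r2 \<ge> pi/2" by (simp add: distrib_left)
        then show False using below[of r2] r2 r2r1 r1 by simp
      qed
      then obtain R where R: "\<rho> \<le> R" "R \<le> r2" "(sin (\<theta> R))^2 \<ge> 19/20" by blast
      have "R * exp (2 * pi) \<le> r2 * exp (2 * pi)" using R by (intro mult_right_mono) auto
      then have "R * exp (2 * pi) \<le> r1" using r2e by linarith
      then show False
        using oscillation_hits[OF N6 order_refl, of R r1] R \<rho>0 r1 \<phi>pos[of r1] small below
        by (force simp: wb_def)
    qed
  qed (use A1 in simp)
qed

text \<open>The intermediate value theorem is applied to the maximum of the angle over
  \<open>[0,1]\<close>, which is Lipschitz in the amplitude, in place of the hitting radius. Where
  this maximum equals \<open>pi/2\<close>, transversality excludes an interior contact, so it is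
  attained only at \<open>r = 1\<close>.\<close>

lemma ex_solution_trajectory:
  assumes N6: "N \<le> 6"
  obtains A a \<phi> where "trajectory W W1 W2 N \<eta> A a \<phi>" "a \<le> A" "\<phi> 1 = pi / 2"
    "\<And>r. 0 \<le> r \<Longrightarrow> r < 1 \<Longrightarrow> r * \<phi> r < pi / 2"
proof -
  obtain A where A: "A \<ge> 0" "\<And>\<phi>. trajectory W W1 W2 N \<eta> A A \<phi> \<Longrightarrow> \<exists>r\<in>{0..1}. r * \<phi> r \<ge> pi / 2"
    using ex_hitting_amplitude[OF N6] by blast
  obtain \<Phi> C where \<Phi>: "\<And>a. continuous_on {0..1} (\<Phi> a)"
    "\<And>a r. r \<in> {0..1} \<Longrightarrow> \<Phi> a r = a + potl (\<lambda>t. force A t (\<Phi> a t)) r"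
    "\<And>a b r. r \<in> {0..1} \<Longrightarrow> \<bar>\<Phi> a r - \<Phi> b r\<bar> \<le> C * \<bar>a - b\<bar>"
    using ex_trajectories[OF A(1)] by blast
  have tr: "trajectory W W1 W2 N \<eta> A a (\<Phi> a)" for a
    by unfold_locales (use A \<Phi> in auto)
  have C: "C \<ge> 0" using \<Phi>(3)[of 0 1 0] by simp
  have "\<exists>x\<in>{0..1}. \<forall>y\<in>{0..1}. y * \<Phi> a y \<le> x * \<Phi> a x" for a
    by (rule continuous_attains_sup) (auto intro!: continuous_intros \<Phi>)
  then obtain X where X: "\<And>a. X a \<in> {0..1}" "\<And>a y. y \<in> {0..1} \<Longrightarrow> y * \<Phi> a y \<le> X a * \<Phi> a (X a)"
    by metis
  define M where "M = (\<lambda>a. X a * \<Phi> a (X a))"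
  have Mle: "M a - M b \<le> C * \<bar>a - b\<bar>" for a b
  proof -
    have "M a - M b \<le> X a * \<Phi> a (X a) - X a * \<Phi> b (X a)" using X(2)[OF X(1)[of a], of b] by (simp add: M_def)
    also have "\<dots> = X a * (\<Phi> a (X a) - \<Phi> b (X a))" by (simp add: algebra_simps)
    also have "\<dots> \<le> X a * \<bar>\<Phi> a (X a) - \<Phi> b (X a)\<bar>" using X(1)[of a] by (intro mult_left_mono) auto
    also have "\<dots> \<le> 1 * (C * \<bar>a - b\<bar>)" using X(1)[of a] \<Phi>(3)[OF X(1)[of a]] by (intro mult_mono) auto
    finally show ?thesis by simp
  qed
  have "C-lipschitz_on {0..A} M"
  proof (rule lipschitz_onI[OF _ C])
    fix x y
    show "dist (M x) (M y) \<le> C * dist x y"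
      using Mle[of x y] Mle[of y x] by (simp add: dist_real_def abs_le_iff abs_minus_commute)
  qed
  then have cM: "continuous_on {0..A} M" by (rule lipschitz_on_continuous_on)
  have M0: "M 0 \<le> pi / 2"
  proof -
    interpret trajectory W W1 W2 N \<eta> A 0 "\<Phi> 0" by (rule tr)
    have "\<Phi> 0 (X 0) \<le> 0" using \<phi>_decreasing[of 0 "X 0"] X(1)[of 0] \<phi>_0 by auto
    then have "M 0 \<le> 0" using X(1)[of 0] by (simp add: M_def mult_nonneg_nonpos)
    then show ?thesis using pi_gt_zero by linarith
  qed
  obtain r where r: "r \<in> {0..1}" "r * \<Phi> A r \<ge> pi / 2" using A(2)[OF tr] by blast
  then have "M A \<ge> pi / 2" using X(2)[OF r(1), of A] unfolding M_def by linarith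
  then obtain a where a: "0 \<le> a" "a \<le> A" "M a = pi / 2"
    using IVT'[of M 0 "pi/2" A] M0 cM A(1) by blast
  interpret trajectory W W1 W2 N \<eta> A a "\<Phi> a" by (rule tr)
  have le: "\<theta> r \<le> pi / 2" if "r \<in> {0..1}" for r
    using X(2)[OF that, of a] a(3) by (simp add: M_def \<theta>_def)
  have lt: "\<theta> r < pi / 2" if r: "0 \<le> r" "r < 1" for r
  proof (rule ccontr)
    assume "\<not> ?thesis"
    moreover have "continuous_on {0..r} (\<lambda>r. \<theta> r - pi / 2)"
      using r by (intro continuous_intros continuous_on_subset[OF c\<theta>]) auto
    ultimately obtain r0 where r0: "0 < r0" "r0 \<le> r" "\<theta> r0 - pi / 2 = 0" "\<And>t. 0 \<le> t \<Longrightarrow> t < r0 \<Longrightarrow> \<theta> t - pi / 2 < 0"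
      using first_zero[of 0 r "\<lambda>r. \<theta> r - pi / 2"] r pi_gt_zero by (auto simp: \<theta>_def)
    have r01: "r0 < 1" using r0 r by simp
    have "p r0 > 0" by (rule transversal[OF a(2) r0(1) r01]) (use r0 in auto)
    moreover have "(\<theta> has_real_derivative p r0) (at r0)" using d\<theta>[of r0] r0 r01 by (simp add: at_interior)
    ultimately obtain d where d: "d > 0" "\<And>h. 0 < h \<Longrightarrow> h < d \<Longrightarrow> \<theta> r0 < \<theta> (r0 + h)"
      using DERIV_pos_inc_right[of \<theta> "p r0" r0] by blast
    define t where "t = min (d/2) (1 - r0)"
    have "0 < t" "t < d" "r0 + t \<le> 1" using d(1) r01 by (auto simp: t_def)
    then show False using d(2)[of t] le[of "r0 + t"] r0 by auto
  qed
  have "X a = 1" using lt[of "X a"] X(1)[of a] a(3) by (force simp: M_def \<theta>_def)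
  then have "\<Phi> a 1 = pi / 2" using a(3) by (simp add: M_def)
  then show ?thesis using that[OF tr a(2)] lt by (simp add: \<theta>_def)
qed

text \<open>The test function is one positive half-period of \<open>chi\<close>, extended by zero.
  For it the second variation is the integral of
  \<open>(hardy_const N - (N-1) + r^2 w0) / r^2\<close> times \<open>u^2 r^(N-1)\<close>, whose
  coefficient is negative for small radii.\<close>

lemma instability:
  assumes N6: "N \<le> 6" shows "unstable_trivial N \<eta> W1"
proof -
  define w0 where "w0 = W1 0 / \<eta>^2"
  have w0: "w0 \<ge> 0" using W1_nonneg[of 0] by (simp add: w0_def)
  define b where "b = 1 / (2 * (1 + w0))"
  have b: "0 < b" "b < 1" using w0 by (auto simp: b_def field_simps)
  have small: "b^2 * w0 \<le> 1/4"
  proof -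
    have "4 * w0 \<le> (2 * (1 + w0))^2" using w0 by (simp add: power2_eq_square algebra_simps)
    moreover have "b^2 * w0 = w0 / (2 * (1 + w0))^2" by (simp add: b_def power_divide)
    ultimately show ?thesis using w0 by (simp add: pos_divide_le_eq)
  qed
  define R where "R = b / exp (2 * pi)"
  have be: "b = R * exp (2 * pi)" by (simp add: R_def)
  have R: "0 < R" "R < b" using b by (auto simp: R_def field_simps)
  define u where "u = chi N R"
  define u1 where "u1 = chi1 N R"
  have du: "(u has_real_derivative u1 r) (at r)" if "r > 0" for r
    unfolding u_def u1_def using that R by (intro chi_deriv)
  have uR: "u R = 0" and ub: "u b = 0" using chi_start[of R N] chi_end[of R N] R be by (auto simp: u_def)
  have cu: "continuous_on {R..b} u" by (rule DERIV_continuous_on[OF has_field_derivative_at_within[OF du]]) (use R in auto)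
  have cu1: "continuous_on {R..b} u1"
  proof -
    have "continuous_on {R..b} (\<lambda>r. r^(N-1) * u1 r)" unfolding u1_def
      by (rule DERIV_continuous_on[OF has_field_derivative_at_within[OF chi1_deriv]]) (use R N2 in auto)
    moreover have "continuous_on {R..b} (\<lambda>r. inverse (r^(N-1)))"
      using R by (intro continuous_intros) auto
    ultimately have "continuous_on {R..b} (\<lambda>r. inverse (r^(N-1)) * (r^(N-1) * u1 r))"
      by (rule continuous_on_mult[rotated])
    then show ?thesis by (rule continuous_on_eq) (use R in auto)
  qed
  \<comment> \<open>Clamping the argument extends \<open>u\<close> by zero, as \<open>u\<close>
    vanishes at both ends, and inherits its Lipschitz constant.\<close>
  define Q where "Q = (\<lambda>r. u (max R (min b r)))"
  define Q1 where "Q1 = (\<lambda>r. if r \<in> {R..b} then u1 r else 0)"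
  have Qin: "Q r = u r" if "r \<in> {R..b}" for r using that by (auto simp: Q_def max_def min_def)
  have Qout: "Q r = 0" if "r \<notin> {R..b}" for r
    using that R uR ub by (auto simp: Q_def max_def min_def)
  obtain L where L: "L \<ge> 0" "\<And>x y. x \<in> {R..b} \<Longrightarrow> y \<in> {R..b} \<Longrightarrow> \<bar>u x - u y\<bar> \<le> L * \<bar>x - y\<bar>"
    using C1_lipschitz[OF has_field_derivative_at_within[OF du] cu1] R by (metis atLeastAtMost_iff less_le_trans)
  have Qlip: "L-lipschitz_on UNIV Q"
  proof (rule lipschitz_onI[OF _ L(1)])
    fix x y :: real
    have "\<bar>Q x - Q y\<bar> \<le> L * \<bar>max R (min b x) - max R (min b y)\<bar>"
      unfolding Q_def using R by (intro L(2)) auto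
    also have "\<dots> \<le> L * \<bar>x - y\<bar>" by (intro mult_left_mono L(1)) (auto simp: max_def min_def)
    finally show "dist (Q x) (Q y) \<le> L * dist x y" by (simp add: dist_real_def)
  qed
  then have Qcont: "continuous_on S Q" for S
    using lipschitz_on_continuous_on continuous_on_subset by blast
  have dQ: "(Q has_real_derivative Q1 r) (at r)" if r: "r \<noteq> R" "r \<noteq> b" for r
  proof (cases "R < r \<and> r < b")
    case True
    then have "(u has_real_derivative u1 r) (at r)" using R by (intro du) auto
    then have "(Q has_real_derivative u1 r) (at r)"
      by (rule has_field_derivative_transform_within_open[where S="{R<..<b}"]) (use True Qin in auto)
    then show ?thesis using True by (simp add: Q1_def)
  next
    case False
    then have out: "r \<in> - {R..b}" using r by auto
    have "((\<lambda>_. 0) has_real_derivative 0) (at r)" by simp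
    then have "(Q has_real_derivative 0) (at r)"
      by (rule has_field_derivative_transform_within_open[where S="- {R..b}"]) (use out Qout in \<open>auto simp: open_Compl\<close>)
    then show ?thesis using out by (auto simp: Q1_def)
  qed
  have QI: "(Q1 has_integral (Q t - Q s)) {s..t}" if "s \<le> t" for s t
    by (rule fundamental_theorem_of_calculus_interior_strong[of "{R, b}"])
       (use that Qcont dQ in \<open>auto simp: has_real_derivative_iff_has_vector_derivative[symmetric]\<close>)
  have lipc: "Lipc_deriv Q Q1"
    unfolding Lipc_deriv_def using Qlip QI Qout R b by blast
  \<comment> \<open>The boundary term of the integration by parts: \<open>G' = F - D\<close>, and
    \<open>G\<close> vanishes at both ends, so the integrals of \<open>F\<close> and
    \<open>D\<close> agree.\<close>
  define G where "G = (\<lambda>r. r^(N-1) * u1 r * u r)"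
  define F where "F = (\<lambda>r. ((u1 r)^2 - (real N - 1) / r^2 * (u r)^2 + w0 * (u r)^2) * r^(N-1))"
  define D where "D = (\<lambda>r. (hardy_const N / r^2 - (real N - 1) / r^2 + w0) * (u r)^2 * r^(N-1))"
  have GI: "((\<lambda>r. F r - D r) has_integral (G b - G R)) {R..b}"
  proof (rule fundamental_theorem_of_calculus)
    fix r assume r: "r \<in> {R..b}"
    then have r0: "r > 0" using R by auto
    have "(G has_real_derivative (- (r^(N-1) * (hardy_const N / r^2 * u r))) * u r + u1 r * (r^(N-1) * u1 r)) (at r)"
      unfolding G_def using du[OF r0] chi1_deriv[OF r0 R(1), of N] N2
      by (intro DERIV_mult) (auto simp: u_def u1_def)
    moreover have "(- (r^(N-1) * (hardy_const N / r^2 * u r))) * u r + u1 r * (r^(N-1) * u1 r) = F r - D r"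
      unfolding F_def D_def by (simp add: algebra_simps power2_eq_square add_divide_distrib diff_divide_distrib)
    ultimately show "(G has_vector_derivative F r - D r) (at r within {R..b})"
      by (simp add: has_real_derivative_iff_has_vector_derivative[symmetric] has_field_derivative_at_within)
  qed (use R in simp)
  have G0: "G b - G R = 0" using uR ub by (simp add: G_def)
  define K where "K = (\<lambda>r. 1/2 / r^2 * (u r)^2 * r^(N-1))"
  have cK: "continuous_on {R..b} K" unfolding K_def using R by (intro continuous_intros cu) auto
  have cD: "continuous_on {R..b} D" unfolding D_def using R by (intro continuous_intros cu) auto
  have Kpos: "integral {R..b} K > 0"
  proof -
    have Knn: "K r \<ge> 0" if "r \<in> {R..b}" for r using that R by (auto simp: K_def)
    have "integral {R..b} K \<ge> 0" using Knn cK by (intro integral_nonneg integrable_continuous_real) auto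
    moreover have "integral {R..b} K \<noteq> 0"
    proof
      assume "integral {R..b} K = 0"
      then have "K ((R + b) / 2) = 0"
        using integral_eq_0_iff[of R b K] cK R Knn by auto
      moreover have "u ((R + b) / 2) > 0" unfolding u_def using R be by (intro chi_pos) auto
      moreover have "(R + b) / 2 > 0" using R by simp
      ultimately show False by (simp add: K_def)
    qed
    ultimately show ?thesis by simp
  qed
  \<comment> \<open>The margins combine to \<open>-3/4 + 1/4 = -1/2\<close>.\<close>
  have "integral {R..b} D \<le> integral {R..b} (\<lambda>r. - K r)"
  proof (rule integral_le)
    fix r assume r: "r \<in> {R..b}"
    then have r0: "r > 0" using R by auto
    have "r^2 * w0 \<le> b^2 * w0" using r r0 w0 by (intro mult_right_mono power_mono) auto
    then have "r^2 * w0 \<le> 1/4" using small by simp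
    then have "hardy_const N - (real N - 1) + r^2 * w0 \<le> - (1/2)" using hardy_const_le(2)[OF N2 N6] by simp
    then have "(hardy_const N - (real N - 1) + r^2 * w0) / r^2 \<le> - (1/2) / r^2" by (rule divide_right_mono) simp
    moreover have "(hardy_const N - (real N - 1) + r^2 * w0) / r^2 = hardy_const N / r^2 - (real N - 1) / r^2 + w0"
      using r0 by (simp add: field_simps)
    ultimately have "(hardy_const N / r^2 - (real N - 1) / r^2 + w0) * ((u r)^2 * r^(N-1)) \<le> - (1/2) / r^2 * ((u r)^2 * r^(N-1))"
      using r0 by (intro mult_right_mono) auto
    then show "D r \<le> - K r" by (simp add: D_def K_def mult.assoc)
  qed (use cD cK in \<open>auto intro!: integrable_continuous_real continuous_intros\<close>)
  then have Dneg: "integral {R..b} D < 0" using Kpos by simp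
  have "((\<lambda>r. (F r - D r) + D r) has_integral (G b - G R) + integral {R..b} D) {R..b}"
    using cD by (intro has_integral_add GI integrable_integral integrable_continuous_real)
  then have FI: "(F has_integral integral {R..b} D) {R..b}" using G0 by simp
  define I where "I = (\<lambda>r. ((Q1 r)^2 - (real N - 1) / r^2 * (Q r)^2 + W1 0 / \<eta>^2 * (Q r)^2) * r^(N-1))"
  have IF: "I = (\<lambda>r. if r \<in> {R..b} then F r else 0)"
    by (rule ext) (auto simp: I_def F_def w0_def Q1_def Qin Qout)
  have "(I has_integral integral {R..b} D) {0<..<1}"
    unfolding IF using FI R b by (subst has_integral_restrict) auto
  then have "integral {0<..<1} I < 0" using Dneg by (simp add: integral_unique)
  then show ?thesis using lipc unfolding unstable_trivial_def I_def by blast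
qed

end

section \<open>Existence and regularity\<close>

context trajectory begin

definition \<phi>1 :: "real \<Rightarrow> real" where "\<phi>1 r = r * q r"
definition \<phi>2 :: "real \<Rightarrow> real" where "\<phi>2 r = h r - (real N + 1) * q r"

text \<open>At \<open>r = 0\<close> the difference quotient of \<open>r q\<close> is
  \<open>q\<close> itself, and \<open>q 0 = h 0 / (N + 2)\<close> makes its limit equal to
  \<open>\<phi>2 0\<close>.\<close>

lemma d\<phi>1:
  assumes r: "r \<in> {0..1}" shows "(\<phi>1 has_real_derivative \<phi>2 r) (at r within {0..1})"
proof (cases "r = 0")
  case True
  have "(q \<longlongrightarrow> q 0) (at 0 within {0..1})" using cq by (simp add: continuous_on_def)
  moreover have "\<forall>\<^sub>F y in at 0 within {0..1::real}. q y = (y * q y - 0 * q 0) / (y - 0)"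
    by (auto simp: eventually_at_filter)
  ultimately have "((\<lambda>y. (y * q y - 0 * q 0) / (y - 0)) \<longlongrightarrow> q 0) (at 0 within {0..1})"
    by (rule Lim_transform_eventually)
  then have "((\<lambda>r. r * q r) has_real_derivative q 0) (at 0 within {0..1})"
    by (simp add: has_field_derivative_iff)
  moreover have "q 0 = \<phi>2 0" unfolding \<phi>2_def q_0 by (simp add: field_simps)
  ultimately show ?thesis using True by (simp add: \<phi>1_def[abs_def])
next
  case False
  then have r0: "0 < r" "r \<le> 1" using r by auto
  have "((\<lambda>r. r * q r) has_real_derivative 1 * q r + (h r - (real N + 2) * q r) / r * r) (at r within {0..1})"
    by (intro DERIV_mult DERIV_ident dq r0)
  moreover have "1 * q r + (h r - (real N + 2) * q r) / r * r = \<phi>2 r"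
  proof -
    have "(h r - (real N + 2) * q r) / r * r = h r - (real N + 2) * q r" using r0 by simp
    then show ?thesis unfolding \<phi>2_def by (simp only:) (simp add: algebra_simps)
  qed
  ultimately show ?thesis by (simp add: \<phi>1_def[abs_def])
qed

text \<open>The second derivative of the angle without negative powers of \<open>r\<close>, hence
  continuous up to the origin.\<close>

definition p1 :: "real \<Rightarrow> real" where "p1 r = 2 * \<phi>1 r + r * \<phi>2 r"

lemma dp1:
  assumes r: "r \<in> {0..1}" shows "(p has_real_derivative p1 r) (at r within {0..1})"
proof -
  have "((\<lambda>r. \<phi> r + r * \<phi>1 r) has_real_derivative \<phi>1 r + (1 * \<phi>1 r + \<phi>2 r * r)) (at r within {0..1})"
    using d\<phi>[OF r] by (intro DERIV_add DERIV_mult DERIV_ident d\<phi>1 r) (simp add: \<phi>1_def)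
  then show ?thesis by (simp add: p_def[abs_def] \<phi>1_def p1_def power2_eq_square algebra_simps)
qed

lemma c\<phi>12: "continuous_on {0..1} \<phi>1" "continuous_on {0..1} \<phi>2" "continuous_on {0..1} p1"
proof -
  show 1: "continuous_on {0..1} \<phi>1" "continuous_on {0..1} \<phi>2"
    unfolding \<phi>1_def[abs_def] \<phi>2_def[abs_def] by (intro continuous_intros cq ch)+
  show "continuous_on {0..1} p1" unfolding p1_def[abs_def] by (intro continuous_intros 1)
qed

lemma C2_cos: "C2_closed01 (\<lambda>r. cos (\<theta> r))"
  unfolding C2_closed01_def
proof (intro exI conjI ballI)
  fix r :: real assume r: "r \<in> {0..1}"
  show "((\<lambda>r. cos (\<theta> r)) has_real_derivative - sin (\<theta> r) * p r) (at r within {0..1})"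
    by (auto intro!: derivative_eq_intros d\<theta> r)
  show "((\<lambda>r. - sin (\<theta> r) * p r) has_real_derivative - cos (\<theta> r) * p r * p r - sin (\<theta> r) * p1 r) (at r within {0..1})"
    by (auto intro!: derivative_eq_intros d\<theta> dp1 r)
next
  show "continuous_on {0..1} (\<lambda>r. - cos (\<theta> r) * p r * p r - sin (\<theta> r) * p1 r)"
    by (intro continuous_intros c\<theta> cp c\<phi>12)
qed

text \<open>This is the extension of \<open>sin \<theta> / r\<close> across the origin.\<close>

lemma C2_sin_div: "C2_closed01 (\<lambda>r. \<phi> r * sinc (\<theta> r))"
proof -
  obtain s1 s2 where s: "\<And>x. (sinc has_real_derivative s1 x) (at x)" "\<And>x. (s1 has_real_derivative s2 x) (at x)"
    "continuous_on UNIV s2" using sinc_C2 by blast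
  have cs: "continuous_on UNIV s1" "continuous_on UNIV sinc"
    using s(1,2) by (auto intro!: DERIV_continuous_on)
  have ds: "((\<lambda>r. sinc (\<theta> r)) has_real_derivative s1 (\<theta> r) * p r) (at r within {0..1})"
    "((\<lambda>r. s1 (\<theta> r)) has_real_derivative s2 (\<theta> r) * p r) (at r within {0..1})" if "r \<in> {0..1}" for r
    by (rule DERIV_chain2[OF s(1) d\<theta>[OF that]] DERIV_chain2[OF s(2) d\<theta>[OF that]])+
  have d\<phi>': "(\<phi> has_real_derivative \<phi>1 r) (at r within {0..1})" if "r \<in> {0..1}" for r
    using d\<phi>[OF that] by (simp add: \<phi>1_def)
  show ?thesis unfolding C2_closed01_def
  proof (intro exI conjI ballI)
    fix r :: real assume r: "r \<in> {0..1}"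
    show "((\<lambda>r. \<phi> r * sinc (\<theta> r)) has_real_derivative \<phi>1 r * sinc (\<theta> r) + s1 (\<theta> r) * p r * \<phi> r) (at r within {0..1})"
      by (intro DERIV_mult d\<phi>' ds r)
    show "((\<lambda>r. \<phi>1 r * sinc (\<theta> r) + s1 (\<theta> r) * p r * \<phi> r) has_real_derivative
        (\<phi>2 r * sinc (\<theta> r) + s1 (\<theta> r) * p r * \<phi>1 r)
        + ((s2 (\<theta> r) * p r * p r + p1 r * s1 (\<theta> r)) * \<phi> r + \<phi>1 r * (s1 (\<theta> r) * p r))) (at r within {0..1})"
      by (intro DERIV_add DERIV_mult d\<phi>' d\<phi>1 ds dp1 r)
  next
    show "continuous_on {0..1} (\<lambda>r. (\<phi>2 r * sinc (\<theta> r) + s1 (\<theta> r) * p r * \<phi>1 r)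
        + ((s2 (\<theta> r) * p r * p r + p1 r * s1 (\<theta> r)) * \<phi> r + \<phi>1 r * (s1 (\<theta> r) * p r)))"
      by (intro continuous_intros c\<phi>12 c\<phi> cp continuous_on_compose2[OF cs(1) c\<theta>] continuous_on_compose2[OF cs(2) c\<theta>]
          continuous_on_compose2[OF s(3) c\<theta>]) auto
  qed
qed

lemma MM_solution_angle:
  assumes aA: "a \<le> A" and end1: "\<phi> 1 = pi / 2" and below: "\<And>r. 0 \<le> r \<Longrightarrow> r < 1 \<Longrightarrow> r * \<phi> r < pi / 2"
  shows "MM_solution N \<eta> W1 (\<lambda>r. sin (\<theta> r)) (\<lambda>r. cos (\<theta> r))"
    and "\<And>r. 0 < r \<Longrightarrow> r < 1 \<Longrightarrow> cos (\<theta> r) > 0"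
proof -
  have \<phi>pos: "\<phi> r > 0" if "0 \<le> r" "r \<le> 1" for r
    using \<phi>_decreasing[of r 1] that end1 pi_gt_zero by linarith
  have reg: "regular r" if "0 < r" "r < 1" for r
    using regular_before[OF aA, of r 1] that end1 below[of r] by (auto simp: \<theta>_def)
  show "cos (\<theta> r) > 0" if r: "0 < r" "r < 1" for r
  proof -
    have "0 \<le> \<theta> r" using \<phi>pos[of r] r by (simp add: \<theta>_def)
    then show ?thesis using below[of r] r pi_gt_zero by (intro cos_gt_zero_pi) (auto simp: \<theta>_def)
  qed
  have dt: "(\<theta> has_real_derivative p r) (at r)" if "0 < r" "r < 1" for r
    using d\<theta>[of r] that by (simp add: at_interior)
  have dpa: "(p has_real_derivative p1 r) (at r)" if "0 < r" "r < 1" for r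
    using dp1[of r] that by (simp add: at_interior)
  \<comment> \<open>The regular and the singular expression are both derivatives of
    \<open>p\<close>; equating them recovers the angle equation for \<open>p1\<close>.\<close>
  have p1: "p1 r = - (real N - 1) / r * p r + sin (\<theta> r) * cos (\<theta> r) * ((real N - 1) / r^2 - wx (\<theta> r))" if "0 < r" "r < 1" for r
  proof (rule DERIV_unique[OF dpa[OF that]])
    show "(p has_real_derivative - (real N - 1) / r * p r + sin (\<theta> r) * cos (\<theta> r) * ((real N - 1) / r^2 - wx (\<theta> r))) (at r)"
      using dp[of r] reg[OF that] that by (simp add: at_interior)
  qed
  define f where "f = (\<lambda>r. sin (\<theta> r))"
  define g where "g = (\<lambda>r. cos (\<theta> r))"
  define f1 where "f1 = (\<lambda>r. cos (\<theta> r) * p r)"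
  define g1 where "g1 = (\<lambda>r. - sin (\<theta> r) * p r)"
  define f2 where "f2 = (\<lambda>r. - sin (\<theta> r) * p r * p r + p1 r * cos (\<theta> r))"
  define g2 where "g2 = (\<lambda>r. - cos (\<theta> r) * p r * p r - sin (\<theta> r) * p1 r)"
  have D: "(f has_real_derivative f1 r) (at r)" "(f1 has_real_derivative f2 r) (at r)"
    "(g has_real_derivative g1 r) (at r)" "(g1 has_real_derivative g2 r) (at r)" if r: "0 < r" "r < 1" for r
    unfolding f_def f1_def f2_def g_def g1_def g2_def
    by (auto intro!: derivative_eq_intros dt[OF r] dpa[OF r])
  have cfg: "continuous_on {0..1} f" "continuous_on {0..1} g" "continuous_on {0..1} f1" "continuous_on {0..1} g1"
    unfolding f_def f1_def g_def g1_def by (intro continuous_intros c\<theta> cp)+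
  have cs: "continuous_on UNIV sinc" unfolding sinc_def by (intro powser_cont entire_coeffs_Suc entire_sin)
  have ci: "u integrable_on {0<..<1}" if "continuous_on {0..1} u" for u :: "real \<Rightarrow> real"
    using integrable_continuous_real[OF that] by (simp add: integrable_on_open_interval_real)
  have ftc: "(u1 has_integral (u b - u a)) {a..b}"
    if u: "\<And>r. 0 < r \<Longrightarrow> r < 1 \<Longrightarrow> (u has_real_derivative u1 r) (at r)" and ab: "0 < a" "a \<le> b" "b < 1" for u u1 a b
  proof (rule fundamental_theorem_of_calculus[OF ab(2)])
    fix x assume "x \<in> {a..b}"
    then show "(u has_vector_derivative u1 x) (at x within {a..b})"
      using u[of x] ab by (simp add: has_real_derivative_iff_has_vector_derivative has_vector_derivative_at_within)
  qed
  have BMM: "BMM N f f1 g g1"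
    unfolding BMM_def
  proof (intro conjI allI impI ballI)
    fix a b :: real assume ab: "0 < a \<and> a \<le> b \<and> b < 1"
    show "(f1 has_integral (f b - f a)) {a..b}" "(g1 has_integral (g b - g a)) {a..b}"
      using ab by (blast intro: ftc[OF D(1)] ftc[OF D(3)])+
  next
    show "(\<lambda>r. (f1 r)^2 * r^(N-1)) integrable_on {0<..<1}" "(\<lambda>r. (g1 r)^2 * r^(N-1)) integrable_on {0<..<1}"
      "(\<lambda>r. (g r)^2 * r^(N-1)) integrable_on {0<..<1}"
      by (intro ci continuous_intros cfg)+
    have "(\<lambda>r. (\<phi> r * sinc (\<theta> r))^2 * r^(N-1)) integrable_on {0<..<1}"
      by (intro ci continuous_intros c\<phi> continuous_on_compose2[OF cs c\<theta>]) auto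
    then show "(\<lambda>r. (f r)^2 / r^2 * r^(N-1)) integrable_on {0<..<1}"
    proof (rule integrable_eq)
      fix r :: real assume "r \<in> {0<..<1}"
      moreover have "f r = r * (\<phi> r * sinc (\<theta> r))" unfolding f_def sin_sinc[of "\<theta> r"] by (simp add: \<theta>_def)
      ultimately show "(\<phi> r * sinc (\<theta> r))^2 * r^(N-1) = (f r)^2 / r^2 * r^(N-1)"
        by (simp add: power_mult_distrib)
    qed
    fix r show "(f r)^2 + (g r)^2 = 1" by (simp add: f_def g_def)
  next
    have l: "at 1 within {0..1::real} = at_left 1" by (rule at_within_Icc_at_left) simp
    have t1: "\<theta> 1 = pi / 2" using end1 by (simp add: \<theta>_def)
    have "(f \<longlongrightarrow> f 1) (at 1 within {0..1})" "(g \<longlongrightarrow> g 1) (at 1 within {0..1})"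
      using cfg(1,2) by (auto simp: continuous_on_def)
    then show "(f \<longlongrightarrow> 1) (at_left 1)" "(g \<longlongrightarrow> 0) (at_left 1)"
      unfolding l by (auto simp: f_def g_def t1)
  qed
  have "f2 r + (real N - 1) / r * f1 r - (real N - 1) / r^2 * f r
          = - ((f1 r)^2 + (real N - 1) / r^2 * (f r)^2 + (g1 r)^2 + W1 ((g r)^2) * (g r)^2 / \<eta>^2) * f r"
       "g2 r + (real N - 1) / r * g1 r = W1 ((g r)^2) * g r / \<eta>^2
          - ((f1 r)^2 + (real N - 1) / r^2 * (f r)^2 + (g1 r)^2 + W1 ((g r)^2) * (g r)^2 / \<eta>^2) * g r"
    if r: "0 < r" "r < 1" for r
  proof -
    define S where "S = sin (\<theta> r)"
    define C where "C = cos (\<theta> r)"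
    define w where "w = wx (\<theta> r)"
    define x where "x = p r"
    define k where "k = (real N - 1) / r"
    define e where "e = (real N - 1) / r^2"
    have SC: "S * S = 1 - C * C" using sin_cos_squared_add[of "\<theta> r"] by (simp add: S_def C_def power2_eq_square)
    have "(f1 r)^2 + e * (f r)^2 + (g1 r)^2 + W1 ((g r)^2) * (g r)^2 / \<eta>^2 = (C * x)^2 + e * S^2 + (S * x)^2 + w * C^2"
      unfolding f_def g_def f1_def g1_def w_def wx_def S_def C_def x_def by simp
    also have "\<dots> = x * x + e * (1 - C * C) + w * (C * C)"
      using SC by (simp add: power2_eq_square algebra_simps) algebra
    finally have lam: "(f1 r)^2 + e * (f r)^2 + (g1 r)^2 + W1 ((g r)^2) * (g r)^2 / \<eta>^2 = x * x + e * (1 - C * C) + w * (C * C)" .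
    have P: "p1 r = - k * x + S * C * (e - w)"
      unfolding S_def C_def w_def x_def k_def e_def minus_divide_left by (rule p1[OF r])
    have v: "f2 r = - S * x * x + p1 r * C" "g2 r = - C * x * x - S * p1 r" "f1 r = C * x" "g1 r = - S * x" "f r = S" "g r = C"
      by (simp_all add: f_def g_def f1_def g1_def f2_def g2_def S_def C_def x_def)
    have wg: "W1 ((g r)^2) * g r / \<eta>^2 = w * C" by (simp add: g_def w_def wx_def C_def)
    show "f2 r + (real N - 1) / r * f1 r - (real N - 1) / r^2 * f r
          = - ((f1 r)^2 + (real N - 1) / r^2 * (f r)^2 + (g1 r)^2 + W1 ((g r)^2) * (g r)^2 / \<eta>^2) * f r"
      unfolding e_def[symmetric] k_def[symmetric] lam unfolding v P by (simp add: algebra_simps)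
    have "- C * x * x - S * p1 r + k * (- S * x) = - C * x * x - (S * S) * C * (e - w)"
      unfolding P by (simp add: algebra_simps)
    then show "g2 r + (real N - 1) / r * g1 r = W1 ((g r)^2) * g r / \<eta>^2
          - ((f1 r)^2 + (real N - 1) / r^2 * (f r)^2 + (g1 r)^2 + W1 ((g r)^2) * (g r)^2 / \<eta>^2) * g r"
      unfolding e_def[symmetric] k_def[symmetric] lam wg unfolding v SC by (simp add: algebra_simps)
  qed
  with D BMM show "MM_solution N \<eta> W1 (\<lambda>r. sin (\<theta> r)) (\<lambda>r. cos (\<theta> r))"
    unfolding MM_solution_def Let_def f_def[symmetric] g_def[symmetric]
    by (intro exI[of _ f1] exI[of _ f2] exI[of _ g1] exI[of _ g2]) auto
qed

end

lemma (in shooting) ex_solution: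
  assumes "N \<le> 6"
  obtains f g F where "MM_solution N \<eta> W1 f g" "\<And>r. 0 < r \<Longrightarrow> r < 1 \<Longrightarrow> g r > 0"
    "C2_closed01 g" "C2_closed01 F" "\<And>r. 0 < r \<Longrightarrow> r < 1 \<Longrightarrow> F r = f r / r"
proof -
  obtain A a \<phi> where t: "trajectory W W1 W2 N \<eta> A a \<phi>" "a \<le> A" "\<phi> 1 = pi / 2"
    "\<And>r. 0 \<le> r \<Longrightarrow> r < 1 \<Longrightarrow> r * \<phi> r < pi / 2"
    using ex_solution_trajectory[OF assms] by metis
  interpret trajectory W W1 W2 N \<eta> A a \<phi> by (rule t)
  show ?thesis
  proof (rule that[OF MM_solution_angle[OF t(2,3,4)] C2_cos C2_sin_div])
    show "\<phi> r * sinc (\<theta> r) = sin (\<theta> r) / r" if "0 < r" for r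
      using that sin_sinc[of "\<theta> r"] by (simp add: \<theta>_def)
  qed auto
qed

section \<open>Minimizers, the trivial solution and assembly\<close>

lemma (in potential) mm_posI:
  assumes sol: "MM_solution N \<eta> W1 f g" and pos: "\<forall>r\<in>{0<..<1}. g r > 0" and "N \<ge> 2" "\<eta> > 0"
  obtains f1 f2 g1 g2 where "mm_pos W W1 W2 N \<eta> f g f1 f2 g1 g2"
proof -
  obtain f1 f2 g1 g2 where s: "\<forall>r\<in>{0<..<1}.
           (f has_real_derivative f1 r) (at r) \<and> (f1 has_real_derivative f2 r) (at r) \<and>
           (g has_real_derivative g1 r) (at r) \<and> (g1 has_real_derivative g2 r) (at r) \<and>
           (f2 r + (real N - 1) / r * f1 r - (real N - 1) / r^2 * f r
              = - ((f1 r)^2 + (real N - 1) / r^2 * (f r)^2 + (g1 r)^2 + W1 ((g r)^2) * (g r)^2 / \<eta>^2) * f r \<and>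
            g2 r + (real N - 1) / r * g1 r = W1 ((g r)^2) * g r / \<eta>^2
              - ((f1 r)^2 + (real N - 1) / r^2 * (f r)^2 + (g1 r)^2 + W1 ((g r)^2) * (g r)^2 / \<eta>^2) * g r)"
    and b: "BMM N f f1 g g1"
    using sol unfolding MM_solution_def Let_def by blast
  have "mm_pos W W1 W2 N \<eta> f g f1 f2 g1 g2"
    by unfold_locales (use s b pos assms(3,4) in auto)
  then show ?thesis by (rule that)
qed

lemma (in mm_pos) BMM_neg: "BMM N f f1 (\<lambda>r. - g r) (\<lambda>r. - g1 r)"
proof -
  have "((\<lambda>r. - g1 r) has_integral (- g b - - g a)) {a..b}" if "0 < a" "a \<le> b" "b < 1" for a b
    using has_integral_neg[OF BMM_D(2)[OF bmm that]] by simp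
  moreover have "((\<lambda>r. - g r) \<longlongrightarrow> 0) (at_left 1)" using tendsto_minus[OF BMM_D(8)[OF bmm]] by simp
  ultimately show ?thesis using bmm unfolding BMM_def by simp
qed

lemma (in mm_pos) minimizers:
  "MM_minimizer N \<eta> W f g" "MM_minimizer N \<eta> W f (\<lambda>r. - g r)"
proof -
  show "MM_minimizer N \<eta> W f g" unfolding MM_minimizer_def using bmm minimal by blast
  have "IMM N \<eta> W f f1 (\<lambda>r. - g r) (\<lambda>r. - g1 r) = IMM N \<eta> W f f1 g g1" by (simp add: IMM_def)
  then show "MM_minimizer N \<eta> W f (\<lambda>r. - g r)" unfolding MM_minimizer_def using BMM_neg minimal by metis
qed

lemma (in mm_pos) minimizer_unique:
  assumes "MM_minimizer N \<eta> W h k"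
  shows "(\<forall>r\<in>{0<..<1}. h r = f r \<and> k r = g r) \<or> (\<forall>r\<in>{0<..<1}. h r = f r \<and> k r = - g r)"
  using assms equality_case bmm unfolding MM_minimizer_def by blast

text \<open>The energy density of the constant map behaves like \<open>r^(N-3)\<close>, integrable
  for \<open>N \<ge> 3\<close>; for \<open>N = 2\<close> it would be \<open>1/r\<close>.\<close>

lemma MM_solution_trivial:
  assumes "N \<ge> 3" shows "MM_solution N \<eta> W1 (\<lambda>_. 1) (\<lambda>_. 0)"
proof -
  have "(\<lambda>r::real. r^(N-3)) integrable_on {0<..<1}"
    unfolding integrable_on_open_interval_real by (intro integrable_continuous_real continuous_intros)
  then have "(\<lambda>r::real. 1^2 / r^2 * r^(N-1)) integrable_on {0<..<1}"
  proof (rule integrable_eq)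
    fix r :: real assume "r \<in> {0<..<1}"
    moreover have "N - 1 = (N - 3) + 2" using assms by simp
    then have "r^(N-1) = r^(N-3) * r^2" by (metis power_add)
    ultimately show "r^(N-3) = 1^2 / r^2 * r^(N-1)" by simp
  qed
  then have "BMM N (\<lambda>_. 1) (\<lambda>_. 0) (\<lambda>_. 0) (\<lambda>_. 0)"
    unfolding BMM_def by (simp add: integrable_0)
  then show ?thesis unfolding MM_solution_def Let_def
    by (intro exI[of _ "\<lambda>_. 0"]) (simp add: divide_simps)
qed

theorem theorem2p6:
  fixes N :: nat and W W1 W2 :: "real \<Rightarrow> real"
  assumes W_d1: "\<And>x. x \<ge> 0 \<Longrightarrow> (W has_real_derivative W1 x) (at x within {0..})"
    and W_d2: "\<And>x. x \<ge> 0 \<Longrightarrow> (W1 has_real_derivative W2 x) (at x within {0..})"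
    and W_C2: "continuous_on {0..} W2"
    and W0: "W 0 = 0"
    and W_nonneg: "\<And>x. x \<ge> 0 \<Longrightarrow> W x \<ge> 0"
    and W2_nonneg: "\<And>x. x > 0 \<Longrightarrow> W2 x \<ge> 0"
  shows "(N \<ge> 7 \<longrightarrow>
            (\<forall>\<eta>>0. \<not> (\<exists>f g. MM_solution N \<eta> W1 f g \<and> (\<forall>r\<in>{0<..<1}. g r > 0))))
       \<and> (2 \<le> N \<and> N \<le> 6 \<longrightarrow>
            (\<forall>\<eta>>0. \<exists>f g. MM_solution N \<eta> W1 f g \<and> (\<forall>r\<in>{0<..<1}. g r > 0) \<and>
               (\<forall>f' g'. MM_solution N \<eta> W1 f' g' \<and> (\<forall>r\<in>{0<..<1}. g' r > 0) \<longrightarrow>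
                   (\<forall>r\<in>{0<..<1}. f' r = f r \<and> g' r = g r)) \<and>
               MM_minimizer N \<eta> W f g \<and> MM_minimizer N \<eta> W f (\<lambda>r. - g r) \<and>
               (\<forall>h k. MM_minimizer N \<eta> W h k \<longrightarrow>
                   (\<forall>r\<in>{0<..<1}. h r = f r \<and> k r = g r) \<or>
                   (\<forall>r\<in>{0<..<1}. h r = f r \<and> k r = - g r)) \<and>
               (\<exists>F. C2_closed01 F \<and> (\<forall>r\<in>{0<..<1}. F r = f r / r)) \<and>
               (\<exists>G. C2_closed01 G \<and> (\<forall>r\<in>{0<..<1}. G r = g r)) \<and>
               (\<forall>r\<in>{0<..<1}. f r > 0 \<and> deriv f r > 0 \<and> deriv g r < 0) \<and>
               (3 \<le> N \<longrightarrow> MM_solution N \<eta> W1 (\<lambda>_. 1) (\<lambda>_. 0) \<and> unstable_trivial N \<eta> W1)))"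
proof (intro conjI impI allI)
  interpret potential W W1 W2 by unfold_locales (fact assms)+
  show "\<not> (\<exists>f g. MM_solution N \<eta> W1 f g \<and> (\<forall>r\<in>{0<..<1}. g r > 0))" if "N \<ge> 7" "\<eta> > 0" for \<eta> :: real
  proof
    assume "\<exists>f g. MM_solution N \<eta> W1 f g \<and> (\<forall>r\<in>{0<..<1}. g r > 0)"
    then obtain f g where sol: "MM_solution N \<eta> W1 f g" "\<forall>r\<in>{0<..<1}. g r > 0" by blast
    have "N \<ge> 2" using that(1) by simp
    from mm_posI[OF sol this that(2)] obtain f1 f2 g1 g2 where "mm_pos W W1 W2 N \<eta> f g f1 f2 g1 g2" by blast
    from mm_pos.dim_le_6[OF this] show False using that(1) by simp
  qed
  fix \<eta> :: real assume N: "2 \<le> N \<and> N \<le> 6" and eta: "\<eta> > 0"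
  interpret shooting W W1 W2 N \<eta> by unfold_locales (use N eta in auto)
  obtain f g F where s: "MM_solution N \<eta> W1 f g" "\<And>r. 0 < r \<Longrightarrow> r < 1 \<Longrightarrow> g r > 0"
    "C2_closed01 g" "C2_closed01 F" "\<And>r. 0 < r \<Longrightarrow> r < 1 \<Longrightarrow> F r = f r / r"
    using ex_solution N by metis
  have s2: "\<forall>r\<in>{0<..<1}. g r > 0" using s(2) by simp
  obtain f1 f2 g1 g2 where mm: "mm_pos W W1 W2 N \<eta> f g f1 f2 g1 g2"
    using mm_posI[OF s(1) s2 N2 eta] by blast
  interpret mm_pos W W1 W2 N \<eta> f g f1 f2 g1 g2 by (rule mm)
  \<comment> \<open>Any positive solution is itself a minimizer, hence one of the two known ones;
    its positivity excludes the reflected branch.\<close>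
  have uniq: "\<forall>r\<in>{0<..<1}. f' r = f r \<and> g' r = g r"
    if sol: "MM_solution N \<eta> W1 f' g'" "\<forall>r\<in>{0<..<1}. g' r > 0" for f' g'
  proof -
    obtain f1' f2' g1' g2' where "mm_pos W W1 W2 N \<eta> f' g' f1' f2' g1' g2'"
      using mm_posI[OF sol N2 eta] by blast
    then have "MM_minimizer N \<eta> W f' g'" by (rule mm_pos.minimizers)
    from minimizer_unique[OF this] show ?thesis
    proof
      assume "\<forall>r\<in>{0<..<1}. f' r = f r \<and> g' r = - g r"
      then have "g' (1/2) = - g (1/2)" by simp
      moreover have "g' (1/2) > 0" "g (1/2) > 0" using sol(2) s(2) by auto
      ultimately show ?thesis by simp
    qed
  qed
  have sgn: "f r > 0 \<and> deriv f r > 0 \<and> deriv g r < 0" if "r \<in> {0<..<1}" for r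
  proof -
    have r: "0 < r" "r < 1" using that by auto
    show ?thesis using DERIV_imp_deriv[OF df'[OF r]] DERIV_imp_deriv[OF dg'[OF r]]
      f_pos[OF r] p_pos[OF r] g_pos[OF r] by simp
  qed
  show "\<exists>f g. MM_solution N \<eta> W1 f g \<and> (\<forall>r\<in>{0<..<1}. g r > 0) \<and>
               (\<forall>f' g'. MM_solution N \<eta> W1 f' g' \<and> (\<forall>r\<in>{0<..<1}. g' r > 0) \<longrightarrow>
                   (\<forall>r\<in>{0<..<1}. f' r = f r \<and> g' r = g r)) \<and>
               MM_minimizer N \<eta> W f g \<and> MM_minimizer N \<eta> W f (\<lambda>r. - g r) \<and>
               (\<forall>h k. MM_minimizer N \<eta> W h k \<longrightarrow>
                   (\<forall>r\<in>{0<..<1}. h r = f r \<and> k r = g r) \<or>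
                   (\<forall>r\<in>{0<..<1}. h r = f r \<and> k r = - g r)) \<and>
               (\<exists>F. C2_closed01 F \<and> (\<forall>r\<in>{0<..<1}. F r = f r / r)) \<and>
               (\<exists>G. C2_closed01 G \<and> (\<forall>r\<in>{0<..<1}. G r = g r)) \<and>
               (\<forall>r\<in>{0<..<1}. f r > 0 \<and> deriv f r > 0 \<and> deriv g r < 0) \<and>
               (3 \<le> N \<longrightarrow> MM_solution N \<eta> W1 (\<lambda>_. 1) (\<lambda>_. 0) \<and> unstable_trivial N \<eta> W1)"
  proof (rule exI[of _ f], rule exI[of _ g], intro conjI)
    show "\<exists>F. C2_closed01 F \<and> (\<forall>r\<in>{0<..<1}. F r = f r / r)" using s(4,5) by auto
    show "\<exists>G. C2_closed01 G \<and> (\<forall>r\<in>{0<..<1}. G r = g r)" using s(3) by auto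
    show "3 \<le> N \<longrightarrow> MM_solution N \<eta> W1 (\<lambda>_. 1) (\<lambda>_. 0) \<and> unstable_trivial N \<eta> W1"
      using MM_solution_trivial instability N by blast
    show "\<forall>f' g'. MM_solution N \<eta> W1 f' g' \<and> (\<forall>r\<in>{0<..<1}. g' r > 0) \<longrightarrow>
        (\<forall>r\<in>{0<..<1}. f' r = f r \<and> g' r = g r)" using uniq by blast
    show "\<forall>h k. MM_minimizer N \<eta> W h k \<longrightarrow> (\<forall>r\<in>{0<..<1}. h r = f r \<and> k r = g r) \<or>
        (\<forall>r\<in>{0<..<1}. h r = f r \<and> k r = - g r)" using minimizer_unique by blast
    show "\<forall>r\<in>{0<..<1}. f r > 0 \<and> deriv f r > 0 \<and> deriv g r < 0" using sgn by blast
  qed (rule s(1) s2 minimizers)+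
qed

end
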